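(* Let $1\le p<\infty$ and let $T:X_1\times\cdots\times X_n\to Y$ be an $n$-linear operator between Banach spaces (over the same field $\mathbb R$ or $\mathbb C$). The following conditions for $T$ are equivalent: (i) There exists $c>0$ such that for all $k\in\mathbb N$ and all $u_1,\dots,u_k,v_1,\dots,v_k\in X_1\times\cdots\times X_n$, $$\Big(\sum_{i=1}^k\|T(u_i)-T(v_i)\|^p\Big)^{1/p}\le c\cdot\sup\Big\{\Big(\sum_{i=1}^k|\varphi(u_i)-\varphi(v_i)|^p\Big)^{1/p};\ \varphi\in B_{\mathcal L(X_1,\dots,X_n)}\Big\}.$$ (ii) There are a constant $c>0$ and a regular probability measure $\mu$ on the space $(B_{\mathcal L(X_1,\dots,X_n)},w^* )$ such that for each $u=(u_1,\dots,u_n),v=(v_1,\dots,v_n)\in X_1\times\cdots\times X_n$, $$\|T(u)-T(v)\|\le c\cdot\Big(\int_{B_{\mathcal L(X_1,\dots,X_n)}}|\varphi(u)-\varphi(v)|^p\,d\mu(\varphi)\Big)^{1/p}.$$ (iii) There exist a regular Borel probability measure $\mu$ on $(B_{\mathcal L(X_1,\dots,X_n)},w^* )$, a subset $\Sigma_p:=(j_p\circ\otimes)(X_1\times\cdots\times X_n)$ of $L_p(\mu)$ and a Lipschitz function $h_T:\Sigma_p\to Y$ such that $T=h_T\circ j_p\circ\otimes$. (iv) There exist a probability space $(\Omega,\Sigma,\mu)$, a multilinear operator $\nu:X_1\times\cdots\times X_n\to L_\infty(\mu)$ with $\|\nu\|=1$, and a Lipschitz function $\tilde h_T:L_p(\mu)\to\ell_\infty^{B_{Y^*}}$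 such that $i_Y\circ T=\tilde h_T\circ i_p\circ\nu$. If $\pi_p^{Lip}(T):=\inf\{c;\ \text{(i) holds}\}$, then $\pi_p^{Lip}(T)=\inf\{c;\ \text{(ii) holds}\}$, and $\|\tilde h_T\|_{Lip}=\pi_p^{Lip}(T)$ when the spaces are real, and $\pi_p^{Lip}(T)\le\|\tilde h_T\|_{Lip}\le\sqrt2\,\pi_p^{Lip}(T)$ when the spaces are complex.
   Context: $B_E$ is the closed unit ball of a Banach space $E$. $\mathcal L(X_1,\dots,X_n)$ is the Banach space of bounded scalar-valued $n$-linear forms on $X_1\times\cdots\times X_n$ with norm $\|\varphi\|=\sup\{|\varphi(x_1,\dots,x_n)|:\|x_i\|\le1\}$; it is isometrically the dual of the completed projective tensor product $X_1\hat\otimes_\pi\cdots\hat\otimes_\pi X_n$, and $w^*$ denotes the corresponding weak* topology (so $(B_{\mathcal L(X_1,\dots,X_n)},w^* )$ is compact Hausdorff). The norm of a multilinear operator $\nu$ is the supremum of $\|\nu(x_1,\dots,x_n)\|$ over $\|x_i\|\le1$. The map $\otimes$ sends $(x_1,\dots,x_n)$ to $x_1\otimes\cdots\otimes x_n$, which is identified with the function $\delta_{x_1\otimes\cdots\otimes x_n}\in C(B_{\mathcal L(X_1,\dots,X_n)},w^* )$ given by $\delta_{x_1\otimes\cdots\otimes x_n}(\varphi)=\varphi(x_1,\dots,x_n)$. The maps $j_p:C(B_{\mathcal L(X_1,\dots,X_n)},w^* )\to L_p(\mu)$ and $i_p:L_\infty(\mu)\to L_p(\mu)$ are the natural inclusion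 maps. The set $\Sigma_p$ carries the metric of $L_p(\mu)$. $\ell_\infty^{\Gamma}$ is the Banach space of bounded scalar functions on the set $\Gamma$ with the supremum norm, and $i_Y:Y\to\ell_\infty^{B_{Y^*}}$ is the isometric linear embedding $i_Y(z)=(x^*(z))_{x^*\in B_{Y^*}}$. $\|h\|_{Lip}$ is the least Lipschitz constant of $h$. In the final assertion $\tilde h_T$ is the function in (iv).
   Formalization: The spaces X_i are assumed nonzero (if some X_i={0}, (i) holds but no ν has norm 1, so (iv) fails); the final assertion is read as: some factorization (iv) has the stated Lipschitz norm, and π_p^Lip(T) ≤ ‖h̃_T‖ for every factorization (iv). *)

theory Defs
  imports "HOL-Probability.Probability"
begin

section \<open>Normed and Banach spaces over a scalar field\<close>

text \<open>
  Everything is parametric in the scalar field \<open>'k\<close>, which is to be instantiated with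
  \<^typ>\<open>real\<close> and \<^typ>\<open>complex\<close>.  Spaces are records with an explicit carrier, because a
  finite family of unrelated Banach spaces is needed, and because \<open>L\<^sub>p(\<mu>)\<close> depends on a measure.
\<close>

record ('k, 'v) nspace =
  vcarrier :: "'v set"
  vadd :: "'v \<Rightarrow> 'v \<Rightarrow> 'v"
  vzero :: "'v"
  vscale :: "'k \<Rightarrow> 'v \<Rightarrow> 'v"
  vnorm :: "'v \<Rightarrow> real"

definition vdist :: "('k::real_normed_field, 'v) nspace \<Rightarrow> 'v \<Rightarrow> 'v \<Rightarrow> real" where
  "vdist V x y = vnorm V (vadd V x (vscale V (- 1) y))"

text \<open>
  \<^locale>\<open>Metric_space\<close> demands nonnegativity and symmetry also outside the carrier, hence the
  default value \<open>0\<close> there; see the lemmas \<open>mspace_nmetric\<close> and \<open>mdist_nmetric\<close>.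
\<close>

definition nmetric :: "('k::real_normed_field, 'v) nspace \<Rightarrow> 'v metric" where
  "nmetric V =
     metric (vcarrier V, \<lambda>x y. if x \<in> vcarrier V \<and> y \<in> vcarrier V then vdist V x y else 0)"

locale normed_space =
  fixes V :: "('k::real_normed_field, 'v) nspace"
  assumes add_closed: "x \<in> vcarrier V \<Longrightarrow> y \<in> vcarrier V \<Longrightarrow> vadd V x y \<in> vcarrier V"
    and zero_closed: "vzero V \<in> vcarrier V"
    and scale_closed: "x \<in> vcarrier V \<Longrightarrow> vscale V c x \<in> vcarrier V"
    and add_assoc: "x \<in> vcarrier V \<Longrightarrow> y \<in> vcarrier V \<Longrightarrow> z \<in> vcarrier V \<Longrightarrow>
      vadd V (vadd V x y) z = vadd V x (vadd V y z)"
    and add_commute: "x \<in> vcarrier V \<Longrightarrow> y \<in> vcarrier V \<Longrightarrow> vadd V x y = vadd V y x"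
    and add_zero: "x \<in> vcarrier V \<Longrightarrow> vadd V (vzero V) x = x"
    and add_inverse: "x \<in> vcarrier V \<Longrightarrow> vadd V x (vscale V (- 1) x) = vzero V"
    and scale_add: "x \<in> vcarrier V \<Longrightarrow> y \<in> vcarrier V \<Longrightarrow>
      vscale V c (vadd V x y) = vadd V (vscale V c x) (vscale V c y)"
    and add_scale: "x \<in> vcarrier V \<Longrightarrow>
      vscale V (c + d) x = vadd V (vscale V c x) (vscale V d x)"
    and scale_scale: "x \<in> vcarrier V \<Longrightarrow> vscale V c (vscale V d x) = vscale V (c * d) x"
    and scale_one: "x \<in> vcarrier V \<Longrightarrow> vscale V 1 x = x"
    and norm_nonneg: "x \<in> vcarrier V \<Longrightarrow> 0 \<le> vnorm V x"
    and norm_eq_zero: "x \<in> vcarrier V \<Longrightarrow> vnorm V x = 0 \<longleftrightarrow> x = vzero V"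
    and norm_scale: "x \<in> vcarrier V \<Longrightarrow> vnorm V (vscale V c x) = norm c * vnorm V x"
    and norm_triangle: "x \<in> vcarrier V \<Longrightarrow> y \<in> vcarrier V \<Longrightarrow>
      vnorm V (vadd V x y) \<le> vnorm V x + vnorm V y"

context normed_space
begin

lemma vdist_nonneg: "x \<in> vcarrier V \<Longrightarrow> y \<in> vcarrier V \<Longrightarrow> 0 \<le> vdist V x y"
  by (simp add: vdist_def norm_nonneg add_closed scale_closed)

lemma scale_minus_one_twice: "x \<in> vcarrier V \<Longrightarrow> vscale V (- 1) (vscale V (- 1) x) = x"
  by (simp add: scale_scale scale_one)

lemma vdist_commute:
  assumes "x \<in> vcarrier V" "y \<in> vcarrier V"
  shows "vdist V x y = vdist V y x"
proof -
  have "vadd V y (vscale V (- 1) x) = vscale V (- 1) (vadd V x (vscale V (- 1) y))"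
    using assms by (simp add: scale_add scale_closed scale_minus_one_twice add_commute)
  then show ?thesis
    using assms by (simp add: vdist_def norm_scale add_closed scale_closed)
qed

lemma diff_add_diff:
  assumes "x \<in> vcarrier V" "y \<in> vcarrier V" "z \<in> vcarrier V"
  shows "vadd V (vadd V x (vscale V (- 1) y)) (vadd V y z) = vadd V x z"
proof -
  have "vadd V (vscale V (- 1) y) (vadd V y z) = vadd V (vadd V y (vscale V (- 1) y)) z"
    using assms by (metis add_assoc add_commute scale_closed)
  also have "\<dots> = z"
    using assms by (simp add: add_inverse add_zero)
  finally show ?thesis
    using assms by (simp add: add_assoc add_closed scale_closed)
qed

lemma vdist_eq_zero:
  assumes "x \<in> vcarrier V" "y \<in> vcarrier V"
  shows "vdist V x y = 0 \<longleftrightarrow> x = y"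
proof
  assume "vdist V x y = 0"
  then have "vadd V x (vscale V (- 1) y) = vzero V"
    using assms by (simp add: vdist_def norm_eq_zero add_closed scale_closed)
  then show "x = y"
    using diff_add_diff [OF assms zero_closed] assms
    by (metis add_commute add_zero zero_closed)
next
  assume "x = y"
  then show "vdist V x y = 0"
    using assms by (simp add: vdist_def add_inverse norm_eq_zero zero_closed)
qed

lemma vdist_triangle:
  assumes "x \<in> vcarrier V" "y \<in> vcarrier V" "z \<in> vcarrier V"
  shows "vdist V x z \<le> vdist V x y + vdist V y z"
  unfolding vdist_def
  using diff_add_diff [of x y "vscale V (- 1) z"] assms
  by (metis add_closed norm_triangle scale_closed)

lemma Metric_space_nmetric:
  "Metric_space (vcarrier V) (\<lambda>x y. if x \<in> vcarrier V \<and> y \<in> vcarrier V then vdist V x y else 0)"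
  by unfold_locales (auto simp: vdist_nonneg vdist_commute vdist_eq_zero vdist_triangle)

lemma mspace_nmetric: "mspace (nmetric V) = vcarrier V"
  unfolding nmetric_def using Metric_space.mspace_metric [OF Metric_space_nmetric] .

lemma mdist_nmetric:
  "x \<in> vcarrier V \<Longrightarrow> y \<in> vcarrier V \<Longrightarrow> mdist (nmetric V) x y = vdist V x y"
  unfolding nmetric_def by (simp add: Metric_space.mdist_metric [OF Metric_space_nmetric])

end

locale banach_space = normed_space +
  assumes complete: "mcomplete_of (nmetric V)"

definition scalars :: "('k::real_normed_field, 'k) nspace" where
  "scalars = \<lparr>vcarrier = UNIV, vadd = (+), vzero = 0, vscale = (*), vnorm = norm\<rparr>"

section \<open>Multilinear operators and forms\<close>

text \<open>The product \<open>X\<^sub>1 \<times> \<dots> \<times> X\<^sub>n\<close>, with indices shifted to \<open>0, \<dots>, n - 1\<close>.\<close>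

definition tuples :: "nat \<Rightarrow> (nat \<Rightarrow> ('k, 'v) nspace) \<Rightarrow> (nat \<Rightarrow> 'v) set" where
  "tuples n X = (\<Pi>\<^sub>E i\<in>{..<n}. vcarrier (X i))"

definition multilinear ::
  "nat \<Rightarrow> (nat \<Rightarrow> ('k::real_normed_field, 'v) nspace) \<Rightarrow> ('k, 'w) nspace \<Rightarrow>
   ((nat \<Rightarrow> 'v) \<Rightarrow> 'w) \<Rightarrow> bool" where
  "multilinear n X W f \<longleftrightarrow>
     f \<in> tuples n X \<rightarrow> vcarrier W \<and>
     (\<forall>i<n. \<forall>u\<in>tuples n X. \<forall>x\<in>vcarrier (X i). \<forall>y\<in>vcarrier (X i).
        f (u(i := vadd (X i) x y)) = vadd W (f (u(i := x))) (f (u(i := y)))) \<and>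
     (\<forall>i<n. \<forall>u\<in>tuples n X. \<forall>x\<in>vcarrier (X i). \<forall>c.
        f (u(i := vscale (X i) c x)) = vscale W c (f (u(i := x))))"

definition unit_tuples :: "nat \<Rightarrow> (nat \<Rightarrow> ('k, 'v) nspace) \<Rightarrow> (nat \<Rightarrow> 'v) set" where
  "unit_tuples n X = {u \<in> tuples n X. \<forall>i<n. vnorm (X i) (u i) \<le> 1}"

definition bounded_op ::
  "nat \<Rightarrow> (nat \<Rightarrow> ('k, 'v) nspace) \<Rightarrow> ('k, 'w) nspace \<Rightarrow> ((nat \<Rightarrow> 'v) \<Rightarrow> 'w) \<Rightarrow> bool" where
  "bounded_op n X W f \<longleftrightarrow> bdd_above ((\<lambda>u. vnorm W (f u)) ` unit_tuples n X)"

definition opnorm ::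
  "nat \<Rightarrow> (nat \<Rightarrow> ('k, 'v) nspace) \<Rightarrow> ('k, 'w) nspace \<Rightarrow> ((nat \<Rightarrow> 'v) \<Rightarrow> 'w) \<Rightarrow> real" where
  "opnorm n X W f = (SUP u\<in>unit_tuples n X. vnorm W (f u))"

text \<open>
  The space \<open>\<L>(X\<^sub>1, \<dots>, X\<^sub>n)\<close> and its closed unit ball; forms are made extensional so that a form
  is determined by its values on tuples.
\<close>

definition mforms ::
  "nat \<Rightarrow> (nat \<Rightarrow> ('k::real_normed_field, 'v) nspace) \<Rightarrow> ((nat \<Rightarrow> 'v) \<Rightarrow> 'k) set" where
  "mforms n X =
     {\<phi> \<in> extensional (tuples n X). multilinear n X scalars \<phi> \<and> bounded_op n X scalars \<phi>}"

definition mform_ball ::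
  "nat \<Rightarrow> (nat \<Rightarrow> ('k::real_normed_field, 'v) nspace) \<Rightarrow> ((nat \<Rightarrow> 'v) \<Rightarrow> 'k) set" where
  "mform_ball n X = {\<phi> \<in> mforms n X. opnorm n X scalars \<phi> \<le> 1}"

section \<open>The projective tensor product and the weak* topology on forms\<close>

text \<open>
  Tensors are realized, as in Ryan's book, as functionals on \<open>\<L>(X\<^sub>1, \<dots>, X\<^sub>n)\<close>: the tensor
  \<open>\<Sum>\<^sub>j u\<^sub>j\<^sub>1 \<otimes> \<dots> \<otimes> u\<^sub>j\<^sub>n\<close> is the functional \<open>\<phi> \<mapsto> \<Sum>\<^sub>j \<phi>(u\<^sub>j)\<close>.  This is faithful since
  bounded forms separate the points of the algebraic tensor product.  Scalar coefficients are
  absorbed into the tuples, which requires \<open>n \<ge> 1\<close>.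
\<close>

definition tensor_sum ::
  "nat \<Rightarrow> (nat \<Rightarrow> ('k::real_normed_field, 'v) nspace) \<Rightarrow> (nat \<Rightarrow> 'v) list \<Rightarrow>
   ((nat \<Rightarrow> 'v) \<Rightarrow> 'k) \<Rightarrow> 'k" where
  "tensor_sum n X us = (\<lambda>\<phi>\<in>mforms n X. \<Sum>u\<leftarrow>us. \<phi> u)"

definition alg_tensor ::
  "nat \<Rightarrow> (nat \<Rightarrow> ('k::real_normed_field, 'v) nspace) \<Rightarrow> (((nat \<Rightarrow> 'v) \<Rightarrow> 'k) \<Rightarrow> 'k) set" where
  "alg_tensor n X = tensor_sum n X ` lists (tuples n X)"

definition proj_norm ::
  "nat \<Rightarrow> (nat \<Rightarrow> ('k::real_normed_field, 'v) nspace) \<Rightarrow> (((nat \<Rightarrow> 'v) \<Rightarrow> 'k) \<Rightarrow> 'k) \<Rightarrow> real" where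
  "proj_norm n X t =
     Inf {(\<Sum>u\<leftarrow>us. \<Prod>i<n. vnorm (X i) (u i)) | us. us \<in> lists (tuples n X) \<and> tensor_sum n X us = t}"

text \<open>
  The completion for the projective norm \<open>\<pi>\<close>.  Because \<open>\<pi>(t)\<close> is the supremum of \<open>|t(\<phi>)|\<close> over
  the unit ball of forms, a \<open>\<pi>\<close>-Cauchy sequence of tensors is determined, up to \<open>\<pi>\<close>-null
  sequences, by its pointwise limit on forms.
\<close>

definition proj_tensor ::
  "nat \<Rightarrow> (nat \<Rightarrow> ('k::real_normed_field, 'v) nspace) \<Rightarrow> (((nat \<Rightarrow> 'v) \<Rightarrow> 'k) \<Rightarrow> 'k) set" where
  "proj_tensor n X =
     {z \<in> extensional (mforms n X). \<exists>t :: nat \<Rightarrow> ((nat \<Rightarrow> 'v) \<Rightarrow> 'k) \<Rightarrow> 'k.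
        (\<forall>k. t k \<in> alg_tensor n X) \<and>
        (\<forall>e>0. \<exists>N. \<forall>k\<ge>N. \<forall>l\<ge>N. proj_norm n X (\<lambda>\<phi>\<in>mforms n X. t k \<phi> - t l \<phi>) < e) \<and>
        (\<forall>\<phi>\<in>mforms n X. (\<lambda>k. t k \<phi>) \<longlonglongrightarrow> z \<phi>)}"

text \<open>
  The coarsest topology making \<open>\<phi> \<mapsto> \<langle>\<phi>, z\<rangle>\<close> continuous for every \<open>z\<close> in the completed
  projective tensor product.
\<close>

definition weak_star ::
  "nat \<Rightarrow> (nat \<Rightarrow> ('k::real_normed_field, 'v) nspace) \<Rightarrow> ((nat \<Rightarrow> 'v) \<Rightarrow> 'k) topology" where
  "weak_star n X =
     pullback_topology (mforms n X) (\<lambda>\<phi>. \<lambda>z\<in>proj_tensor n X. z \<phi>)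
       (product_topology (\<lambda>_. euclidean) (proj_tensor n X))"

definition ball_top ::
  "nat \<Rightarrow> (nat \<Rightarrow> ('k::real_normed_field, 'v) nspace) \<Rightarrow> ((nat \<Rightarrow> 'v) \<Rightarrow> 'k) topology" where
  "ball_top n X = subtopology (weak_star n X) (mform_ball n X)"

definition regular_prob :: "'s topology \<Rightarrow> 's measure \<Rightarrow> bool" where
  "regular_prob S M \<longleftrightarrow>
     prob_space M \<and> space M = topspace S \<and> sets M = sigma_sets (topspace S) {U. openin S U} \<and>
     (\<forall>A\<in>sets M.
        emeasure M A = (SUP K\<in>{K. compactin S K \<and> K \<in> sets M \<and> K \<subseteq> A}. emeasure M K) \<and>
        emeasure M A = (INF U\<in>{U. openin S U \<and> A \<subseteq> U}. emeasure M U))"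

section \<open>Lebesgue spaces and \<open>\<ell>\<^sub>\<infinity>(\<Gamma>)\<close>\<close>

text \<open>Elements of \<open>L\<^sub>p(\<mu>)\<close> and \<open>L\<^sub>\<infinity>(\<mu>)\<close> are classes of measurable functions modulo a.e. equality.\<close>

definition ae_class :: "'s measure \<Rightarrow> ('s \<Rightarrow> 'k::real_normed_field) \<Rightarrow> ('s \<Rightarrow> 'k) set" where
  "ae_class M f = {g \<in> borel_measurable M. AE x in M. g x = f x}"

definition class_space ::
  "'s measure \<Rightarrow> ('s \<Rightarrow> 'k::real_normed_field) set \<Rightarrow> (('s \<Rightarrow> 'k) \<Rightarrow> real) \<Rightarrow>
   ('k, ('s \<Rightarrow> 'k) set) nspace" where
  "class_space M F N =
     \<lparr>vcarrier = ae_class M ` F,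
      vadd = (\<lambda>A B. ae_class M (\<lambda>x. (SOME f. f \<in> A) x + (SOME g. g \<in> B) x)),
      vzero = ae_class M (\<lambda>_. 0),
      vscale = (\<lambda>c A. ae_class M (\<lambda>x. c * (SOME f. f \<in> A) x)),
      vnorm = (\<lambda>A. N (SOME f. f \<in> A))\<rparr>"

definition Lp :: "real \<Rightarrow> 's measure \<Rightarrow> ('k::real_normed_field, ('s \<Rightarrow> 'k) set) nspace" where
  "Lp p M =
     class_space M {f \<in> borel_measurable M. integrable M (\<lambda>x. norm (f x) powr p)}
       (\<lambda>f. (LINT x|M. norm (f x) powr p) powr (1 / p))"

definition Linf :: "'s measure \<Rightarrow> ('k::real_normed_field, ('s \<Rightarrow> 'k) set) nspace" where
  "Linf M =
     class_space M {f \<in> borel_measurable M. esssup M (\<lambda>x. ennreal (norm (f x))) < \<infinity>}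
       (\<lambda>f. enn2real (esssup M (\<lambda>x. ennreal (norm (f x)))))"

text \<open>
  For a probability measure every class in \<open>L\<^sub>\<infinity>(\<mu>)\<close> is literally a class in \<open>L\<^sub>p(\<mu>)\<close>, so the
  natural inclusion does not change the class.
\<close>

definition i_p :: "'s measure \<Rightarrow> ('s \<Rightarrow> 'k::real_normed_field) set \<Rightarrow> ('s \<Rightarrow> 'k) set" where
  "i_p M A = A"

definition j_p :: "'s measure \<Rightarrow> ('s \<Rightarrow> 'k::real_normed_field) \<Rightarrow> ('s \<Rightarrow> 'k) set" where
  "j_p M f = ae_class M f"

text \<open>The map \<open>\<otimes>\<close>, with values in \<open>C(B\<^bsub>\<L>(X\<^sub>1,\<dots>,X\<^sub>n)\<^esub>, w*)\<close>.\<close>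

definition tensor_map ::
  "nat \<Rightarrow> (nat \<Rightarrow> ('k::real_normed_field, 'v) nspace) \<Rightarrow> (nat \<Rightarrow> 'v) \<Rightarrow>
   ((nat \<Rightarrow> 'v) \<Rightarrow> 'k) \<Rightarrow> 'k" where
  "tensor_map n X u = (\<lambda>\<phi>\<in>mform_ball n X. \<phi> u)"

definition dual_ball :: "('k::real_normed_field, 'y) nspace \<Rightarrow> ('y \<Rightarrow> 'k) set" where
  "dual_ball Y =
     {g \<in> extensional (vcarrier Y).
        (\<forall>x\<in>vcarrier Y. \<forall>y\<in>vcarrier Y. g (vadd Y x y) = g x + g y) \<and>
        (\<forall>x\<in>vcarrier Y. \<forall>c. g (vscale Y c x) = c * g x) \<and>
        bdd_above ((\<lambda>y. norm (g y)) ` {y \<in> vcarrier Y. vnorm Y y \<le> 1}) \<and>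
        (SUP y\<in>{y \<in> vcarrier Y. vnorm Y y \<le> 1}. norm (g y)) \<le> 1}"

definition linf_space :: "'g set \<Rightarrow> ('k::real_normed_field, 'g \<Rightarrow> 'k) nspace" where
  "linf_space \<Gamma> =
     \<lparr>vcarrier = {f \<in> extensional \<Gamma>. bdd_above ((\<lambda>x. norm (f x)) ` \<Gamma>)},
      vadd = (\<lambda>f g. \<lambda>x\<in>\<Gamma>. f x + g x),
      vzero = (\<lambda>x\<in>\<Gamma>. 0),
      vscale = (\<lambda>c f. \<lambda>x\<in>\<Gamma>. c * f x),
      vnorm = (\<lambda>f. SUP x\<in>\<Gamma>. norm (f x))\<rparr>"

definition i_Y :: "('k::real_normed_field, 'y) nspace \<Rightarrow> 'y \<Rightarrow> ('y \<Rightarrow> 'k) \<Rightarrow> 'k" where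
  "i_Y Y z = (\<lambda>g\<in>dual_ball Y. g z)"

definition lip_norm :: "'c metric \<Rightarrow> 'd metric \<Rightarrow> ('c \<Rightarrow> 'd) \<Rightarrow> real" where
  "lip_norm m1 m2 h =
     Inf {L. 0 \<le> L \<and> (\<forall>x\<in>mspace m1. \<forall>y\<in>mspace m1. mdist m2 (h x) (h y) \<le> L * mdist m1 x y)}"

section \<open>The four conditions\<close>

definition summing_const ::
  "real \<Rightarrow> nat \<Rightarrow> (nat \<Rightarrow> ('k::real_normed_field, 'v) nspace) \<Rightarrow> ('k, 'y) nspace \<Rightarrow>
   ((nat \<Rightarrow> 'v) \<Rightarrow> 'y) \<Rightarrow> real \<Rightarrow> bool" where
  "summing_const p n X Y T c \<longleftrightarrow>
     0 < c \<and>
     (\<forall>k::nat. \<forall>u v. (\<forall>i<k. u i \<in> tuples n X \<and> v i \<in> tuples n X) \<longrightarrow>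
        (\<Sum>i<k. vdist Y (T (u i)) (T (v i)) powr p) powr (1 / p)
        \<le> c * (SUP \<phi>\<in>mform_ball n X. (\<Sum>i<k. norm (\<phi> (u i) - \<phi> (v i)) powr p) powr (1 / p)))"

definition domination_const ::
  "real \<Rightarrow> nat \<Rightarrow> (nat \<Rightarrow> ('k::real_normed_field, 'v) nspace) \<Rightarrow> ('k, 'y) nspace \<Rightarrow>
   ((nat \<Rightarrow> 'v) \<Rightarrow> 'y) \<Rightarrow> real \<Rightarrow> bool" where
  "domination_const p n X Y T c \<longleftrightarrow>
     0 < c \<and>
     (\<exists>M. regular_prob (ball_top n X) M \<and>
        (\<forall>u\<in>tuples n X. \<forall>v\<in>tuples n X.
           vdist Y (T u) (T v) \<le> c * (LINT \<phi>|M. norm (\<phi> u - \<phi> v) powr p) powr (1 / p)))"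

definition factors_Sigma_p ::
  "real \<Rightarrow> nat \<Rightarrow> (nat \<Rightarrow> ('k::real_normed_field, 'v) nspace) \<Rightarrow> ('k, 'y) nspace \<Rightarrow>
   ((nat \<Rightarrow> 'v) \<Rightarrow> 'y) \<Rightarrow> bool" where
  "factors_Sigma_p p n X Y T \<longleftrightarrow>
     (\<exists>M \<Sigma>\<^sub>p h. regular_prob (ball_top n X) M \<and>
        \<Sigma>\<^sub>p = (j_p M \<circ> tensor_map n X) ` tuples n X \<and>
        Lipschitz_continuous_map (submetric (nmetric (Lp p M)) \<Sigma>\<^sub>p) (nmetric Y) h \<and>
        (\<forall>u\<in>tuples n X. T u = (h \<circ> j_p M \<circ> tensor_map n X) u))"

definition factors_Linf_Lp ::
  "real \<Rightarrow> nat \<Rightarrow> (nat \<Rightarrow> ('k::real_normed_field, 'v) nspace) \<Rightarrow> ('k, 'y) nspace \<Rightarrow>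
   ((nat \<Rightarrow> 'v) \<Rightarrow> 'y) \<Rightarrow> 's measure \<Rightarrow> ((nat \<Rightarrow> 'v) \<Rightarrow> ('s \<Rightarrow> 'k) set) \<Rightarrow>
   (('s \<Rightarrow> 'k) set \<Rightarrow> ('y \<Rightarrow> 'k) \<Rightarrow> 'k) \<Rightarrow> bool" where
  "factors_Linf_Lp p n X Y T M \<nu> h \<longleftrightarrow>
     prob_space M \<and>
     multilinear n X (Linf M) \<nu> \<and> bounded_op n X (Linf M) \<nu> \<and> opnorm n X (Linf M) \<nu> = 1 \<and>
     Lipschitz_continuous_map (nmetric (Lp p M)) (nmetric (linf_space (dual_ball Y))) h \<and>
     (\<forall>u\<in>tuples n X. i_Y Y (T u) = (h \<circ> i_p M \<circ> \<nu>) u)"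

definition pi_Lip ::
  "real \<Rightarrow> nat \<Rightarrow> (nat \<Rightarrow> ('k::real_normed_field, 'v) nspace) \<Rightarrow> ('k, 'y) nspace \<Rightarrow>
   ((nat \<Rightarrow> 'v) \<Rightarrow> 'y) \<Rightarrow> real" where
  "pi_Lip p n X Y T = Inf {c. summing_const p n X Y T c}"

abbreviation norm_h ::
  "real \<Rightarrow> ('k::real_normed_field, 'y) nspace \<Rightarrow> 's measure \<Rightarrow>
   (('s \<Rightarrow> 'k) set \<Rightarrow> ('y \<Rightarrow> 'k) \<Rightarrow> 'k) \<Rightarrow> real" where
  "norm_h p Y M h \<equiv> lip_norm (nmetric (Lp p M)) (nmetric (linf_space (dual_ball Y))) h"

text \<open>
  The spaces \<open>X\<^sub>i\<close> are nonzero: otherwise \<open>\<nu> = 0\<close> is the only multilinear operator, so that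
  \<open>\<parallel>\<nu>\<parallel> = 1\<close> is impossible.
\<close>

definition setting ::
  "nat \<Rightarrow> (nat \<Rightarrow> ('k::real_normed_field, 'v) nspace) \<Rightarrow> ('k, 'y) nspace \<Rightarrow>
   ((nat \<Rightarrow> 'v) \<Rightarrow> 'y) \<Rightarrow> bool" where
  "setting n X Y T \<longleftrightarrow>
     1 \<le> n \<and> (\<forall>i<n. banach_space (X i) \<and> vcarrier (X i) \<noteq> {vzero (X i)}) \<and>
     banach_space Y \<and> multilinear n X Y T"

end

theory Submission
  imports Defs
begin

text \<open>
  (i) to (ii): by (i), every nonnegative integer combination of the functions
  \<open>c\<^sup>p |\<phi>(u) - \<phi>(v)|\<^sup>p - \<parallel>T(u) - T(v)\<parallel>\<^sup>p\<close> is nonnegative somewhere on the ball, up to an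
  arbitrarily small error.  A greedy choice of points turns this into finitely supported
  averages for which finitely many such functions are almost nonnegative at once.  A limit of these
  averages in \<open>[0,1]\<^bsup>Pow K\<^esup>\<close> is a finitely additive probability, and the regular Borel measure
  that it induces gives closed sets at least the same mass; by the layer cake formula integrals of
  nonnegative continuous functions do not decrease, which is the inequality needed in (ii).

  (ii) to (iv): coordinatewise McShane extension; the Euclidean dimension of the scalar field enters
  as \<open>sqrt DIM\<close>, that is \<open>1\<close> or \<open>sqrt 2\<close>.

  (iv) to (i): averaging \<open>\<nu>(u)\<close> over a set of positive measure yields a form in the unit ball.
  Hence \<open>\<Sum>\<^sub>i |\<nu>(u\<^sub>i) - \<nu>(v\<^sub>i)|\<^sup>p\<close> is almost everywhere at most the supremum in (i), and no
  extension of multilinear forms is needed.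
\<close>

text \<open>The conditions have to be linked without any loss in the constant. Passing from (i) to
  (ii) keeps \<open>c\<close>, so the two infima agree; passing from (iv) to (i) costs exactly the
  Lipschitz constant of \<open>h\<close> times the norm of \<open>\<nu>\<close>, which yields the
  lower bound for the norm of \<open>h\<close>. The same estimate, applied to an evaluation operator
  of norm below 1, shows that a measure for the optimal constant has an evaluation operator of norm
  exactly 1, so the normalization of \<open>\<nu>\<close> in (iv) costs nothing. This breaks down if
  \<open>\<pi>T = 0\<close>, where \<open>T\<close> is constant and a norm one form made of norming
  functionals takes over.

  The obstacle in going back from (iv) is that the values \<open>\<nu> u\<close> are classes:
  additivity holds off a null set that depends on the tuples, and there are uncountably many tuples,
  so fixing a point of the measure space need not give a multilinear form. Integration over a set of
  positive measure forgets the null sets. Norming functionals are also what makes \<open>i_Y\<close>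
  isometric; apart from them and the dimension, the argument does not see whether the scalars are
  real or complex.\<close>

section \<open>Norming functionals\<close>

context normed_space
begin

text \<open>Real sublinearity over an arbitrary scalar field: only scalars \<open>of_real c\<close>
  occur, so that one Hahn-Banach argument covers both fields. Homogeneity is asked as an inequality,
  the form that survives infima; \<open>sublin_scale\<close> turns it into an equality.\<close>

definition sublin :: "('v \<Rightarrow> real) \<Rightarrow> bool" where
  "sublin q \<longleftrightarrow>
     (\<forall>x\<in>vcarrier V. \<forall>y\<in>vcarrier V. q (vadd V x y) \<le> q x + q y) \<and>
     (\<forall>x\<in>vcarrier V. \<forall>c\<ge>0. q (vscale V (of_real c) x) \<le> c * q x)"

lemma sublin_add: "sublin q \<Longrightarrow> x \<in> vcarrier V \<Longrightarrow> y \<in> vcarrier V \<Longrightarrow> q (vadd V x y) \<le> q x + q y"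
  by (simp add: sublin_def)

lemma sublin_scale_le:
  "sublin q \<Longrightarrow> x \<in> vcarrier V \<Longrightarrow> 0 \<le> c \<Longrightarrow> q (vscale V (of_real c) x) \<le> c * q x"
  by (simp add: sublin_def)

lemma scale_zero: "x \<in> vcarrier V \<Longrightarrow> vscale V 0 x = vzero V"
  using add_scale [of x 1 "-1"] by (simp add: scale_one add_inverse)

lemma scale_vzero: "vscale V c (vzero V) = vzero V"
  by (metis mult_zero_right scale_scale scale_zero zero_closed)

lemma add_zero_right: "x \<in> vcarrier V \<Longrightarrow> vadd V x (vzero V) = x"
  using add_commute add_zero zero_closed by metis

lemma norm_vzero: "vnorm V (vzero V) = 0"
  by (simp add: norm_eq_zero zero_closed)

lemma add_left_commute:
  "x \<in> vcarrier V \<Longrightarrow> y \<in> vcarrier V \<Longrightarrow> z \<in> vcarrier V \<Longrightarrow>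
    vadd V x (vadd V y z) = vadd V y (vadd V x z)"
  by (metis add_assoc add_commute)

lemmas vadd_ac = add_assoc add_commute add_left_commute

lemma sublin_zero: "sublin q \<Longrightarrow> q (vzero V) = 0"
  using sublin_add [of q "vzero V" "vzero V"] sublin_scale_le [of q "vzero V" 0]
  by (simp add: zero_closed add_zero scale_zero)

lemma sublin_scale:
  assumes "sublin q" "x \<in> vcarrier V" "0 \<le> c"
  shows "q (vscale V (of_real c) x) = c * q x"
proof (cases "c = 0")
  case True
  then show ?thesis using assms by (simp add: scale_zero sublin_zero)
next
  case False
  have "q (vscale V (of_real (inverse c)) (vscale V (of_real c) x)) \<le> inverse c * q (vscale V (of_real c) x)"
    using assms by (intro sublin_scale_le) (auto simp: scale_closed)
  moreover have "vscale V (of_real (inverse c)) (vscale V (of_real c) x) = x"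
    using assms False by (simp add: scale_scale scale_one flip: of_real_mult)
  ultimately have "c * q x \<le> q (vscale V (of_real c) x)"
    using assms False by (simp add: field_simps)
  then show ?thesis using sublin_scale_le [OF assms] by simp
qed

lemma sublin_minus:
  assumes "sublin q" "x \<in> vcarrier V"
  shows "- q (vscale V (- 1) x) \<le> q x"
  using sublin_add [of q x "vscale V (- 1) x"] assms
  by (simp add: add_inverse scale_closed sublin_zero)

lemma sublin_norm: "sublin (vnorm V)"
  by (simp add: sublin_def norm_triangle norm_scale)

text \<open>For sublinear \<open>q\<close> this is the largest sublinear functional below
  \<open>q\<close> whose value at \<open>- x0\<close> is at most \<open>- q x0\<close>. Restriction
  to the carrier lets functionals that agree there be equal, as minimality requires.\<close>

definition tilt :: "('v \<Rightarrow> real) \<Rightarrow> 'v \<Rightarrow> 'v \<Rightarrow> real" where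
  "tilt q x0 = (\<lambda>y\<in>vcarrier V. INF t\<in>{0..}. q (vadd V y (vscale V (of_real t) x0)) - t * q x0)"

text \<open>Subadditivity for \<open>t x0 = (y + t x0) - y\<close>. The bound does not depend on
  \<open>t\<close>, so the infimum in \<open>tilt\<close> is finite.\<close>

lemma tilt_lower:
  assumes "sublin q" "x0 \<in> vcarrier V" "y \<in> vcarrier V" "0 \<le> t"
  shows "- q (vscale V (- 1) y) \<le> q (vadd V y (vscale V (of_real t) x0)) - t * q x0"
proof -
  have "vadd V (vadd V y (vscale V (of_real t) x0)) (vscale V (- 1) y) = vscale V (of_real t) x0"
    using assms by (metis add_assoc add_closed add_commute add_inverse add_zero scale_closed)
  then have "t * q x0 \<le> q (vadd V y (vscale V (of_real t) x0)) + q (vscale V (- 1) y)"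
    using sublin_add [of q "vadd V y (vscale V (of_real t) x0)" "vscale V (- 1) y"]
      sublin_scale [of q x0 t] assms by (simp add: add_closed scale_closed)
  then show ?thesis by simp
qed

lemma tilt_bdd:
  assumes "sublin q" "x0 \<in> vcarrier V" "y \<in> vcarrier V"
  shows "bdd_below ((\<lambda>t. q (vadd V y (vscale V (of_real t) x0)) - t * q x0) ` {0..})"
  using tilt_lower [OF assms] by (intro bdd_belowI2) auto

lemma tilt_le:
  assumes "sublin q" "x0 \<in> vcarrier V" "y \<in> vcarrier V" "0 \<le> t"
  shows "tilt q x0 y \<le> q (vadd V y (vscale V (of_real t) x0)) - t * q x0"
  unfolding tilt_def using assms by (auto intro!: cINF_lower tilt_bdd)

lemma tilt_le_self:
  assumes "sublin q" "x0 \<in> vcarrier V" "y \<in> vcarrier V"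
  shows "tilt q x0 y \<le> q y"
  using tilt_le [OF assms, of 0] assms by (simp add: scale_zero add_zero_right)

lemma tilt_minus:
  assumes "sublin q" "x0 \<in> vcarrier V"
  shows "tilt q x0 (vscale V (- 1) x0) \<le> - q x0"
  using tilt_le [OF assms, of "vscale V (- 1) x0" 1] assms
  by (simp add: scale_closed scale_one add_commute [of "vscale V (- 1) x0"] add_inverse sublin_zero)

lemma tilt_approx:
  assumes "sublin q" "x0 \<in> vcarrier V" "y \<in> vcarrier V" "0 < e"
  obtains t where "0 \<le> t" "q (vadd V y (vscale V (of_real t) x0)) - t * q x0 < tilt q x0 y + e"
proof -
  have "\<exists>z\<in>(\<lambda>t. q (vadd V y (vscale V (of_real t) x0)) - t * q x0) ` {0..}. z < tilt q x0 y + e"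
    using assms by (intro cInf_lessD) (auto simp: tilt_def)
  then show ?thesis using that by auto
qed

text \<open>If \<open>s\<close> and \<open>t\<close> are almost optimal for \<open>x\<close> and
  \<open>y\<close>, then \<open>s + t\<close> is admissible for \<open>x + y\<close>; for
  \<open>c x\<close> it is \<open>c * t\<close>. The error \<open>e / (c + 1)\<close> also allows
  \<open>c = 0\<close>.\<close>

lemma sublin_tilt:
  assumes q: "sublin q" and x0: "x0 \<in> vcarrier V"
  shows "sublin (tilt q x0)"
  unfolding sublin_def
proof (intro conjI ballI allI impI)
  fix x y assume xy: "x \<in> vcarrier V" "y \<in> vcarrier V"
  show "tilt q x0 (vadd V x y) \<le> tilt q x0 x + tilt q x0 y"
  proof (rule field_le_epsilon)
    fix e :: real assume e: "0 < e"
    obtain s where s: "0 \<le> s" "q (vadd V x (vscale V (of_real s) x0)) - s * q x0 < tilt q x0 x + e/2"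
      using tilt_approx [OF q x0 xy(1), of "e/2"] e by auto
    obtain t where t: "0 \<le> t" "q (vadd V y (vscale V (of_real t) x0)) - t * q x0 < tilt q x0 y + e/2"
      using tilt_approx [OF q x0 xy(2), of "e/2"] e by auto
    have eq: "vadd V (vadd V x y) (vscale V (of_real (s + t)) x0) =
        vadd V (vadd V x (vscale V (of_real s) x0)) (vadd V y (vscale V (of_real t) x0))"
      using xy x0 by (simp add: add_scale vadd_ac add_closed scale_closed)
    have "tilt q x0 (vadd V x y) \<le> q (vadd V (vadd V x y) (vscale V (of_real (s + t)) x0)) - (s + t) * q x0"
      using s t xy x0 q by (intro tilt_le) (auto simp: add_closed)
    also have "\<dots> \<le> q (vadd V x (vscale V (of_real s) x0)) + q (vadd V y (vscale V (of_real t) x0)) - (s + t) * q x0"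
      unfolding eq using q xy x0 by (simp add: sublin_add add_closed scale_closed)
    also have "\<dots> \<le> tilt q x0 x + tilt q x0 y + e"
      using s t by (simp add: algebra_simps)
    finally show "tilt q x0 (vadd V x y) \<le> tilt q x0 x + tilt q x0 y + e" .
  qed
next
  fix x and c :: real assume x: "x \<in> vcarrier V" and c: "0 \<le> c"
  show "tilt q x0 (vscale V (of_real c) x) \<le> c * tilt q x0 x"
  proof (rule field_le_epsilon)
    fix e :: real assume e: "0 < e"
    obtain t where t: "0 \<le> t" "q (vadd V x (vscale V (of_real t) x0)) - t * q x0 < tilt q x0 x + e/(c+1)"
      using tilt_approx [OF q x0 x, of "e/(c+1)"] e c by auto
    have eq: "vadd V (vscale V (of_real c) x) (vscale V (of_real (c * t)) x0) =
        vscale V (of_real c) (vadd V x (vscale V (of_real t) x0))"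
      using x x0 by (simp add: scale_add scale_scale scale_closed)
    have "tilt q x0 (vscale V (of_real c) x) \<le> c * q (vadd V x (vscale V (of_real t) x0)) - (c * t) * q x0"
      using tilt_le [OF q x0 scale_closed [OF x], of "c * t" "of_real c"] c t
        sublin_scale [OF q, of "vadd V x (vscale V (of_real t) x0)" c]
      unfolding eq using x x0 by (simp add: add_closed scale_closed)
    also have "\<dots> = c * (q (vadd V x (vscale V (of_real t) x0)) - t * q x0)"
      by (simp add: algebra_simps)
    also have "\<dots> \<le> c * (tilt q x0 x + e/(c+1))"
      using t c by (intro mult_left_mono) auto
    also have "\<dots> \<le> c * tilt q x0 x + e"
      using c e by (simp add: field_simps)
    finally show "tilt q x0 (vscale V (of_real c) x) \<le> c * tilt q x0 x + e" .
  qed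
qed

text \<open>Every member lies above \<open>- r (- x)\<close>, so the infimum is finite.
  Subadditivity needs one functional that is almost optimal at \<open>x\<close> and at
  \<open>y\<close> simultaneously; of two members of a chain the smaller one is.\<close>

lemma sublin_INF_chain:
  assumes ne: "C \<noteq> {}" and C: "\<And>q. q \<in> C \<Longrightarrow> sublin q" and below: "\<And>q x. q \<in> C \<Longrightarrow> x \<in> vcarrier V \<Longrightarrow> q x \<le> r x"
    and chain: "\<And>q q'. q \<in> C \<Longrightarrow> q' \<in> C \<Longrightarrow> (\<forall>x\<in>vcarrier V. q x \<le> q' x) \<or> (\<forall>x\<in>vcarrier V. q' x \<le> q x)"
  defines "I \<equiv> \<lambda>x\<in>vcarrier V. INF q\<in>C. q x"
  shows "sublin I" and "\<And>q x. q \<in> C \<Longrightarrow> x \<in> vcarrier V \<Longrightarrow> I x \<le> q x"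
proof -
  have bdd: "bdd_below ((\<lambda>q. q x) ` C)" if x: "x \<in> vcarrier V" for x
  proof (rule bdd_belowI2)
    fix q assume q: "q \<in> C"
    then show "- r (vscale V (- 1) x) \<le> q x"
      using sublin_minus [OF C [OF q] x] below [OF q scale_closed [OF x], of "- 1"] by simp
  qed
  show le: "I x \<le> q x" if "q \<in> C" "x \<in> vcarrier V" for q x
    using that bdd by (auto simp: I_def intro!: cINF_lower)
  have approx: "\<exists>q\<in>C. q x < I x + e" if "x \<in> vcarrier V" "0 < e" for x e
  proof -
    have "\<exists>z\<in>(\<lambda>q. q x) ` C. z < I x + e"
      using that ne by (intro cInf_lessD) (auto simp: I_def)
    then show ?thesis by auto
  qed
  show "sublin I"
    unfolding sublin_def
  proof (intro conjI ballI allI impI)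
    fix x y assume xy: "x \<in> vcarrier V" "y \<in> vcarrier V"
    show "I (vadd V x y) \<le> I x + I y"
    proof (rule field_le_epsilon)
      fix e :: real assume e: "0 < e"
      obtain q1 where q1: "q1 \<in> C" "q1 x < I x + e/2" using approx [OF xy(1), of "e/2"] e by auto
      obtain q2 where q2: "q2 \<in> C" "q2 y < I y + e/2" using approx [OF xy(2), of "e/2"] e by auto
      obtain q where q: "q \<in> C" "q x \<le> q1 x" "q y \<le> q2 y"
        using chain [OF q1(1) q2(1)] q1 q2 xy by blast
      have "I (vadd V x y) \<le> q x + q y"
        using le [OF q(1) add_closed [OF xy]] sublin_add [OF C [OF q(1)] xy] by simp
      then show "I (vadd V x y) \<le> I x + I y + e" using q q1 q2 by simp
    qed
  next
    fix x and c :: real assume x: "x \<in> vcarrier V" and c: "0 \<le> c"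
    show "I (vscale V (of_real c) x) \<le> c * I x"
    proof (rule field_le_epsilon)
      fix e :: real assume e: "0 < e"
      obtain q where q: "q \<in> C" "q x < I x + e/(c+1)" using approx [OF x, of "e/(c+1)"] e c by auto
      have "I (vscale V (of_real c) x) \<le> c * q x"
        using le [OF q(1) scale_closed [OF x], of "of_real c"] sublin_scale [OF C [OF q(1)] x c] by simp
      also have "\<dots> \<le> c * (I x + e/(c+1))"
        using q c by (intro mult_left_mono) auto
      also have "\<dots> \<le> c * I x + e" using c e by (simp add: field_simps)
      finally show "I (vscale V (of_real c) x) \<le> c * I x + e" .
    qed
  qed
qed

text \<open>A minimal sublinear functional coincides with all its tilts, hence is odd, hence linear.\<close>

lemma real_linear_below:
  assumes r: "sublin r"
  obtains g where
    "\<And>x y. x \<in> vcarrier V \<Longrightarrow> y \<in> vcarrier V \<Longrightarrow> g (vadd V x y) = g x + g y"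
    "\<And>x c. x \<in> vcarrier V \<Longrightarrow> g (vscale V (of_real c) x) = c * g x"
    "\<And>x. x \<in> vcarrier V \<Longrightarrow> g x \<le> r x"
proof -
  define A where "A = {q \<in> extensional (vcarrier V). sublin q \<and> (\<forall>x\<in>vcarrier V. q x \<le> r x)}"
  \<comment> \<open>The order is reversed: a maximal element in Zorn's lemma is a minimal
    functional.\<close>
  define P where "P = (\<lambda>q q' :: 'v \<Rightarrow> real. \<forall>x\<in>vcarrier V. q' x \<le> q x)"
  have "partial_order_on A (relation_of P A)"
  proof (rule partial_order_on_relation_ofI)
    show "q = q'" if "q \<in> A" "q' \<in> A" "P q q'" "P q' q" for q q'
      using that unfolding A_def P_def
      by (intro extensionalityI [of q "vcarrier V" q']) (auto intro: antisym)
  qed (auto simp: P_def intro: order_trans)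
  moreover have "\<exists>u\<in>A. \<forall>q\<in>C. P q u" if C: "C \<in> Chains (relation_of P A)" for C
  proof (cases "C = {}")
    case True
    have "restrict r (vcarrier V) \<in> A"
      using r by (auto simp: A_def sublin_def add_closed scale_closed)
    then show ?thesis using True by auto
  next
    case False
    have CA: "C \<subseteq> A" using C by (auto simp: Chains_def relation_of_def)
    have *: "(\<forall>x\<in>vcarrier V. q x \<le> q' x) \<or> (\<forall>x\<in>vcarrier V. q' x \<le> q x)" if "q \<in> C" "q' \<in> C" for q q'
      using C that by (auto simp: Chains_def relation_of_def P_def)
    define I where "I = (\<lambda>x\<in>vcarrier V. INF q\<in>C. q x)"
    have I: "sublin I" "\<And>q x. q \<in> C \<Longrightarrow> x \<in> vcarrier V \<Longrightarrow> I x \<le> q x"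
      unfolding I_def using sublin_INF_chain [of C r] False CA * by (auto simp: A_def)
    obtain q0 where q0: "q0 \<in> C" using False by auto
    have "I \<in> A"
      using I q0 CA by (force simp: A_def I_def)
    then show ?thesis using I by (auto simp: P_def)
  qed
  ultimately obtain g where g: "g \<in> A" and min: "\<And>q. q \<in> A \<Longrightarrow> P g q \<Longrightarrow> q = g"
    using predicate_Zorn [of A P] by blast
  have gs: "sublin g" using g by (simp add: A_def)
  have odd: "g (vscale V (- 1) x) = - g x" if x: "x \<in> vcarrier V" for x
  proof -
    have "tilt g x \<in> A"
      using sublin_tilt [OF gs x] tilt_le_self [OF gs x] g by (force simp: A_def tilt_def)
    then have "tilt g x = g"
      using tilt_le_self [OF gs x] by (intro min) (auto simp: P_def)
    then have "g (vscale V (- 1) x) \<le> - g x" using tilt_minus [OF gs x] by simp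
    then show ?thesis using sublin_minus [OF gs x] by simp
  qed
  show ?thesis
  proof
    fix x y assume xy: "x \<in> vcarrier V" "y \<in> vcarrier V"
    have "g (vscale V (- 1) (vadd V x y)) \<le> g (vscale V (- 1) x) + g (vscale V (- 1) y)"
      using xy by (simp add: scale_add sublin_add [OF gs] scale_closed)
    then show "g (vadd V x y) = g x + g y"
      using sublin_add [OF gs xy] xy by (simp add: odd add_closed)
  next
    fix x and c :: real assume x: "x \<in> vcarrier V"
    show "g (vscale V (of_real c) x) = c * g x"
    proof (cases "0 \<le> c")
      case True
      then show ?thesis using sublin_scale [OF gs x] by simp
    next
      case False
      have "g (vscale V (- 1) (vscale V (of_real (- c)) x)) = - g (vscale V (of_real (- c)) x)"
        using x by (intro odd scale_closed)
      then show ?thesis using sublin_scale [OF gs x, of "- c"] False x by (simp add: scale_scale)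
    qed
  qed (use g in \<open>auto simp: A_def\<close>)
qed

text \<open>Domination by the tilt of the norm at \<open>y\<close>, not by the norm alone, forces
  \<open>g (- y) \<le> - vnorm V y\<close>, hence equality at \<open>y\<close>.\<close>

lemma real_norming:
  assumes y: "y \<in> vcarrier V"
  obtains g where
    "\<And>x y. x \<in> vcarrier V \<Longrightarrow> y \<in> vcarrier V \<Longrightarrow> g (vadd V x y) = g x + g y"
    "\<And>x c. x \<in> vcarrier V \<Longrightarrow> g (vscale V (of_real c) x) = c * g x"
    "\<And>x. x \<in> vcarrier V \<Longrightarrow> g x \<le> vnorm V x" "g y = vnorm V y"
proof -
  obtain g where g: "\<And>x y. x \<in> vcarrier V \<Longrightarrow> y \<in> vcarrier V \<Longrightarrow> g (vadd V x y) = g x + g y"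
    "\<And>x c. x \<in> vcarrier V \<Longrightarrow> g (vscale V (of_real c) x) = c * g x"
    "\<And>x. x \<in> vcarrier V \<Longrightarrow> g x \<le> tilt (vnorm V) y x"
    using real_linear_below [OF sublin_tilt [OF sublin_norm y]] by metis
  have le: "g x \<le> vnorm V x" if "x \<in> vcarrier V" for x
    using g(3) [OF that] tilt_le_self [OF sublin_norm y that] by simp
  have "g (vscale V (of_real (- 1)) y) \<le> - vnorm V y"
    using g(3) [OF scale_closed [OF y], of "- 1"] tilt_minus [OF sublin_norm y] by simp
  then have "g y = vnorm V y"
    using g(2) [OF y, of "- 1"] le [OF y] by simp
  then show ?thesis using that g le by blast
qed

end

text \<open>The consequence of Hahn-Banach that is used later. As a predicate it confines the
  distinction between real and complex scalars to its two proofs; what follows is uniform in the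
  field up to the final theorem.\<close>

definition has_norming :: "('k::real_normed_field, 'v) nspace \<Rightarrow> bool" where
  "has_norming V \<longleftrightarrow> (\<forall>y\<in>vcarrier V. \<exists>g\<in>dual_ball V. norm (g y) = vnorm V y)"

lemma (in normed_space) dual_ballI:
  assumes "g \<in> extensional (vcarrier V)"
    "\<And>x y. x \<in> vcarrier V \<Longrightarrow> y \<in> vcarrier V \<Longrightarrow> g (vadd V x y) = g x + g y"
    "\<And>x c. x \<in> vcarrier V \<Longrightarrow> g (vscale V c x) = c * g x"
    "\<And>x. x \<in> vcarrier V \<Longrightarrow> norm (g x) \<le> vnorm V x"
  shows "g \<in> dual_ball V"
proof -
  have "norm (g y) \<le> 1" if "y \<in> vcarrier V" "vnorm V y \<le> 1" for y
    using assms(4) [OF that(1)] that by simp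
  moreover have "vzero V \<in> {y \<in> vcarrier V. vnorm V y \<le> 1}"
    by (simp add: zero_closed norm_vzero)
  then have "{y \<in> vcarrier V. vnorm V y \<le> 1} \<noteq> {}" by blast
  ultimately show ?thesis
    using assms by (auto simp: dual_ball_def intro!: bdd_aboveI2 [where M = 1] cSUP_least)
qed

lemma (in normed_space) dual_ball_le:
  assumes g: "g \<in> dual_ball V" and x: "x \<in> vcarrier V"
  shows "norm (g x) \<le> vnorm V x"
proof (cases "vnorm V x = 0")
  case True
  then have "x = vscale V 0 x" using x by (simp add: norm_eq_zero scale_vzero)
  moreover have "g (vscale V 0 x) = 0 * g x" using g x by (simp add: dual_ball_def)
  ultimately have "g x = 0" by simp
  then show ?thesis using True by simp
next
  case False
  define c :: 'k where "c = of_real (inverse (vnorm V x))"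
  have pos: "0 < vnorm V x" using False norm_nonneg [OF x] by simp
  have "norm (g (vscale V c x)) \<le> (SUP y\<in>{y \<in> vcarrier V. vnorm V y \<le> 1}. norm (g y))"
    using g x pos by (intro cSUP_upper) (auto simp: dual_ball_def scale_closed norm_scale c_def norm_inverse)
  also have "\<dots> \<le> 1" using g by (simp add: dual_ball_def)
  finally have "norm (c * g x) \<le> 1" using g x by (simp add: dual_ball_def)
  then have "inverse (vnorm V x) * norm (g x) \<le> 1"
    using pos by (simp add: c_def norm_mult norm_inverse)
  then show ?thesis using pos by (simp add: field_simps)
qed

lemma has_norming_real:
  fixes V :: "(real, 'v) nspace"
  assumes "normed_space V"
  shows "has_norming V"
  unfolding has_norming_def
proof
  interpret normed_space V by fact
  fix y assume y: "y \<in> vcarrier V"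
  obtain g where g: "\<And>x y. x \<in> vcarrier V \<Longrightarrow> y \<in> vcarrier V \<Longrightarrow> g (vadd V x y) = g x + g y"
    "\<And>x c. x \<in> vcarrier V \<Longrightarrow> g (vscale V (of_real c) x) = c * g x"
    "\<And>x. x \<in> vcarrier V \<Longrightarrow> g x \<le> vnorm V x" "g y = vnorm V y"
    using real_norming [OF y] by metis
  have "\<bar>g x\<bar> \<le> vnorm V x" if x: "x \<in> vcarrier V" for x
    using g(3) [OF x] g(3) [OF scale_closed [OF x], of "- 1"] g(2) [OF x, of "- 1"] x
    by (simp add: norm_scale)
  then have "restrict g (vcarrier V) \<in> dual_ball V"
    using g by (intro dual_ballI) (auto simp: add_closed scale_closed)
  then show "\<exists>g\<in>dual_ball V. norm (g y) = vnorm V y"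
    using g(4) y norm_nonneg [OF y] by (intro bexI [of _ "restrict g (vcarrier V)"]) auto
qed

lemma has_norming_complex:
  fixes V :: "(complex, 'v) nspace"
  assumes "normed_space V"
  shows "has_norming V"
  unfolding has_norming_def
proof
  interpret normed_space V by fact
  fix y assume y: "y \<in> vcarrier V"
  obtain r where r: "\<And>x y. x \<in> vcarrier V \<Longrightarrow> y \<in> vcarrier V \<Longrightarrow> r (vadd V x y) = r x + r y"
    "\<And>x c. x \<in> vcarrier V \<Longrightarrow> r (vscale V (of_real c) x) = c * r x"
    "\<And>x. x \<in> vcarrier V \<Longrightarrow> r x \<le> vnorm V x" "r y = vnorm V y"
    using real_norming [OF y] by metis
  \<comment> \<open>A complex linear functional with real part \<open>r\<close> can only be
    \<open>r x - \<i> r (\<i> x)\<close>.\<close>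
  define g where "g = (\<lambda>x\<in>vcarrier V. Complex (r x) (- r (vscale V \<i> x)))"
  have add: "g (vadd V x y) = g x + g y" if "x \<in> vcarrier V" "y \<in> vcarrier V" for x y
    using that by (simp add: g_def add_closed scale_add scale_closed r(1) complex_eq_iff)
  have scale: "g (vscale V c x) = c * g x" if x: "x \<in> vcarrier V" for c x
  proof -
    have lin: "r (vscale V (Complex a b) x) = a * r x + b * r (vscale V \<i> x)" for a b
    proof -
      have "Complex a b = of_real a + of_real b * \<i>" by (simp add: complex_eq_iff)
      then have "vscale V (Complex a b) x =
          vadd V (vscale V (of_real a) x) (vscale V (of_real b) (vscale V \<i> x))"
        using x by (simp add: add_scale scale_scale)
      then show ?thesis using x by (simp add: r scale_closed)
    qed
    \<comment> \<open>The second coordinate of \<open>g (c x)\<close> evaluates \<open>r\<close> at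
      \<open>\<i> * c\<close> times \<open>x\<close>.\<close>
    have ic: "\<i> * c = Complex (- Im c) (Re c)" by (simp add: complex_eq_iff)
    show ?thesis
      using x lin [of "Re c" "Im c"] lin [of "- Im c" "Re c"]
      by (simp add: g_def scale_closed scale_scale ic complex_eq_iff)
  qed
  have le: "norm (g x) \<le> vnorm V x" if x: "x \<in> vcarrier V" for x
  proof (cases "g x = 0")
    case True
    then show ?thesis using norm_nonneg [OF x] by simp
  next
    case False
    \<comment> \<open>Rotating \<open>x\<close> by the unimodular \<open>w\<close> makes the value
      real and nonnegative, so \<open>norm (g x)\<close> becomes a value of \<open>r\<close>, which
      is dominated by the norm.\<close>
    define w where "w = cnj (g x) / of_real (norm (g x))"
    have w: "norm w = 1" using False by (simp add: w_def norm_divide)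
    have "w * g x = of_real (norm (g x))"
      using False by (simp add: w_def complex_norm_square [symmetric] power2_eq_square mult.commute)
    then have "g (vscale V w x) = of_real (norm (g x))" using scale [OF x] by simp
    then have "r (vscale V w x) = norm (g x)"
      using x by (simp add: g_def scale_closed complex_eq_iff)
    then show ?thesis using r(3) [OF scale_closed [OF x], of w] x w by (simp add: norm_scale)
  qed
  have gB: "g \<in> dual_ball V"
    using add scale le by (intro dual_ballI) (auto simp: g_def)
  have "vnorm V y \<le> norm (g y)"
    using complex_Re_le_cmod [of "g y"] y r(4) by (simp add: g_def)
  then show "\<exists>g\<in>dual_ball V. norm (g y) = vnorm V y"
    using gB le [OF y] by (intro bexI [of _ g]) auto
qed

section \<open>A regular measure from a finitely additive one\<close>

lemma ennreal_less_add_pos: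
  assumes "x < (top :: ennreal)" "0 < e"
  shows "x < x + ennreal e"
  using assms by (cases x) (auto simp: ennreal_less_iff simp flip: ennreal_plus)

text \<open>Only monotonicity, subadditivity and superadditivity on disjoint sets of the set function
  \<open>m\<close> are needed, so it may be a pointwise limit of discrete probabilities.\<close>

locale content_space =
  fixes S :: "'s topology" and m :: "'s set \<Rightarrow> ennreal"
  assumes compact: "compact_space S" and Hausdorff: "Hausdorff_space S"
    and m_empty: "m {} = 0" and m_space: "m (topspace S) = 1"
    and m_mono: "A \<subseteq> B \<Longrightarrow> B \<subseteq> topspace S \<Longrightarrow> m A \<le> m B"
    and m_subadd: "A \<subseteq> topspace S \<Longrightarrow> B \<subseteq> topspace S \<Longrightarrow> m (A \<union> B) \<le> m A + m B"
    and m_superadd: "A \<subseteq> topspace S \<Longrightarrow> B \<subseteq> topspace S \<Longrightarrow> disjnt A B \<Longrightarrow> m A + m B \<le> m (A \<union> B)"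
begin

text \<open>The three stages of the classical passage from a content to a regular measure: closed
  sets are measured from outside by \<open>m\<close> on open sets, open sets from inside by closed
  ones, arbitrary sets from outside by open ones. \<open>m\<close> is only finitely additive;
  compactness gains countable subadditivity at the middle stage.\<close>

definition outer_content :: "'s set \<Rightarrow> ennreal" where
  "outer_content C = (INF U\<in>{U. openin S U \<and> C \<subseteq> U}. m U)"

definition open_mass :: "'s set \<Rightarrow> ennreal" where
  "open_mass U = (SUP C\<in>{C. closedin S C \<and> C \<subseteq> U}. outer_content C)"

definition outer_mass :: "'s set \<Rightarrow> ennreal" where
  "outer_mass A = (INF U\<in>{U. openin S U \<and> A \<subseteq> U}. open_mass U)"

lemma normal: "normal_space S"
  using compact Hausdorff by (simp add: compact_Hausdorff_or_regular_imp_normal_space)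

lemma outer_content_le: "openin S U \<Longrightarrow> C \<subseteq> U \<Longrightarrow> outer_content C \<le> m U"
  unfolding outer_content_def by (intro INF_lower) auto

lemma le_outer_content: "(\<And>U. openin S U \<Longrightarrow> C \<subseteq> U \<Longrightarrow> x \<le> m U) \<Longrightarrow> x \<le> outer_content C"
  unfolding outer_content_def by (intro INF_greatest) auto

lemma m_le_outer_content: "m C \<le> outer_content C"
  by (intro le_outer_content m_mono) (auto dest: openin_subset)

lemma outer_content_empty: "outer_content {} = 0"
  using outer_content_le [of "{}" "{}"] m_empty by simp

lemma outer_content_subadd: "outer_content (C \<union> D) \<le> outer_content C + outer_content D"
proof (rule ennreal_le_epsilon)
  fix e :: real assume e: "0 < e" and fin: "outer_content C + outer_content D < top"
  have *: "\<exists>U. openin S U \<and> C \<subseteq> U \<and> m U < outer_content C + ennreal (e/2)" if "outer_content C < top" for C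
  proof -
    have "outer_content C < outer_content C + ennreal (e/2)"
      using e that by (intro ennreal_less_add_pos) auto
    then show ?thesis unfolding outer_content_def [of C] INF_less_iff by auto
  qed
  obtain U where U: "openin S U" "C \<subseteq> U" "m U < outer_content C + ennreal (e/2)"
    using * [of C] fin by (auto simp: ennreal_add_less_top)
  obtain W where W: "openin S W" "D \<subseteq> W" "m W < outer_content D + ennreal (e/2)"
    using * [of D] fin by (auto simp: ennreal_add_less_top)
  have "outer_content (C \<union> D) \<le> m (U \<union> W)" using U W by (intro outer_content_le) auto
  also have "\<dots> \<le> m U + m W" using U W by (intro m_subadd) (auto dest: openin_subset)
  also have "\<dots> \<le> (outer_content C + ennreal (e/2)) + (outer_content D + ennreal (e/2))"
    using U W by (intro add_mono) auto
  also have "\<dots> = outer_content C + outer_content D + (ennreal (e/2) + ennreal (e/2))"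
    by (simp add: ac_simps)
  also have "ennreal (e/2) + ennreal (e/2) = ennreal e"
    using e by (simp flip: ennreal_plus)
  finally show "outer_content (C \<union> D) \<le> outer_content C + outer_content D + ennreal e" .
qed

text \<open>Normality gives disjoint open neighbourhoods of \<open>C\<close> and \<open>D\<close>,
  and \<open>m\<close> is superadditive on their traces in any open set around the union.\<close>

lemma outer_content_superadd:
  assumes "closedin S C" "closedin S D" "disjnt C D"
  shows "outer_content C + outer_content D \<le> outer_content (C \<union> D)"
proof (rule le_outer_content)
  fix W assume W: "openin S W" "C \<union> D \<subseteq> W"
  obtain A B where AB: "openin S A" "openin S B" "C \<subseteq> A" "D \<subseteq> B" "disjnt A B"
    using normal assms unfolding normal_space_def by meson
  have "outer_content C + outer_content D \<le> m (W \<inter> A) + m (W \<inter> B)"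
    using W AB by (intro add_mono outer_content_le) auto
  also have "\<dots> \<le> m (W \<inter> A \<union> W \<inter> B)"
    using W AB by (intro m_superadd) (auto simp: disjnt_def dest: openin_subset)
  also have "\<dots> \<le> m W"
    using W by (intro m_mono) (auto dest: openin_subset)
  finally show "outer_content C + outer_content D \<le> m W" .
qed

section \<open>Mass of open sets and countable subadditivity\<close>

lemma open_mass_ge: "closedin S C \<Longrightarrow> C \<subseteq> U \<Longrightarrow> outer_content C \<le> open_mass U"
  unfolding open_mass_def by (intro SUP_upper) auto

lemma open_mass_leI: "(\<And>C. closedin S C \<Longrightarrow> C \<subseteq> U \<Longrightarrow> outer_content C \<le> x) \<Longrightarrow> open_mass U \<le> x"
  unfolding open_mass_def by (intro SUP_least) auto

lemma open_mass_mono: "U \<subseteq> W \<Longrightarrow> open_mass U \<le> open_mass W"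
  by (intro open_mass_leI open_mass_ge) auto

lemma open_mass_empty: "open_mass {} = 0"
  using open_mass_leI [of "{}" 0] outer_content_empty by auto

lemma open_mass_space: "open_mass (topspace S) = 1"
proof (rule antisym)
  show "open_mass (topspace S) \<le> 1"
    using outer_content_le [OF openin_topspace] m_space
    by (intro open_mass_leI) auto
  show "1 \<le> open_mass (topspace S)"
    using m_le_outer_content [of "topspace S"] m_space open_mass_ge [of "topspace S"]
    by (auto intro: order_trans)
qed

text \<open>\<open>C - U\<close> and \<open>C - W\<close> are disjoint closed sets. Removing from
  \<open>C\<close> one or the other of two disjoint open neighbourhoods of them leaves two pieces,
  which cover \<open>C\<close> since no point lies in both neighbourhoods.\<close>

lemma closed_split:
  assumes C: "closedin S C" "C \<subseteq> U \<union> W" and UW: "openin S U" "openin S W"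
  obtains D E where "closedin S D" "closedin S E" "D \<subseteq> U" "E \<subseteq> W" "C = D \<union> E"
proof -
  have "closedin S (C - U)" "closedin S (C - W)" "disjnt (C - U) (C - W)"
    using C UW by (auto simp: disjnt_def)
  then obtain A B where AB: "openin S A" "openin S B" "C - U \<subseteq> A" "C - W \<subseteq> B" "disjnt A B"
    using normal unfolding normal_space_def by meson
  show ?thesis
  proof
    show "closedin S (C - A)" "closedin S (C - B)" using AB C by auto
    show "C - A \<subseteq> U" "C - B \<subseteq> W" "C = C - A \<union> (C - B)"
      using AB by (auto simp: disjnt_def)
  qed
qed

lemma open_mass_Un:
  assumes "openin S U" "openin S W"
  shows "open_mass (U \<union> W) \<le> open_mass U + open_mass W"
proof (rule open_mass_leI)
  fix C assume C: "closedin S C" "C \<subseteq> U \<union> W"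
  obtain D E where DE: "closedin S D" "closedin S E" "D \<subseteq> U" "E \<subseteq> W" "C = D \<union> E"
    using closed_split [OF C assms] .
  have "outer_content C \<le> outer_content D + outer_content E"
    unfolding DE(5) by (rule outer_content_subadd)
  also have "\<dots> \<le> open_mass U + open_mass W"
    using DE by (intro add_mono open_mass_ge)
  finally show "outer_content C \<le> open_mass U + open_mass W" .
qed

lemma open_mass_UN_finite:
  assumes "\<And>i::nat. openin S (U i)"
  shows "open_mass (\<Union>i<N. U i) \<le> (\<Sum>i<N. open_mass (U i))"
proof (induction N)
  case 0
  then show ?case by (simp add: open_mass_empty)
next
  case (Suc N)
  have "open_mass (\<Union>i<Suc N. U i) = open_mass ((\<Union>i<N. U i) \<union> U N)"
    by (simp add: lessThan_Suc Un_commute)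
  also have "\<dots> \<le> open_mass (\<Union>i<N. U i) + open_mass (U N)"
    using assms by (intro open_mass_Un) auto
  also have "\<dots> \<le> (\<Sum>i<Suc N. open_mass (U i))"
    using Suc by (simp add: add_right_mono)
  finally show ?case .
qed

text \<open>A closed set inside a countable union of open sets is compact, hence inside a finite
  subunion. This is the source of countable subadditivity.\<close>

lemma open_mass_UN:
  assumes U: "\<And>i::nat. openin S (U i)"
  shows "open_mass (\<Union>i. U i) \<le> (\<Sum>i. open_mass (U i))"
proof (rule open_mass_leI)
  fix C assume C: "closedin S C" "C \<subseteq> (\<Union>i. U i)"
  have "compactin S C" using C compact closedin_compact_space by blast
  then have "\<exists>F. finite F \<and> F \<subseteq> range U \<and> C \<subseteq> \<Union>F"
    using compactinD [of S C "range U"] C U by auto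
  then obtain F where F: "finite F" "F \<subseteq> range U" "C \<subseteq> \<Union>F" by blast
  then obtain I where I: "finite I" "F = U ` I" by (meson finite_subset_image)
  obtain N where N: "I \<subseteq> {..<N}" using I(1) finite_nat_iff_bounded by blast
  have "C \<subseteq> (\<Union>i<N. U i)" using F I N by fastforce
  then have "outer_content C \<le> open_mass (\<Union>i<N. U i)"
    using C by (intro open_mass_ge)
  also have "\<dots> \<le> (\<Sum>i<N. open_mass (U i))" by (rule open_mass_UN_finite [OF U])
  also have "\<dots> \<le> (\<Sum>i. open_mass (U i))" by (intro sum_le_suminf) auto
  finally show "outer_content C \<le> (\<Sum>i. open_mass (U i))" .
qed

lemma outer_mass_le: "openin S U \<Longrightarrow> A \<subseteq> U \<Longrightarrow> outer_mass A \<le> open_mass U"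
  unfolding outer_mass_def by (intro INF_lower) auto

lemma le_outer_mass: "(\<And>U. openin S U \<Longrightarrow> A \<subseteq> U \<Longrightarrow> x \<le> open_mass U) \<Longrightarrow> x \<le> outer_mass A"
  unfolding outer_mass_def by (intro INF_greatest) auto

lemma outer_mass_open: "openin S U \<Longrightarrow> outer_mass U = open_mass U"
  by (intro antisym outer_mass_le le_outer_mass open_mass_mono) auto

lemma outer_mass_mono: "A \<subseteq> B \<Longrightarrow> outer_mass A \<le> outer_mass B"
  by (intro le_outer_mass outer_mass_le) auto

lemma outer_mass_empty: "outer_mass {} = 0"
  by (simp add: outer_mass_open open_mass_empty)

lemma outer_mass_le_1: "A \<subseteq> topspace S \<Longrightarrow> outer_mass A \<le> 1"
  using outer_mass_le [OF openin_topspace] by (simp add: open_mass_space)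

lemma outer_mass_approx:
  assumes A: "A \<subseteq> topspace S" and e: "0 < e"
  obtains U where "openin S U" "A \<subseteq> U" "open_mass U \<le> outer_mass A + ennreal e"
proof -
  have "outer_mass A < top" using outer_mass_le_1 [OF A] by (simp add: le_less_trans)
  then have "outer_mass A < outer_mass A + ennreal e"
    using e by (rule ennreal_less_add_pos)
  then have "(INF U\<in>{U. openin S U \<and> A \<subseteq> U}. open_mass U) < outer_mass A + ennreal e"
    by (simp only: outer_mass_def)
  then obtain U where "openin S U" "A \<subseteq> U" "open_mass U < outer_mass A + ennreal e"
    unfolding INF_less_iff by auto
  then show ?thesis using that less_imp_le by metis
qed

lemma outer_mass_UN:
  assumes A: "\<And>i::nat. A i \<subseteq> topspace S"
  shows "outer_mass (\<Union>i. A i) \<le> (\<Sum>i. outer_mass (A i))"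
proof (rule ennreal_le_epsilon)
  fix e :: real assume e: "0 < e"
  have "\<exists>U. openin S U \<and> A i \<subseteq> U \<and> open_mass U \<le> outer_mass (A i) + ennreal (e * (1/2)^Suc i)" for i
  proof -
    have "0 < e * (1/2)^Suc i" using e by simp
    then show ?thesis using outer_mass_approx [OF A] by metis
  qed
  then obtain U where U: "\<And>i. openin S (U i)" "\<And>i. A i \<subseteq> U i"
    "\<And>i. open_mass (U i) \<le> outer_mass (A i) + ennreal (e * (1/2)^Suc i)"
    by metis
  have "outer_mass (\<Union>i. A i) \<le> open_mass (\<Union>i. U i)"
    using U by (intro outer_mass_le) auto
  also have "\<dots> \<le> (\<Sum>i. open_mass (U i))" by (rule open_mass_UN [OF U(1)])
  also have "\<dots> \<le> (\<Sum>i. outer_mass (A i) + ennreal (e * (1/2)^Suc i))"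
    using U by (intro suminf_le) auto
  also have "\<dots> = (\<Sum>i. outer_mass (A i)) + (\<Sum>i. ennreal (e * (1/2)^Suc i))"
    by (intro suminf_add [symmetric]) auto
  also have "(\<Sum>i. ennreal (e * (1/2)^Suc i)) = ennreal e"
  proof (rule suminf_ennreal_eq)
    show "(\<lambda>i. e * (1/2)^Suc i) sums e"
      using sums_mult [OF power_half_series, of e] by simp
  qed (use e in auto)
  finally show "outer_mass (\<Union>i. A i) \<le> (\<Sum>i. outer_mass (A i)) + ennreal e" .
qed

lemma outer_mass_Un:
  assumes "A \<subseteq> topspace S" "B \<subseteq> topspace S"
  shows "outer_mass (A \<union> B) \<le> outer_mass A + outer_mass B"
proof -
  define F :: "nat \<Rightarrow> 's set" where "F = (\<lambda>i. if i = 0 then A else if i = 1 then B else {})"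
  have "(\<Union>i. F i) = A \<union> B"
    by (auto simp: F_def split: if_splits)
  moreover have "(\<Sum>i. outer_mass (F i)) = (\<Sum>i\<in>{0,1}. outer_mass (F i))"
    by (intro suminf_finite) (auto simp: F_def outer_mass_empty)
  ultimately show ?thesis
    using outer_mass_UN [of F] assms by (auto simp: F_def)
qed

text \<open>Caratheodory's inequality for open test sets. Exhaust \<open>U \<inter> W\<close> by
  closed \<open>C\<close>; then \<open>U - C\<close> is open, contains \<open>U - W\<close>, and its
  closed subsets \<open>D\<close> are disjoint from \<open>C\<close>, so that
  \<open>outer_content\<close> is superadditive on \<open>C \<union> D\<close>.\<close>

lemma open_mass_split:
  assumes U: "openin S U" and W: "openin S W"
  shows "open_mass (U \<inter> W) + outer_mass (U - W) \<le> open_mass U"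
proof -
  have "outer_content C + outer_mass (U - W) \<le> open_mass U" if C: "closedin S C" "C \<subseteq> U \<inter> W" for C
  proof -
    have op: "openin S (U - C)" using U C by auto
    have "outer_content C + outer_content D \<le> open_mass U" if D: "closedin S D" "D \<subseteq> U - C" for D
    proof -
      have "outer_content C + outer_content D \<le> outer_content (C \<union> D)"
        using C D by (intro outer_content_superadd) (auto simp: disjnt_def)
      also have "\<dots> \<le> open_mass U" using C D by (intro open_mass_ge) auto
      finally show ?thesis .
    qed
    then have "outer_content C + open_mass (U - C) \<le> open_mass U"
      unfolding open_mass_def [of "U - C"]
      by (subst ennreal_SUP_add_right) (auto intro: SUP_least)
    moreover have "outer_mass (U - W) \<le> open_mass (U - C)"
      using op C by (intro outer_mass_le) auto
    ultimately show ?thesis using add_left_mono order_trans by blast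
  qed
  then show ?thesis
    unfolding open_mass_def [of "U \<inter> W"]
    by (subst ennreal_SUP_add_left [symmetric]) (auto intro: SUP_least)
qed

text \<open>\<open>outer_mass A\<close> is an infimum over open \<open>U\<close> around
  \<open>A\<close>, so the inequality for an arbitrary test set follows from the one for open test
  sets; subadditivity is the converse.\<close>

lemma open_in_lambda_system:
  assumes W: "openin S W"
  shows "W \<in> lambda_system (topspace S) (Pow (topspace S)) outer_mass"
  unfolding lambda_system_def
proof (intro CollectI conjI ballI)
  show "W \<in> Pow (topspace S)" using openin_subset [OF W] by simp
  fix A assume "A \<in> Pow (topspace S)"
  then have A: "A \<subseteq> topspace S" by simp
  show "outer_mass (W \<inter> A) + outer_mass ((topspace S - W) \<inter> A) = outer_mass A"
  proof (rule antisym)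
    show "outer_mass (W \<inter> A) + outer_mass ((topspace S - W) \<inter> A) \<le> outer_mass A"
    proof (rule le_outer_mass)
      fix U assume U: "openin S U" "A \<subseteq> U"
      have "outer_mass (W \<inter> A) + outer_mass ((topspace S - W) \<inter> A) \<le> open_mass (U \<inter> W) + outer_mass (U - W)"
        using U W by (intro add_mono outer_mass_le outer_mass_mono) auto
      also have "\<dots> \<le> open_mass U" using U W by (intro open_mass_split)
      finally show "outer_mass (W \<inter> A) + outer_mass ((topspace S - W) \<inter> A) \<le> open_mass U" .
    qed
    have "A = (W \<inter> A) \<union> ((topspace S - W) \<inter> A)" using A by auto
    then show "outer_mass A \<le> outer_mass (W \<inter> A) + outer_mass ((topspace S - W) \<inter> A)"
      using outer_mass_Un [of "W \<inter> A" "(topspace S - W) \<inter> A"] A by auto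
  qed
qed

definition borel_mass :: "'s measure" where
  "borel_mass = measure_of (topspace S) {U. openin S U} outer_mass"

lemma space_borel_mass: "space borel_mass = topspace S"
  by (simp add: borel_mass_def space_measure_of_conv)

lemma sets_borel_mass: "sets borel_mass = sigma_sets (topspace S) {U. openin S U}"
  unfolding borel_mass_def by (intro sets_measure_of) (auto dest: openin_subset)

lemma emeasure_borel_mass:
  assumes "A \<in> sets borel_mass"
  shows "emeasure borel_mass A = outer_mass A"
proof -
  interpret P: sigma_algebra "topspace S" "Pow (topspace S)" by (rule sigma_algebra_Pow)
  let ?L = "lambda_system (topspace S) (Pow (topspace S)) outer_mass"
  have oms: "outer_measure_space (Pow (topspace S)) outer_mass"
    unfolding outer_measure_space_def positive_def increasing_def countably_subadditive_def
    using outer_mass_empty outer_mass_mono 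
    by (auto intro!: outer_mass_UN dest: range_subsetD)
  have ms: "measure_space (topspace S) ?L outer_mass"
    by (rule P.caratheodory_lemma [OF oms])
  then interpret L: sigma_algebra "topspace S" ?L by (simp add: measure_space_def)
  have sub: "sigma_sets (topspace S) {U. openin S U} \<subseteq> ?L"
    by (intro L.sigma_sets_subset) (auto simp: open_in_lambda_system)
  have "positive ?L outer_mass" "countably_additive ?L outer_mass"
    using ms by (auto simp: measure_space_def)
  then have *: "positive (sets borel_mass) outer_mass" "countably_additive (sets borel_mass) outer_mass"
    using sub unfolding sets_borel_mass
    by (auto simp: positive_def) (meson countably_additive_def subsetD subset_trans)
  show ?thesis
    using * assms
    by (intro emeasure_measure_of [OF borel_mass_def]) (auto dest: openin_subset)
qed

lemma closed_sets_borel_mass: "closedin S C \<Longrightarrow> C \<in> sets borel_mass"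
proof -
  assume C: "closedin S C"
  then have "topspace S - C \<in> sets borel_mass"
    unfolding sets_borel_mass by (intro sigma_sets.Basic) auto
  then have "space borel_mass - (topspace S - C) \<in> sets borel_mass" by (rule sets.compl_sets)
  moreover have "space borel_mass - (topspace S - C) = C"
    using closedin_subset [OF C] by (auto simp: space_borel_mass)
  ultimately show ?thesis by simp
qed

lemma prob_space_borel_mass: "prob_space borel_mass"
proof
  have "topspace S \<in> sets borel_mass" by (simp add: closed_sets_borel_mass)
  then show "emeasure borel_mass (space borel_mass) = 1"
    by (simp add: space_borel_mass emeasure_borel_mass outer_mass_open open_mass_space)
qed

text \<open>Any open \<open>U\<close> around \<open>C\<close> has
  \<open>m C \<le> outer_content C \<le> open_mass U\<close>. Equality cannot be expected: mass that
  \<open>m\<close> puts arbitrarily near \<open>C\<close> may end up on \<open>C\<close>. The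
  inequality is the favourable one, because a lower bound is wanted for integrals of functions whose
  upper level sets are closed.\<close>

lemma emeasure_borel_mass_closed_ge:
  assumes C: "closedin S C"
  shows "m C \<le> emeasure borel_mass C"
  unfolding emeasure_borel_mass [OF closed_sets_borel_mass [OF C]]
  using C open_mass_ge m_le_outer_content [of C] by (intro le_outer_mass) (blast intro: order_trans)

text \<open>Outer regularity is the definition of \<open>outer_mass\<close>. Inner regularity is
  outer regularity of the complement: an open \<open>U\<close> around the complement has a closed,
  hence compact, complement of its own, which misses at most mass \<open>e\<close> of
  \<open>A\<close>.\<close>

lemma regular_prob_borel_mass: "regular_prob S borel_mass"
  unfolding regular_prob_def
proof (intro conjI ballI prob_space_borel_mass space_borel_mass sets_borel_mass)
  interpret prob_space borel_mass by (rule prob_space_borel_mass)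
  have open_sets: "U \<in> sets borel_mass" if "openin S U" for U
    using that unfolding sets_borel_mass by (intro sigma_sets.Basic) auto
  fix A assume A: "A \<in> sets borel_mass"
  have As: "A \<subseteq> topspace S" using sets.sets_into_space [OF A] by (simp add: space_borel_mass)
  show "emeasure borel_mass A = (INF U\<in>{U. openin S U \<and> A \<subseteq> U}. emeasure borel_mass U)"
    unfolding emeasure_borel_mass [OF A] outer_mass_def [of A]
    by (intro INF_cong) (auto simp: emeasure_borel_mass open_sets outer_mass_open)
  show "emeasure borel_mass A =
      (SUP K\<in>{K. compactin S K \<and> K \<in> sets borel_mass \<and> K \<subseteq> A}. emeasure borel_mass K)" (is "_ = ?R")
  proof (rule antisym)
    show "?R \<le> emeasure borel_mass A"
      using A by (intro SUP_least emeasure_mono) auto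
    show "emeasure borel_mass A \<le> ?R"
    proof (rule ennreal_le_epsilon)
      fix e :: real assume e: "0 < e"
      obtain U where U: "openin S U" "topspace S - A \<subseteq> U"
        "open_mass U \<le> outer_mass (topspace S - A) + ennreal e"
        using outer_mass_approx [of "topspace S - A" e] e by blast
      let ?K = "topspace S - U"
      have K: "closedin S ?K" "?K \<subseteq> A" using U As by auto
      have cA: "topspace S - A \<in> sets borel_mass" using sets.compl_sets [OF A] by (simp add: space_borel_mass)
      have "A \<subseteq> ?K \<union> (U - (topspace S - A))" using As by auto
      then have "emeasure borel_mass A \<le> emeasure borel_mass (?K \<union> (U - (topspace S - A)))"
        using open_sets [OF U(1)] closed_sets_borel_mass [OF K(1)] cA by (intro emeasure_mono) auto
      also have "\<dots> \<le> emeasure borel_mass ?K + emeasure borel_mass (U - (topspace S - A))"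
        using open_sets [OF U(1)] closed_sets_borel_mass [OF K(1)] cA by (intro emeasure_subadditive) auto
      also have "emeasure borel_mass (U - (topspace S - A)) =
          emeasure borel_mass U - emeasure borel_mass (topspace S - A)"
        using open_sets [OF U(1)] cA U by (intro emeasure_Diff) auto
      also have "\<dots> \<le> ennreal e"
        using U(3) cA open_sets [OF U(1)] U(1) emeasure_finite [of "topspace S - A"]
        by (simp add: emeasure_borel_mass outer_mass_open ennreal_minus_le_iff)
      also have "emeasure borel_mass ?K \<le> ?R"
        using K compact closed_sets_borel_mass [OF K(1)]
        by (intro SUP_upper) (auto intro: closedin_compact_space)
      finally show "emeasure borel_mass A \<le> ?R + ennreal e" by (simp add: add_mono)
    qed
  qed
qed

end

section \<open>Pietsch domination by finitely supported averages\<close>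

text \<open>Playing against the current deficits keeps their sum of squares growing only linearly
  (Blackwell's approachability argument).\<close>

lemma greedy_average:
  fixes a :: "nat \<Rightarrow> 'x \<Rightarrow> real"
  assumes bound: "\<And>i x. i < k \<Longrightarrow> x \<in> K \<Longrightarrow> \<bar>a i x\<bar> \<le> B"
    and choice: "\<And>w :: nat \<Rightarrow> nat. \<exists>x\<in>K. - 1 \<le> (\<Sum>i<k. real (w i) * a i x)"
    and e: "0 < e"
  obtains N :: nat and xs where "0 < N" "\<And>j. xs j \<in> K" "\<And>i. i < k \<Longrightarrow> - e * real N \<le> (\<Sum>j<N. a i (xs j))"
proof -
  obtain X where X: "\<And>w. X w \<in> K" "\<And>w :: nat \<Rightarrow> nat. - 1 \<le> (\<Sum>i<k. real (w i) * a i (X w))"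
    using choice by metis
  \<comment> \<open>Negative parts of the running sums, rounded down because \<open>choice\<close>
    speaks of integer weights; the rounding changes each product by at most
    \<open>B\<close>.\<close>
  define deficit where "deficit = (\<lambda>s :: nat \<Rightarrow> real. \<lambda>i. nat \<lfloor>max 0 (- s i)\<rfloor>)"
  define S where "S = rec_nat (\<lambda>_. 0) (\<lambda>_ s i. s i + a i (X (deficit s)))"
  have S0: "S 0 i = 0" and SSuc: "S (Suc t) i = S t i + a i (X (deficit (S t)))" for i t
    by (simp_all add: S_def)
  \<comment> \<open>Growth per step: \<open>2\<close> is twice the slack \<open>1\<close> in
    \<open>choice\<close>, and each coordinate contributes \<open>2 * B\<close> for the rounding and
    \<open>B\<^sup>2\<close> for the square of the increment.\<close>
  define C where "C = 2 + real k * (2 * B + B\<^sup>2)"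
  have D: "(\<Sum>i<k. (max 0 (- S t i))\<^sup>2) \<le> C * real t" for t
  proof (induction t)
    case 0
    then show ?case by (simp add: S0)
  next
    case (Suc t)
    let ?w = "deficit (S t)"
    have step: "(max 0 (- S (Suc t) i))\<^sup>2 \<le>
        (max 0 (- S t i))\<^sup>2 - 2 * (real (?w i) * a i (X ?w)) + (2 * B + B\<^sup>2)" if i: "i < k" for i
    proof -
      define y where "y = a i (X ?w)"
      define n where "n = max 0 (- S t i)"
      have y: "\<bar>y\<bar> \<le> B" unfolding y_def using bound [OF i X(1)] .
      have w: "n - 1 \<le> real (?w i)" "real (?w i) \<le> n"
        unfolding deficit_def n_def by linarith+
      have "(max 0 (- S (Suc t) i))\<^sup>2 \<le> (n - y)\<^sup>2"
        unfolding SSuc y_def [symmetric] n_def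
        by (auto simp: max_def intro!: power_mono)
      also have "\<dots> = n\<^sup>2 - 2 * n * y + y\<^sup>2" by (simp add: power2_eq_square algebra_simps)
      also have "y\<^sup>2 \<le> B\<^sup>2" using y by (simp add: abs_le_square_iff [symmetric])
      also have "- (n * y) \<le> - (real (?w i) * y) + B"
      proof -
        have "(real (?w i) - n) * y \<le> \<bar>real (?w i) - n\<bar> * \<bar>y\<bar>" by (metis abs_ge_self abs_mult)
        also have "\<dots> \<le> 1 * B" using w y by (intro mult_mono) auto
        finally show ?thesis by (simp add: algebra_simps)
      qed
      then have "n\<^sup>2 - 2 * n * y + B\<^sup>2 \<le> n\<^sup>2 - 2 * (real (?w i) * y) + (2 * B + B\<^sup>2)" by simp
      finally show ?thesis unfolding y_def n_def by simp
    qed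
    have "(\<Sum>i<k. (max 0 (- S (Suc t) i))\<^sup>2) \<le>
        (\<Sum>i<k. (max 0 (- S t i))\<^sup>2 - 2 * (real (?w i) * a i (X ?w)) + (2 * B + B\<^sup>2))"
      using step by (intro sum_mono) auto
    also have "\<dots> = (\<Sum>i<k. (max 0 (- S t i))\<^sup>2) - 2 * (\<Sum>i<k. real (?w i) * a i (X ?w)) + real k * (2 * B + B\<^sup>2)"
      by (simp add: sum.distrib sum_subtractf sum_distrib_left)
    also have "\<dots> \<le> C * real t + C"
      using Suc X(2) [of ?w] unfolding C_def by linarith
    finally show ?case by (simp add: algebra_simps)
  qed
  have Ssum: "S t i = (\<Sum>j<t. a i (X (deficit (S j))))" for t i
    by (induction t) (simp_all add: S0 SSuc)
  \<comment> \<open>Large enough for \<open>C * N \<le> (e * N)\<^sup>2\<close>: the sum of squares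
    grows linearly in \<open>N\<close>, the square of the tolerated deficit quadratically.\<close>
  define N where "N = Suc (nat \<lceil>C / e\<^sup>2\<rceil>)"
  have "C / e\<^sup>2 \<le> real N" unfolding N_def by linarith
  then have CN: "C \<le> e\<^sup>2 * real N" using e by (simp add: field_simps)
  show ?thesis
  proof
    show "0 < N" by (simp add: N_def)
    show "X (deficit (S j)) \<in> K" for j by (rule X)
    fix i assume i: "i < k"
    have "(max 0 (- S N i))\<^sup>2 \<le> (\<Sum>i<k. (max 0 (- S N i))\<^sup>2)"
      using i by (intro member_le_sum) auto
    also have "\<dots> \<le> C * real N" by (rule D)
    also have "\<dots> \<le> (e\<^sup>2 * real N) * real N" using CN by (intro mult_right_mono) auto
    also have "\<dots> = (e * real N)\<^sup>2" by (simp add: power2_eq_square)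
    finally have "max 0 (- S N i) \<le> e * real N"
      by (rule power2_le_imp_le) (use e in auto)
    then show "- e * real N \<le> (\<Sum>j<N. a i (X (deficit (S j))))"
      unfolding Ssum [symmetric] by simp
  qed
qed

text \<open>The sum is \<open>d\<close> times the floor of \<open>y / d\<close>: for
  \<open>y\<close> up to \<open>L * d\<close> it counts the \<open>l\<close> from 1 to
  \<open>L\<close> with \<open>l * d \<le> y\<close>. The levels are closed conditions because
  closed sets are those whose mass is known not to drop.\<close>

lemma layer_bounds:
  fixes y :: real
  assumes y: "0 \<le> y" "y \<le> real L * d" and d: "0 < d"
  shows "(\<Sum>l=1..L. d * indicator {t. real l * d \<le> t} y) \<le> y"
    and "y \<le> d + (\<Sum>l=1..L. d * indicator {t. real l * d \<le> t} y)"
proof -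
  define c where "c = nat \<lfloor>y / d\<rfloor>"
  have "0 \<le> y / d" using y d by simp
  then have c: "real c \<le> y / d" "y / d < real c + 1"
    unfolding c_def by linarith+
  have "y / d \<le> real L" using y d by (simp add: field_simps)
  then have cL: "c \<le> L" using c by linarith
  have "real l * d \<le> y \<longleftrightarrow> l \<le> c" for l
  proof -
    have "real l * d \<le> y \<longleftrightarrow> real l \<le> y / d" using d by (simp add: field_simps)
    also have "\<dots> \<longleftrightarrow> l \<le> c" using c by linarith
    finally show ?thesis .
  qed
  then have "(\<Sum>l=1..L. d * indicator {t. real l * d \<le> t} y) = (\<Sum>l=1..L. if l \<le> c then d else 0)"
    by (intro sum.cong) (auto simp: indicator_def)
  also have "\<dots> = (\<Sum>l\<in>{1..L} \<inter> {l. l \<le> c}. d)"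
    using sum.inter_restrict [of "{1..L}" "\<lambda>_. d" "{l. l \<le> c}"] by simp
  also have "{1..L} \<inter> {l. l \<le> c} = {1..c}" using cL by auto
  finally have eq: "(\<Sum>l=1..L. d * indicator {t. real l * d \<le> t} y) = real c * d" by simp
  show "(\<Sum>l=1..L. d * indicator {t. real l * d \<le> t} y) \<le> y"
    "y \<le> d + (\<Sum>l=1..L. d * indicator {t. real l * d \<le> t} y)"
    unfolding eq using c d by (simp_all add: field_simps)
qed

lemma regular_prob_measurable:
  assumes M: "regular_prob S M" and f: "continuous_map S euclidean f"
  shows "f \<in> borel_measurable M"
proof (rule borel_measurableI)
  fix U :: "'b set" assume "open U"
  then have "openin S {x \<in> topspace S. f x \<in> U}"
    using f by (simp add: continuous_map_def)
  moreover have "f -` U \<inter> space M = {x \<in> topspace S. f x \<in> U}"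
    using M by (auto simp: regular_prob_def)
  ultimately show "f -` U \<inter> space M \<in> sets M"
    using M by (auto simp: regular_prob_def)
qed

text \<open>All subsets of the type are measured, so that every requirement is a closed condition on
  coordinates; concentration on \<open>K\<close> is imposed separately by
  \<open>m K = 1\<close>.\<close>

definition fin_additive :: "('x set \<Rightarrow> real) \<Rightarrow> bool" where
  "fin_additive m \<longleftrightarrow> (\<forall>A. m A \<in> {0..1}) \<and> m {} = 0 \<and> (\<forall>A B. A \<inter> B = {} \<longrightarrow> m (A \<union> B) = m A + m B)"

text \<open>A closed subset of the Tychonoff cube of set functions with values in
  \<open>[0, 1]\<close>, since each condition involves finitely many coordinates.\<close>

lemma compact_fin_additive: "compact {m :: 'x set \<Rightarrow> real. fin_additive m \<and> m K = 1}"
proof -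
  have 1: "compact (Pi\<^sub>E UNIV (\<lambda>_ :: 'x set. {0..1 :: real}))"
    unfolding compactin_euclidean_iff [symmetric] euclidean_product_topology [symmetric]
    by (simp add: compactin_PiE)
  have cont: "continuous_on UNIV (\<lambda>m :: 'x set \<Rightarrow> real. m A)" for A
    by (rule continuous_on_product_coordinates)
  have 2: "closed {m :: 'x set \<Rightarrow> real. m {} = 0 \<and> m K = 1 \<and> (\<forall>A B. A \<inter> B = {} \<longrightarrow> m (A \<union> B) = m A + m B)}"
    by (intro closed_Collect_conj closed_Collect_all closed_Collect_imp closed_Collect_eq open_Collect_const
        continuous_intros cont)
  have "{m. fin_additive m \<and> m K = 1} = Pi\<^sub>E UNIV (\<lambda>_ :: 'x set. {0..1 :: real}) \<inter>
      {m :: 'x set \<Rightarrow> real. m {} = 0 \<and> m K = 1 \<and> (\<forall>A B. A \<inter> B = {} \<longrightarrow> m (A \<union> B) = m A + m B)}"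
    by (auto simp: fin_additive_def PiE_UNIV_domain Pi_def)
  then show ?thesis using compact_Int_closed [OF 1 2] by simp
qed

lemma fin_additive_mono: "fin_additive m \<Longrightarrow> A \<subseteq> B \<Longrightarrow> m A \<le> m B"
  unfolding fin_additive_def
  by (metis Diff_disjoint Diff_partition add_increasing2 atLeastAtMost_iff order_refl)

lemma fin_additive_subadd: "fin_additive m \<Longrightarrow> m (A \<union> B) \<le> m A + m B"
  using fin_additive_mono [of m "B - A" B] unfolding fin_additive_def
  by (metis Diff_disjoint Un_Diff_cancel add_left_mono Diff_subset)

lemma content_space_fin_additive:
  assumes "compact_space S" "Hausdorff_space S" and m: "fin_additive m" "m (topspace S) = 1"
  shows "content_space S (\<lambda>A. ennreal (m A))"
proof
  have nn: "0 \<le> m A" for A using m by (simp add: fin_additive_def)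
  show "ennreal (m {}) = 0" using m by (simp add: fin_additive_def)
  show "ennreal (m (topspace S)) = 1" using m by simp
  show "ennreal (m A) \<le> ennreal (m B)" if "A \<subseteq> B" for A B
    using fin_additive_mono [OF m(1) that] by (simp add: ennreal_leI)
  show "ennreal (m (A \<union> B)) \<le> ennreal (m A) + ennreal (m B)" for A B
    using fin_additive_subadd [OF m(1)] nn by (simp add: ennreal_leI flip: ennreal_plus)
  show "ennreal (m A) + ennreal (m B) \<le> ennreal (m (A \<union> B))" if "disjnt A B" for A B
    using m that nn by (simp add: fin_additive_def disjnt_def flip: ennreal_plus)
qed (use assms in auto)

definition uniform_mass :: "nat \<Rightarrow> (nat \<Rightarrow> 'x) \<Rightarrow> 'x set \<Rightarrow> real" where
  "uniform_mass N xs A = (\<Sum>j<N. indicator A (xs j)) / real N"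

lemma fin_additive_uniform_mass:
  assumes "0 < N"
  shows "fin_additive (uniform_mass N xs)"
proof -
  have "(\<Sum>j<N. indicator A (xs j) :: real) \<le> (\<Sum>j<N. 1)" for A
    by (intro sum_mono) (auto simp: indicator_def)
  then have "(\<Sum>j<N. indicator A (xs j) :: real) \<le> real N" for A by simp
  moreover have "indicator (A \<union> B) x = (indicator A x + indicator B x :: real)" if "A \<inter> B = {}" for A B :: "'a set" and x
    using that by (auto simp: indicator_def)
  ultimately show ?thesis
    using assms by (auto simp: fin_additive_def uniform_mass_def sum.distrib add_divide_distrib intro!: sum_nonneg divide_nonneg_nonneg)
qed

text \<open>The usual proof of Pietsch's theorem separates a cone from the negative functions and
  represents the functional by a measure. Here each desired inequality is replaced by its layer sums
  of mesh \<open>1 / n\<close>, which involve \<open>m\<close> at finitely many sets and so cut out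
  closed sets of finitely additive probabilities. The greedy averages show that any finitely many of
  these sets meet; a common point of all of them induces the measure.\<close>

lemma exists_dominating_measure:
  fixes f :: "'j \<Rightarrow> 's \<Rightarrow> real"
  assumes S: "compact_space S" "Hausdorff_space S"
    and cont: "\<And>j. j \<in> J \<Longrightarrow> continuous_map S euclidean (f j)"
    and f: "\<And>j x. j \<in> J \<Longrightarrow> x \<in> topspace S \<Longrightarrow> 0 \<le> f j x \<and> f j x \<le> B j"
    and choice: "\<And>js. set js \<subseteq> J \<Longrightarrow> \<exists>x\<in>topspace S. - 1 \<le> (\<Sum>j\<leftarrow>js. f j x - b j)"
  obtains M where "regular_prob S M" "\<And>j. j \<in> J \<Longrightarrow> b j \<le> (LINT x|M. f j x)"
proof -
  define K where "K = topspace S"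
  \<comment> \<open>Enough levels of height \<open>1 / n\<close> to reach the bound
    \<open>B j\<close>.\<close>
  define L where "L = (\<lambda>j n. nat \<lceil>B j * real n\<rceil>)"
  have L: "B j \<le> real (L j n) * (1 / real n)" if "0 < n" for j n
    using that real_nat_ceiling_ge [of "B j * real n"] unfolding L_def by (simp add: field_simps)
  define lev where "lev = (\<lambda>j n l. {x \<in> K. real l * (1 / real n) \<le> f j x})"
  \<comment> \<open>One \<open>1 / n\<close> absorbs the error of the greedy average, the other the
    rounding of the layer sum.\<close>
  define good where "good = (\<lambda>(j, n :: nat).
    {m :: 's set \<Rightarrow> real. b j - 1 / real n \<le> 1 / real n + (\<Sum>l=1..L j n. 1 / real n * m (lev j n l))})"
  define I where "I = J \<times> {n :: nat. 0 < n}"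
  have "{m. fin_additive m \<and> m K = 1} \<inter> \<Inter>(good ` I) \<noteq> {}"
  proof (rule compact_imp_fip_image [OF compact_fin_additive])
    show "closed (good i)" if "i \<in> I" for i
    proof -
      have cont: "continuous_on UNIV (\<lambda>m :: 's set \<Rightarrow> real. m A)" for A
        by (rule continuous_on_product_coordinates)
      obtain j n where i: "i = (j, n)" by fastforce
      show ?thesis unfolding i good_def prod.case
        by (intro closed_Collect_le continuous_intros cont)
    qed
    fix I' assume fin: "finite I'" and sub: "I' \<subseteq> I"
    obtain ls where ls: "set ls = I'" using finite_list [OF fin] by blast
    define js where "js = map fst ls"
    \<comment> \<open>At most \<open>1 / n\<close> for every mesh that occurs in the finite set
      \<open>I'\<close>.\<close>
    define e where "e = 1 / real (Suc (\<Sum>i\<in>I'. snd i))"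
    have e0: "0 < e" unfolding e_def by (simp only: zero_less_divide_1_iff of_nat_0_less_iff zero_less_Suc)
    have e: "e \<le> 1 / real n" if "(j, n) \<in> I'" for j n
    proof -
      have "n \<le> (\<Sum>i\<in>I'. snd i)" using member_le_sum [of "(j, n)" I' snd] that fin by simp
      moreover have "0 < n" using that sub by (auto simp: I_def)
      ultimately show ?thesis unfolding e_def by (intro frac_le) (simp_all only: of_nat_le_iff of_nat_0_less_iff zero_le_one order_refl le_SucI)
    qed
    have jsJ: "js ! i \<in> J" if "i < length js" for i
      using that nth_mem [of i js] ls sub by (auto simp: js_def I_def)
    define BB where "BB = (\<Sum>i<length js. B (js ! i) + \<bar>b (js ! i)\<bar>)"
    have bnd: "\<bar>f (js ! i) x - b (js ! i)\<bar> \<le> BB" if i: "i < length js" and x: "x \<in> K" for i x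
    proof -
      have "0 \<le> B (js ! i')" if "i' < length js" for i'
        using f [OF jsJ [OF that], of x] x by (simp add: K_def)
      then have "B (js ! i) + \<bar>b (js ! i)\<bar> \<le> BB"
        unfolding BB_def using i by (intro member_le_sum) (auto intro: add_nonneg_nonneg)
      moreover have "0 \<le> f (js ! i) x" "f (js ! i) x \<le> B (js ! i)"
        using f [OF jsJ [OF i], of x] x by (simp_all add: K_def)
      ultimately show ?thesis by linarith
    qed
    have ch: "\<exists>x\<in>K. - 1 \<le> (\<Sum>i<length js. real (w i) * (f (js ! i) x - b (js ! i)))" for w :: "nat \<Rightarrow> nat"
    proof -
      \<comment> \<open>Repetition turns integer weights into the lists that \<open>choice\<close>
        accepts.\<close>
      define ks where "ks = concat (map (\<lambda>i. replicate (w i) (js ! i)) [0..<length js])"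
      have "set ks \<subseteq> J" using jsJ by (auto simp: ks_def)
      then obtain x where x: "x \<in> K" "- 1 \<le> (\<Sum>j\<leftarrow>ks. f j x - b j)" using choice K_def by blast
      have "(\<Sum>j\<leftarrow>concat (map (\<lambda>i. replicate (w i) (js ! i)) is). g j) = (\<Sum>i\<leftarrow>is. real (w i) * g (js ! i))"
        for g :: "'j \<Rightarrow> real" and "is"
        by (induction "is") (simp_all add: sum_list_replicate)
      then have "(\<Sum>j\<leftarrow>ks. f j x - b j) = (\<Sum>i<length js. real (w i) * (f (js ! i) x - b (js ! i)))"
        by (simp add: ks_def interv_sum_list_conv_sum_set_nat lessThan_atLeast0)
      then show ?thesis using x by metis
    qed
    obtain N :: nat and xs where N: "0 < N" "\<And>j. xs j \<in> K"
      "\<And>i. i < length js \<Longrightarrow> - e * real N \<le> (\<Sum>l<N. f (js ! i) (xs l) - b (js ! i))"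
      by (rule greedy_average [of "length js" K "\<lambda>i x. f (js ! i) x - b (js ! i)" BB e, OF bnd ch e0]) blast+
    let ?m = "uniform_mass N xs"
    have "?m \<in> good (j, n)" if jn: "(j, n) \<in> I'" for j n
    proof -
      have n: "0 < n" and jJ: "j \<in> J" using jn sub by (auto simp: I_def)
      have "j \<in> set js" using jn ls by (force simp: js_def)
      then obtain i where i: "i < length js" "js ! i = j" by (auto simp: in_set_conv_nth)
      have "b j * real N - e * real N \<le> (\<Sum>l<N. f j (xs l))"
        using N(3) [OF i(1)] i(2) by (simp add: sum_subtractf algebra_simps)
      also have "\<dots> \<le> (\<Sum>q<N. 1 / real n + (\<Sum>l=1..L j n. 1 / real n * indicator {t. real l * (1 / real n) \<le> t} (f j (xs q))))"
      proof (intro sum_mono layer_bounds)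
        fix q
        show "0 \<le> f j (xs q)" "f j (xs q) \<le> real (L j n) * (1 / real n)"
          using f [OF jJ, of "xs q"] N(2) L [OF n, of j] by (auto simp: K_def intro: order_trans)
      qed (use n in auto)
      also have "\<dots> = real N * (1 / real n) + (\<Sum>l=1..L j n. \<Sum>q<N. 1 / real n * indicator {t. real l * (1 / real n) \<le> t} (f j (xs q)))"
        unfolding sum.distrib by (subst sum.swap) simp
      also have "\<dots> = real N * (1 / real n) + (\<Sum>l=1..L j n. 1 / real n * (real N * ?m (lev j n l)))"
      proof -
        have ind: "indicator {t. real l * (1 / real n) \<le> t} (f j (xs q)) = (indicator (lev j n l) (xs q) :: real)"
          for l q using N(2) by (simp add: lev_def indicator_def)
        have "real N * ?m A = (\<Sum>q<N. indicator A (xs q))" for A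
          using N(1) by (simp add: uniform_mass_def)
        then show ?thesis unfolding ind by (simp only: sum_distrib_left)
      qed
      also have "\<dots> = real N * (1 / real n + (\<Sum>l=1..L j n. 1 / real n * ?m (lev j n l)))"
        by (simp add: sum_distrib_left algebra_simps)
      finally have "real N * (b j - e) \<le> real N * (1 / real n + (\<Sum>l=1..L j n. 1 / real n * ?m (lev j n l)))"
        by (simp add: algebra_simps)
      then have "b j - e \<le> 1 / real n + (\<Sum>l=1..L j n. 1 / real n * ?m (lev j n l))"
        using N(1) by (simp only: mult_le_cancel_left_pos of_nat_0_less_iff)
      then show ?thesis using e [OF jn] by (simp add: good_def)
    qed
    moreover have "?m K = 1" using N by (simp add: uniform_mass_def)
    ultimately show "{m. fin_additive m \<and> m K = 1} \<inter> (\<Inter>i\<in>I'. good i) \<noteq> {}"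
      using fin_additive_uniform_mass [OF N(1), of xs] by fast
  qed
  then obtain m where m: "fin_additive m" "m K = 1" and good: "\<And>i. i \<in> I \<Longrightarrow> m \<in> good i" by auto
  interpret content_space S "\<lambda>A. ennreal (m A)"
    using content_space_fin_additive [OF S m(1)] m(2) by (simp add: K_def)
  interpret prob_space borel_mass by (rule prob_space_borel_mass)
  show ?thesis
  proof
    show "regular_prob S borel_mass" by (rule regular_prob_borel_mass)
    fix j assume j: "j \<in> J"
    have fm [measurable]: "f j \<in> borel_measurable borel_mass"
      by (rule regular_prob_measurable [OF regular_prob_borel_mass cont [OF j]])
    have bnd: "0 \<le> f j x" "f j x \<le> B j" if "x \<in> space borel_mass" for x
      using f [OF j, of x] that by (auto simp: space_borel_mass)
    have intf: "integrable borel_mass (f j)"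
      using bnd by (intro integrable_const_bound [where B = "B j"]) auto
    \<comment> \<open>Replacing \<open>m\<close> by the measure does not lower any layer term
      because the level sets are closed, and the layer sum of \<open>f j\<close> lies below
      \<open>f j\<close>; the two errors \<open>1 / n\<close> remain.\<close>
    have step: "b j \<le> (LINT x|borel_mass. f j x) + 2 / real n" if n: "0 < n" for n :: nat
    proof -
      have closed: "closedin S (lev j n l)" for l
        using closedin_continuous_map_preimage [OF cont [OF j], of "{real l * (1 / real n)..}"]
        by (simp add: lev_def K_def)
      have int: "integrable borel_mass (\<lambda>x. 1 / real n * indicator (lev j n l) x :: real)" for l
        using closed_sets_borel_mass [OF closed, of l]
        by (intro integrable_mult_right integrable_real_indicator) (auto simp flip: less_top)
      have ml: "m (lev j n l) \<le> measure borel_mass (lev j n l)" for l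
        using emeasure_borel_mass_closed_ge [OF closed, of l]
        by (simp add: emeasure_eq_measure)
      have "b j - 1 / real n \<le> 1 / real n + (\<Sum>l=1..L j n. 1 / real n * m (lev j n l))"
        using good [of "(j, n)"] j n by (simp add: good_def I_def)
      also have "\<dots> \<le> 1 / real n + (\<Sum>l=1..L j n. 1 / real n * measure borel_mass (lev j n l))"
        using ml by (intro add_left_mono sum_mono mult_left_mono) auto
      also have "\<dots> = 1 / real n + (LINT x|borel_mass. (\<Sum>l=1..L j n. 1 / real n * indicator (lev j n l) x))"
        using closed_sets_borel_mass [OF closed]
        by (subst Bochner_Integration.integral_sum [OF int]) auto
      also have "(LINT x|borel_mass. (\<Sum>l=1..L j n. 1 / real n * indicator (lev j n l) x)) \<le> (LINT x|borel_mass. f j x)"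
      proof (rule integral_mono)
        show "integrable borel_mass (\<lambda>x. \<Sum>l=1..L j n. 1 / real n * indicator (lev j n l) x)"
          by (intro Bochner_Integration.integrable_sum int)
        fix x assume x: "x \<in> space borel_mass"
        have "(\<Sum>l=1..L j n. 1 / real n * indicator (lev j n l) x) =
            (\<Sum>l=1..L j n. 1 / real n * indicator {t. real l * (1 / real n) \<le> t} (f j x))"
          using x by (intro sum.cong) (auto simp: lev_def indicator_def K_def space_borel_mass)
        also have "\<dots> \<le> f j x"
          using bnd [OF x] L [OF n, of j] n by (intro layer_bounds) auto
        finally show "(\<Sum>l=1..L j n. 1 / real n * indicator (lev j n l) x) \<le> f j x" .
      qed (rule intf)
      finally show ?thesis by simp
    qed
    show "b j \<le> (LINT x|borel_mass. f j x)"
    proof (rule field_le_epsilon)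
      fix e :: real assume "0 < e"
      then obtain n :: nat where n: "0 < n" "2 / e < real n"
        using reals_Archimedean2 [of "2 / e"] by (metis divide_pos_pos less_trans of_nat_0_less_iff zero_less_numeral)
      then have "2 / real n \<le> e" using \<open>0 < e\<close> by (simp add: field_simps)
      then show "b j \<le> (LINT x|borel_mass. f j x) + e" using step [OF n(1)] by simp
    qed
  qed
qed

section \<open>The unit ball of multilinear forms\<close>

locale normed_product =
  fixes n :: nat and X :: "nat \<Rightarrow> ('k::{real_normed_field, euclidean_space}, 'v) nspace"
  assumes n_pos: "1 \<le> n" and X: "i < n \<Longrightarrow> normed_space (X i)"
begin

abbreviation "TT \<equiv> tuples n X"
abbreviation "BB \<equiv> mform_ball n X"

definition prodnorm :: "(nat \<Rightarrow> 'v) \<Rightarrow> real" where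
  "prodnorm u = (\<Prod>i<n. vnorm (X i) (u i))"

lemma tuples_nth: "u \<in> TT \<Longrightarrow> i < n \<Longrightarrow> u i \<in> vcarrier (X i)"
  by (auto simp: tuples_def)

lemma tuples_upd: "u \<in> TT \<Longrightarrow> i < n \<Longrightarrow> x \<in> vcarrier (X i) \<Longrightarrow> u(i := x) \<in> TT"
  by (auto simp: tuples_def PiE_iff extensional_def)

lemma tuplesI: "(\<And>i. i < n \<Longrightarrow> f i \<in> vcarrier (X i)) \<Longrightarrow> (\<lambda>i\<in>{..<n}. f i) \<in> TT"
  by (auto simp: tuples_def)

lemma vscale_closed: "i < n \<Longrightarrow> x \<in> vcarrier (X i) \<Longrightarrow> vscale (X i) c x \<in> vcarrier (X i)"
  using X by (rule normed_space.scale_closed)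

lemma prodnorm_nonneg: "u \<in> TT \<Longrightarrow> 0 \<le> prodnorm u"
  unfolding prodnorm_def by (intro prod_nonneg) (auto simp: normed_space.norm_nonneg X tuples_nth)

lemma zero_unit_tuple: "(\<lambda>i\<in>{..<n}. vzero (X i)) \<in> unit_tuples n X"
  by (auto simp: unit_tuples_def normed_space.zero_closed X normed_space.norm_eq_zero [THEN iffD2] intro!: tuplesI)

lemma unit_tuples_ne: "unit_tuples n X \<noteq> {}"
  using zero_unit_tuple by blast

lemma unit_tuples_subset: "unit_tuples n X \<subseteq> TT"
  by (auto simp: unit_tuples_def)

lemma multilinear_scalars:
  "multilinear n X scalars \<phi> \<longleftrightarrow>
     (\<forall>i<n. \<forall>u\<in>TT. \<forall>x\<in>vcarrier (X i). \<forall>y\<in>vcarrier (X i).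
        \<phi> (u(i := vadd (X i) x y)) = \<phi> (u(i := x)) + \<phi> (u(i := y))) \<and>
     (\<forall>i<n. \<forall>u\<in>TT. \<forall>x\<in>vcarrier (X i). \<forall>c. \<phi> (u(i := vscale (X i) c x)) = c * \<phi> (u(i := x)))"
  by (simp add: multilinear_def scalars_def)

lemma multilinear_scale1:
  assumes "multilinear n X scalars \<phi>" "i < n" "u \<in> TT" "x \<in> vcarrier (X i)"
  shows "\<phi> (u(i := vscale (X i) c x)) = c * \<phi> (u(i := x))"
  using assms by (simp add: multilinear_scalars)

lemma multilinear_scale_all:
  assumes \<phi>: "multilinear n X scalars \<phi>" and u: "u \<in> TT"
  shows "\<phi> (\<lambda>i\<in>{..<n}. vscale (X i) (c i) (u i)) = (\<Prod>i<n. c i) * \<phi> u"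
proof -
  \<comment> \<open>The first \<open>m\<close> coordinates are scaled, so a step of the induction
    changes a single coordinate.\<close>
  define f where "f = (\<lambda>m. \<lambda>i\<in>{..<n}. if i < m then vscale (X i) (c i) (u i) else u i)"
  have f: "f m \<in> TT" for m unfolding f_def using u by (intro tuplesI) (auto simp: tuples_nth vscale_closed)
  have "\<phi> (f m) = (\<Prod>i<m. c i) * \<phi> u" if "m \<le> n" for m
    using that
  proof (induction m)
    case 0
    have "f 0 = u" using u by (auto simp: f_def tuples_def)
    then show ?case by simp
  next
    case (Suc m)
    then have m: "m < n" by simp
    have "f (Suc m) = (f m)(m := vscale (X m) (c m) (u m))" "(f m)(m := u m) = f m"
      using m by (auto simp: f_def fun_eq_iff less_Suc_eq)
    then have "\<phi> (f (Suc m)) = c m * \<phi> (f m)"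
      using multilinear_scale1 [OF \<phi> m f tuples_nth [OF u m], of m "c m"] by simp
    then show ?case using Suc by simp
  qed
  moreover have "f n = (\<lambda>i\<in>{..<n}. vscale (X i) (c i) (u i))" by (auto simp: f_def)
  ultimately show ?thesis by (metis order_refl)
qed

lemma mform_ball_multilinear: "\<phi> \<in> BB \<Longrightarrow> multilinear n X scalars \<phi>"
  by (simp add: mform_ball_def mforms_def)

lemma mform_ball_unit: "\<phi> \<in> BB \<Longrightarrow> u \<in> unit_tuples n X \<Longrightarrow> norm (\<phi> u) \<le> 1"
proof -
  assume \<phi>: "\<phi> \<in> BB" and u: "u \<in> unit_tuples n X"
  have "vnorm scalars (\<phi> u) \<le> opnorm n X scalars \<phi>"
    unfolding opnorm_def using \<phi> u
    by (intro cSUP_upper) (auto simp: mform_ball_def mforms_def bounded_op_def)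
  then show ?thesis using \<phi> by (simp add: mform_ball_def scalars_def)
qed

lemma mform_ballI:
  assumes "\<phi> \<in> extensional TT" "multilinear n X scalars \<phi>" "\<And>u. u \<in> unit_tuples n X \<Longrightarrow> norm (\<phi> u) \<le> 1"
  shows "\<phi> \<in> BB"
proof -
  have "bounded_op n X scalars \<phi>"
    unfolding bounded_op_def using assms(3) by (intro bdd_aboveI2 [where M = 1]) (simp add: scalars_def)
  moreover have "opnorm n X scalars \<phi> \<le> 1"
    unfolding opnorm_def using assms(3) unit_tuples_ne by (intro cSUP_least) (auto simp: scalars_def)
  ultimately show ?thesis using assms by (simp add: mform_ball_def mforms_def)
qed

text \<open>Homogeneity reduces to unit vectors in every coordinate. A coordinate of norm 0 cannot
  be normalized, but then \<open>\<phi> u = 0\<close>.\<close>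

lemma mform_ball_le:
  assumes \<phi>: "\<phi> \<in> BB" and u: "u \<in> TT"
  shows "norm (\<phi> u) \<le> prodnorm u"
proof (cases "\<exists>i<n. vnorm (X i) (u i) = 0")
  case True
  then obtain i where i: "i < n" "vnorm (X i) (u i) = 0" by blast
  interpret Xi: normed_space "X i" by (rule X [OF i(1)])
  have ui: "u i \<in> vcarrier (X i)" using tuples_nth [OF u i(1)] .
  have "vscale (X i) 0 (u i) = u i"
  proof -
    have "vnorm (X i) (vscale (X i) 0 (u i)) = 0" using ui by (simp add: Xi.norm_scale)
    then show ?thesis using i ui Xi.norm_eq_zero Xi.scale_closed by metis
  qed
  then have "\<phi> u = 0"
    using multilinear_scale1 [OF mform_ball_multilinear [OF \<phi>] i(1) u ui, of 0] by simp
  then show ?thesis using prodnorm_nonneg [OF u] by simp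
next
  case False
  then have pos: "0 < vnorm (X i) (u i)" if "i < n" for i
    using that normed_space.norm_nonneg [OF X [OF that] tuples_nth [OF u that]] by force
  define c :: "nat \<Rightarrow> 'k" where "c = (\<lambda>i. of_real (inverse (vnorm (X i) (u i))))"
  have "vnorm (X i) (vscale (X i) (c i) (u i)) \<le> 1" if "i < n" for i
    using pos [OF that] normed_space.norm_scale [OF X [OF that] tuples_nth [OF u that]]
    by (simp add: c_def norm_inverse)
  then have "(\<lambda>i\<in>{..<n}. vscale (X i) (c i) (u i)) \<in> unit_tuples n X"
    using u tuplesI [of "\<lambda>i. vscale (X i) (c i) (u i)"]
    by (simp add: unit_tuples_def vscale_closed tuples_nth)
  from mform_ball_unit [OF \<phi> this]
  have "norm ((\<Prod>i<n. c i) * \<phi> u) \<le> 1"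
    unfolding multilinear_scale_all [OF mform_ball_multilinear [OF \<phi>] u] .
  moreover have "norm (\<Prod>i<n. c i) = inverse (prodnorm u)"
  proof -
    have "norm (\<Prod>i<n. c i) = (\<Prod>i<n. inverse (vnorm (X i) (u i)))"
      unfolding c_def prod_norm [symmetric] using pos by (intro prod.cong) (auto simp: norm_inverse abs_of_pos)
    then show ?thesis by (simp add: prodnorm_def prod_inversef [symmetric] o_def)
  qed
  moreover have "0 < prodnorm u" unfolding prodnorm_def using pos by (intro prod_pos) auto
  ultimately show ?thesis by (simp add: norm_mult field_simps)
qed

lemma zero_in_ball: "(\<lambda>u\<in>TT. 0) \<in> BB"
  by (intro mform_ballI) (auto simp: multilinear_scalars tuples_upd normed_space.add_closed X
      vscale_closed unit_tuples_def)

lemma ball_ne: "BB \<noteq> {}"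
  using zero_in_ball by blast

lemma ball_diff_le:
  assumes "\<phi> \<in> BB" "u \<in> TT" "v \<in> TT"
  shows "norm (\<phi> u - \<phi> v) \<le> prodnorm u + prodnorm v"
  using norm_triangle_ineq4 [of "\<phi> u" "\<phi> v"] mform_ball_le [OF assms(1,2)] mform_ball_le [OF assms(1,3)]
  by linarith

text \<open>Banach-Alaoglu for pointwise convergence: the ball is the closed set of multilinear
  functions in a product of balls of radius \<open>prodnorm u\<close>, which are compact as the
  scalars are finite-dimensional. Outside \<open>TT\<close> the factor \<open>{undefined}\<close>
  encodes extensionality.\<close>

lemma compact_ball: "compact BB"
proof -
  define Q where "Q = Pi\<^sub>E UNIV (\<lambda>u. if u \<in> TT then cball (0::'k) (prodnorm u) else {undefined})"
  have "compact Q"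
    unfolding Q_def compactin_euclidean_iff [symmetric] euclidean_product_topology [symmetric]
    by (subst compactin_PiE) auto
  have cont: "continuous_on UNIV (\<lambda>\<phi> :: (nat \<Rightarrow> 'v) \<Rightarrow> 'k. \<phi> u)" for u
    by (rule continuous_on_product_coordinates)
  have "closed {\<phi>. multilinear n X scalars \<phi>}"
    unfolding multilinear_scalars Ball_def
    by (intro closed_Collect_conj closed_Collect_all closed_Collect_imp closed_Collect_eq open_Collect_const
        continuous_intros cont)
  with \<open>compact Q\<close> have "compact (Q \<inter> {\<phi>. multilinear n X scalars \<phi>})"
    by (rule compact_Int_closed)
  moreover have "BB = Q \<inter> {\<phi>. multilinear n X scalars \<phi>}"
  proof (intro equalityI subsetI)
    fix \<phi> assume \<phi>: "\<phi> \<in> BB"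
    then have "\<phi> \<in> extensional TT" by (simp add: mform_ball_def mforms_def)
    then show "\<phi> \<in> Q \<inter> {\<phi>. multilinear n X scalars \<phi>}"
      using mform_ball_le [OF \<phi>] mform_ball_multilinear [OF \<phi>]
      by (auto simp: Q_def PiE_UNIV_domain extensional_def)
  next
    fix \<phi> assume \<phi>: "\<phi> \<in> Q \<inter> {\<phi>. multilinear n X scalars \<phi>}"
    then have Q: "\<phi> u \<in> (if u \<in> TT then cball 0 (prodnorm u) else {undefined})" for u
      by (auto simp: Q_def PiE_UNIV_domain Pi_def)
    show "\<phi> \<in> BB"
    proof (rule mform_ballI)
      show "\<phi> \<in> extensional TT"
      proof -
        have "\<phi> u = undefined" if "u \<notin> TT" for u using Q [of u] that by simp
        then show ?thesis by (simp add: extensional_def)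
      qed
      show "multilinear n X scalars \<phi>" using \<phi> by simp
      fix u assume u: "u \<in> unit_tuples n X"
      then have uT: "u \<in> TT" using unit_tuples_subset by blast
      have "prodnorm u \<le> 1" unfolding prodnorm_def
        using u by (intro prod_le_1) (auto simp: unit_tuples_def normed_space.norm_nonneg X tuples_nth)
      then show "norm (\<phi> u) \<le> 1" using Q [of u] uT by simp
    qed
  qed
  ultimately show ?thesis by simp
qed

section \<open>Projective tensors and the weak* topology on the ball\<close>

lemma alg_tensor_diff:
  assumes "s \<in> alg_tensor n X" "t \<in> alg_tensor n X"
  shows "(\<lambda>\<phi>\<in>mforms n X. s \<phi> - t \<phi>) \<in> alg_tensor n X"
proof -
  obtain us vs where us: "us \<in> lists TT" "s = tensor_sum n X us" and vs: "vs \<in> lists TT" "t = tensor_sum n X vs"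
    using assms by (auto simp: alg_tensor_def)
  \<comment> \<open>The sign is moved into coordinate 0, which exists because
    \<open>1 \<le> n\<close>.\<close>
  define neg where "neg = (\<lambda>v :: nat \<Rightarrow> 'v. v(0 := vscale (X 0) (- 1) (v 0)))"
  have n0: "0 < n" using n_pos by simp
  have negT: "neg v \<in> TT" if "v \<in> TT" for v
    using that n0 by (simp add: neg_def tuples_upd vscale_closed tuples_nth)
  have neg\<phi>: "\<phi> (neg v) = - \<phi> v" if "v \<in> TT" "\<phi> \<in> mforms n X" for \<phi> v
    using that multilinear_scale1 [of \<phi> 0 v "v 0" "- 1"] n0 by (simp add: neg_def mforms_def tuples_nth)
  have "(\<lambda>\<phi>\<in>mforms n X. s \<phi> - t \<phi>) = tensor_sum n X (us @ map neg vs)"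
  proof (rule ext)
    fix \<phi>
    show "(\<lambda>\<phi>\<in>mforms n X. s \<phi> - t \<phi>) \<phi> = tensor_sum n X (us @ map neg vs) \<phi>"
    proof (cases "\<phi> \<in> mforms n X")
      case True
      have "(\<Sum>v\<leftarrow>vs. \<phi> (neg v)) = - (\<Sum>v\<leftarrow>vs. \<phi> v)"
        using vs(1) True by (induction vs) (auto simp: neg\<phi>)
      then show ?thesis using True us vs by (simp add: tensor_sum_def o_def)
    qed (simp add: tensor_sum_def)
  qed
  moreover have "us @ map neg vs \<in> lists TT" using us vs negT by auto
  ultimately show ?thesis by (auto simp: alg_tensor_def)
qed

lemma proj_norm_bdd:
  "bdd_below {(\<Sum>u\<leftarrow>us. \<Prod>i<n. vnorm (X i) (u i)) | us. us \<in> lists TT \<and> tensor_sum n X us = t}"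
  by (rule bdd_belowI [where m = 0])
    (auto intro!: sum_list_nonneg simp: prodnorm_nonneg [unfolded prodnorm_def] in_lists_conv_set)

text \<open>A representation of \<open>t\<close> that almost attains the projective norm bounds
  \<open>t \<phi>\<close> term by term. Consequently a Cauchy sequence for the projective norm is
  uniformly Cauchy on the ball.\<close>

lemma proj_norm_ge:
  assumes t: "t \<in> alg_tensor n X" and lt: "proj_norm n X t < e" and \<phi>: "\<phi> \<in> BB"
  shows "norm (t \<phi>) < e"
proof -
  have "\<exists>x\<in>{(\<Sum>u\<leftarrow>us. \<Prod>i<n. vnorm (X i) (u i)) | us. us \<in> lists TT \<and> tensor_sum n X us = t}. x < e"
    using t lt unfolding proj_norm_def by (intro cInf_lessD) (auto simp: alg_tensor_def)
  then obtain us where us: "us \<in> lists TT" "tensor_sum n X us = t" "(\<Sum>u\<leftarrow>us. prodnorm u) < e"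
    by (auto simp: prodnorm_def)
  have "\<phi> \<in> mforms n X" using \<phi> by (simp add: mform_ball_def)
  then have "t \<phi> = (\<Sum>u\<leftarrow>us. \<phi> u)" using us(2) by (auto simp: tensor_sum_def)
  moreover have "norm (\<Sum>u\<leftarrow>us. \<phi> u) \<le> (\<Sum>u\<leftarrow>us. prodnorm u)"
    using us(1)
  proof (induction us)
    case (Cons u us)
    then show ?case
      using norm_triangle_ineq [of "\<phi> u" "\<Sum>u\<leftarrow>us. \<phi> u"] mform_ball_le [OF \<phi>, of u] by auto
  qed simp
  ultimately show ?thesis using us(3) by simp
qed

lemma continuous_on_alg_tensor:
  assumes "t \<in> alg_tensor n X"
  shows "continuous_on BB t"
proof -
  obtain us where us: "t = tensor_sum n X us" using assms by (auto simp: alg_tensor_def)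
  have cont: "continuous_on BB (\<lambda>\<phi> :: (nat \<Rightarrow> 'v) \<Rightarrow> 'k. \<phi> u)" for u
    by (rule continuous_on_subset [OF continuous_on_product_coordinates]) simp
  have "continuous_on BB (\<lambda>\<phi>. \<Sum>u\<leftarrow>us. \<phi> u)"
    by (induction us) (auto intro!: continuous_intros cont)
  then show ?thesis
    by (rule continuous_on_eq) (auto simp: us tensor_sum_def mform_ball_def)
qed

text \<open>The approximating tensors are finite sums of evaluations and converge uniformly on the
  ball, so the limit is continuous for pointwise convergence. Thus passing to the completion adds no
  open sets on the ball to those of pointwise convergence.\<close>

lemma continuous_on_proj_tensor:
  assumes "z \<in> proj_tensor n X"
  shows "continuous_on BB z"
proof -
  obtain t where t: "\<And>k. t k \<in> alg_tensor n X"
    "\<And>e. 0 < e \<Longrightarrow> \<exists>N. \<forall>k\<ge>N. \<forall>l\<ge>N. proj_norm n X (\<lambda>\<phi>\<in>mforms n X. t k \<phi> - t l \<phi>) < e"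
    "\<And>\<phi>. \<phi> \<in> mforms n X \<Longrightarrow> (\<lambda>k. t k \<phi>) \<longlonglongrightarrow> z \<phi>"
    using assms unfolding proj_tensor_def by blast
  have "uniform_limit BB t z sequentially"
    unfolding uniform_limit_sequentially_iff
  proof (intro allI impI)
    fix e :: real assume e: "0 < e"
    obtain N where N: "\<And>k l. N \<le> k \<Longrightarrow> N \<le> l \<Longrightarrow> proj_norm n X (\<lambda>\<phi>\<in>mforms n X. t k \<phi> - t l \<phi>) < e/2"
      using t(2) [of "e/2"] e by auto
    have "dist (t k \<phi>) (z \<phi>) < e" if k: "N \<le> k" and \<phi>: "\<phi> \<in> BB" for k \<phi>
    proof -
      have \<phi>m: "\<phi> \<in> mforms n X" using \<phi> by (simp add: mform_ball_def)
      have "norm (t k \<phi> - t l \<phi>) \<le> e/2" if "N \<le> l" for l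
        using proj_norm_ge [OF alg_tensor_diff [OF t(1) t(1)] N [OF k that] \<phi>] \<phi>m by simp
      moreover have "(\<lambda>l. norm (t k \<phi> - t l \<phi>)) \<longlonglongrightarrow> norm (t k \<phi> - z \<phi>)"
        by (intro tendsto_intros t(3) \<phi>m)
      ultimately have "norm (t k \<phi> - z \<phi>) \<le> e/2"
        by (intro LIMSEQ_le_const2) auto
      then show ?thesis using e by (simp add: dist_norm)
    qed
    then show "\<exists>N. \<forall>n\<ge>N. \<forall>x\<in>BB. dist (t n x) (z x) < e" by blast
  qed
  then show ?thesis
    using t(1) continuous_on_alg_tensor by (intro uniform_limit_theorem [where f = t and F = sequentially]) auto
qed

lemma topspace_ball_top: "topspace (ball_top n X) = BB"
  by (auto simp: ball_top_def weak_star_def topspace_pullback_topology mform_ball_def)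

text \<open>On the ball, pointwise convergence is at least as fine as weak*, so compactness carries
  over to \<open>ball_top\<close>.\<close>

lemma continuous_map_id_ball: "continuous_map (top_of_set BB) (weak_star n X) id"
  unfolding weak_star_def
proof (rule continuous_map_pullback')
  show "topspace (top_of_set BB) \<subseteq> id -` mforms n X" by (auto simp: mform_ball_def)
  show "continuous_map (top_of_set BB) (product_topology (\<lambda>_. euclidean) (proj_tensor n X))
     ((\<lambda>\<phi>. \<lambda>z\<in>proj_tensor n X. z \<phi>) \<circ> id)"
    by (auto simp: continuous_map_componentwise continuous_on_proj_tensor)
qed

lemma compact_space_ball_top: "compact_space (ball_top n X)"
proof -
  have "compactin (top_of_set BB) BB"
    using compact_ball by (simp add: compactin_subtopology)
  then have "compactin (weak_star n X) (id ` BB)"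
    by (rule image_compactin [OF _ continuous_map_id_ball])
  then show ?thesis unfolding ball_top_def by (simp add: compact_space_subtopology)
qed

text \<open>A constant sequence approximates: its differences vanish, and the zero tensor has the
  empty representation, of cost 0.\<close>

lemma elementary_tensor:
  assumes "u \<in> TT"
  shows "tensor_sum n X [u] \<in> proj_tensor n X"
  unfolding proj_tensor_def
proof (intro CollectI conjI exI [of _ "\<lambda>_. tensor_sum n X [u]"] allI ballI impI)
  show "tensor_sum n X [u] \<in> extensional (mforms n X)" by (simp add: tensor_sum_def)
  show "tensor_sum n X [u] \<in> alg_tensor n X" using assms by (auto simp: alg_tensor_def)
  fix e :: real assume e: "0 < e"
  have "proj_norm n X (\<lambda>\<phi>\<in>mforms n X. 0) \<le> 0"
    unfolding proj_norm_def
    by (rule cInf_lower [OF _ proj_norm_bdd]) (auto intro!: exI [of _ "[]"] simp: tensor_sum_def)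
  then show "\<exists>N. \<forall>k\<ge>N. \<forall>l\<ge>N.
      proj_norm n X (\<lambda>\<phi>\<in>mforms n X. tensor_sum n X [u] \<phi> - tensor_sum n X [u] \<phi>) < e"
    using e by auto
qed auto

text \<open>Evaluation at \<open>u\<close> is the pairing with the elementary tensor of
  \<open>u\<close>. It supplies both the Hausdorff separation and the continuity of the
  integrands.\<close>

lemma continuous_map_eval:
  assumes u: "u \<in> TT"
  shows "continuous_map (ball_top n X) euclidean (\<lambda>\<phi>. \<phi> u)"
proof -
  let ?z = "tensor_sum n X [u]"
  have "continuous_map (product_topology (\<lambda>_. euclidean) (proj_tensor n X)) (euclidean :: 'k topology) (\<lambda>y. y ?z)"
    by (rule continuous_map_product_projection [OF elementary_tensor [OF u]])
  then have "continuous_map (weak_star n X) (euclidean :: 'k topology) ((\<lambda>y. y ?z) \<circ> (\<lambda>\<phi>. \<lambda>z\<in>proj_tensor n X. z \<phi>))"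
    unfolding weak_star_def by (rule continuous_map_pullback)
  then have "continuous_map (ball_top n X) (euclidean :: 'k topology) ((\<lambda>y. y ?z) \<circ> (\<lambda>\<phi>. \<lambda>z\<in>proj_tensor n X. z \<phi>))"
    unfolding ball_top_def by (rule continuous_map_from_subtopology)
  then show ?thesis
  proof (rule continuous_map_eq)
    fix \<phi> assume "\<phi> \<in> topspace (ball_top n X)"
    then have "\<phi> \<in> mforms n X" by (simp add: topspace_ball_top mform_ball_def)
    then show "((\<lambda>y. y ?z) \<circ> (\<lambda>\<phi>. \<lambda>z\<in>proj_tensor n X. z \<phi>)) \<phi> = \<phi> u"
      using elementary_tensor [OF u] by (simp add: tensor_sum_def)
  qed
qed

lemma Hausdorff_ball_top: "Hausdorff_space (ball_top n X)"
  unfolding Hausdorff_space_def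
proof (intro allI impI)
  fix \<phi> \<psi> assume *: "\<phi> \<in> topspace (ball_top n X) \<and> \<psi> \<in> topspace (ball_top n X) \<and> \<phi> \<noteq> \<psi>"
  then have "\<phi> \<in> extensional TT" "\<psi> \<in> extensional TT"
    by (auto simp: topspace_ball_top mform_ball_def mforms_def)
  then obtain u where u: "u \<in> TT" "\<phi> u \<noteq> \<psi> u" using * extensionalityI by blast
  obtain A B where AB: "open A" "open B" "\<phi> u \<in> A" "\<psi> u \<in> B" "A \<inter> B = {}"
    using hausdorff [OF u(2)] by blast
  let ?P = "\<lambda>A. {g \<in> topspace (ball_top n X). g u \<in> A}"
  have "openin (ball_top n X) (?P A)" "openin (ball_top n X) (?P B)"
    using continuous_map_eval [OF u(1)] AB by (auto simp: continuous_map_def)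
  moreover have "\<phi> \<in> ?P A" "\<psi> \<in> ?P B" "disjnt (?P A) (?P B)" using * AB by (auto simp: disjnt_def)
  ultimately show "\<exists>U V. openin (ball_top n X) U \<and> openin (ball_top n X) V \<and> \<phi> \<in> U \<and> \<psi> \<in> V \<and> disjnt U V"
    by blast
qed

end

section \<open>Lebesgue spaces and bounded functions\<close>

text \<open>At the boundary, where one argument is 0, convexity becomes
  \<open>(r * z) powr p \<le> r * z powr p\<close> for \<open>0 \<le> r \<le> 1\<close>, which is
  \<open>r powr p \<le> r\<close>.\<close>

lemma powr_convex_nonneg:
  fixes x y s t p :: real
  assumes p: "1 \<le> p" and xy: "0 \<le> x" "0 \<le> y" and st: "0 \<le> s" "0 \<le> t" "s + t = 1"
  shows "(s * x + t * y) powr p \<le> s * x powr p + t * y powr p"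
proof -
  have le: "(r * z) powr p \<le> r * z powr p" if "0 \<le> r" "r \<le> 1" "0 \<le> z" for r z :: real
  proof (cases "r = 0")
    case False
    then have "r powr p \<le> r" using that p by (intro powr_le_one_le) auto
    then show ?thesis using that by (simp add: powr_mult mult_right_mono)
  qed simp
  consider "x = 0" | "y = 0" | "0 < x" "0 < y" using xy by linarith
  then show ?thesis
  proof cases
    case 1
    then show ?thesis using le [of t y] xy st by simp
  next
    case 2
    then show ?thesis using le [of s x] xy st by simp
  next
    case 3
    have s: "s = 1 - t" using st by simp
    show ?thesis
      using convex_onD [OF powr_convex [OF p], of t x y] 3 st unfolding s by simp
  qed
qed

section \<open>Minkowski's inequality\<close>

definition Lp_norm :: "real \<Rightarrow> 's measure \<Rightarrow> ('s \<Rightarrow> 'k::real_normed_field) \<Rightarrow> real" where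
  "Lp_norm p M f = (LINT x|M. norm (f x) powr p) powr (1 / p)"

lemma Lp_norm_nonneg: "0 \<le> Lp_norm p M f"
  by (simp add: Lp_norm_def)

lemma Lp_norm_powr:
  assumes "0 < p"
  shows "Lp_norm p M f powr p = (LINT x|M. norm (f x) powr p)"
  using assms by (simp add: Lp_norm_def powr_powr)

lemma Lp_integrable_add:
  fixes f g :: "'s \<Rightarrow> 'k::{real_normed_field, euclidean_space}"
  assumes p: "1 \<le> p" and [measurable]: "f \<in> borel_measurable M" "g \<in> borel_measurable M"
    and int: "integrable M (\<lambda>x. norm (f x) powr p)" "integrable M (\<lambda>x. norm (g x) powr p)"
  shows "integrable M (\<lambda>x. norm (f x + g x) powr p)"
proof (rule Bochner_Integration.integrable_bound)
  show "integrable M (\<lambda>x. 2 powr p * (norm (f x) powr p + norm (g x) powr p))" using int by simp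
  have "norm (f x + g x) powr p \<le> 2 powr p * (norm (f x) powr p + norm (g x) powr p)" for x
  proof -
    have "norm (f x + g x) powr p \<le> (2 * (1/2 * norm (f x) + 1/2 * norm (g x))) powr p"
      using norm_triangle_ineq [of "f x" "g x"] p by (intro powr_mono2) auto
    also have "\<dots> = 2 powr p * (1/2 * norm (f x) + 1/2 * norm (g x)) powr p"
      by (rule powr_mult)
    also have "\<dots> \<le> 2 powr p * (1/2 * norm (f x) powr p + 1/2 * norm (g x) powr p)"
      using p by (intro mult_left_mono powr_convex_nonneg) auto
    also have "\<dots> \<le> 2 powr p * (norm (f x) powr p + norm (g x) powr p)"
      by (intro mult_left_mono add_mono) auto
    finally show ?thesis .
  qed
  then show "AE x in M. norm (norm (f x + g x) powr p) \<le> norm (2 powr p * (norm (f x) powr p + norm (g x) powr p))"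
    by (simp add: abs_of_nonneg)
qed simp

text \<open>The function \<open>(|f| + |g|) / (a + b)\<close> is the convex combination of
  \<open>|f| / a\<close> and \<open>|g| / b\<close> with weights \<open>a / (a + b)\<close> and
  \<open>b / (a + b)\<close>; integrating the convexity inequality for its power \<open>p\<close>
  gives at most 1. The summand \<open>e / 2\<close> keeps \<open>a\<close> and \<open>b\<close>
  positive.\<close>

lemma Minkowski:
  fixes f g :: "'s \<Rightarrow> 'k::{real_normed_field, euclidean_space}"
  assumes p: "1 \<le> p" and [measurable]: "f \<in> borel_measurable M" "g \<in> borel_measurable M"
    and int: "integrable M (\<lambda>x. norm (f x) powr p)" "integrable M (\<lambda>x. norm (g x) powr p)"
  shows "Lp_norm p M (\<lambda>x. f x + g x) \<le> Lp_norm p M f + Lp_norm p M g"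
proof (rule field_le_epsilon)
  fix e :: real assume e: "0 < e"
  define a where "a = Lp_norm p M f + e/2"
  define b where "b = Lp_norm p M g + e/2"
  have ab: "0 < a" "0 < b" using e Lp_norm_nonneg [of p M f] Lp_norm_nonneg [of p M g]
    by (simp_all add: a_def b_def add_nonneg_pos)
  have le: "(LINT x|M. norm (h x) powr p) \<le> c powr p" if "Lp_norm p M h \<le> c" for h :: "'s \<Rightarrow> 'k" and c
    using powr_mono2 [OF _ Lp_norm_nonneg that, of p] p Lp_norm_powr [of p M h] by simp
  have leab: "(LINT x|M. norm (f x) powr p) \<le> a powr p" "(LINT x|M. norm (g x) powr p) \<le> b powr p"
    using e by (intro le; simp add: a_def b_def)+
  have pw: "norm (f x + g x) powr p \<le>
      (a + b) powr p * (a / (a + b) / a powr p * norm (f x) powr p + b / (a + b) / b powr p * norm (g x) powr p)" for x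
  proof -
    have "(a + b) * (a / (a + b) * (norm (f x) / a) + b / (a + b) * (norm (g x) / b)) = norm (f x) + norm (g x)"
      using ab by (simp flip: add_divide_distrib)
    then have "norm (f x + g x) powr p \<le> ((a + b) * (a / (a + b) * (norm (f x) / a) + b / (a + b) * (norm (g x) / b))) powr p"
      using norm_triangle_ineq [of "f x" "g x"] p by (intro powr_mono2) auto
    also have "\<dots> = (a + b) powr p * (a / (a + b) * (norm (f x) / a) + b / (a + b) * (norm (g x) / b)) powr p"
      by (rule powr_mult)
    also have "\<dots> \<le> (a + b) powr p * (a / (a + b) * (norm (f x) / a) powr p + b / (a + b) * (norm (g x) / b) powr p)"
      using p ab by (intro mult_left_mono powr_convex_nonneg) (auto simp flip: add_divide_distrib)
    finally show ?thesis using ab by (simp add: powr_divide)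
  qed
  have "(LINT x|M. norm (f x + g x) powr p) \<le>
      (LINT x|M. (a + b) powr p * (a / (a + b) / a powr p * norm (f x) powr p + b / (a + b) / b powr p * norm (g x) powr p))"
    using int pw by (intro integral_mono Lp_integrable_add p) auto
  also have "\<dots> = (a + b) powr p * (a / (a + b) / a powr p * (LINT x|M. norm (f x) powr p) +
      b / (a + b) / b powr p * (LINT x|M. norm (g x) powr p))"
    using int by simp
  also have "\<dots> \<le> (a + b) powr p * (a / (a + b) / a powr p * a powr p + b / (a + b) / b powr p * b powr p)"
    using ab leab by (intro mult_left_mono add_mono) auto
  also have "\<dots> = (a + b) powr p * (a / (a + b) + b / (a + b))"
    using ab by simp
  also have "\<dots> = (a + b) powr p"
    using ab by (simp flip: add_divide_distrib)
  finally have "(LINT x|M. norm (f x + g x) powr p) powr (1/p) \<le> ((a + b) powr p) powr (1/p)"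
    using p by (intro powr_mono2) auto
  then show "Lp_norm p M (\<lambda>x. f x + g x) \<le> Lp_norm p M f + Lp_norm p M g + e"
    using p ab unfolding Lp_norm_def [of p M "\<lambda>x. f x + g x"] by (simp add: powr_powr a_def b_def)
qed

text \<open>Names the choice made inside \<open>class_space\<close>. A representative is determined
  only up to null sets: identities between classes hold for representatives almost
  everywhere.\<close>

definition rep :: "('s \<Rightarrow> 'k) set \<Rightarrow> 's \<Rightarrow> 'k" where
  "rep A = (SOME f. f \<in> A)"

section \<open>Arithmetic of classes modulo null sets\<close>

context
  fixes M :: "'s measure"
begin

lemma rep_ae_class:
  fixes f :: "'s \<Rightarrow> 'k::real_normed_field"
  assumes "f \<in> borel_measurable M"
  shows rep_measurable: "rep (ae_class M f) \<in> borel_measurable M" and AE_rep: "AE x in M. rep (ae_class M f) x = f x"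
proof -
  have "f \<in> ae_class M f" using assms by (simp add: ae_class_def)
  then have "rep (ae_class M f) \<in> ae_class M f" unfolding rep_def by (rule someI [where P = "\<lambda>g. g \<in> ae_class M f"])
  then show "rep (ae_class M f) \<in> borel_measurable M" "AE x in M. rep (ae_class M f) x = f x"
    by (simp_all add: ae_class_def)
qed

lemma ae_class_cong: "AE x in M. f x = g x \<Longrightarrow> ae_class M f = ae_class M g"
  unfolding ae_class_def by (auto elim: eventually_elim2)

lemma ae_class_eq_iff:
  fixes f :: "'s \<Rightarrow> 'k::real_normed_field"
  assumes "f \<in> borel_measurable M"
  shows "ae_class M f = ae_class M g \<longleftrightarrow> (AE x in M. f x = g x)"
proof
  assume "ae_class M f = ae_class M g"
  then have "f \<in> ae_class M g" using assms by (auto simp: ae_class_def)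
  then show "AE x in M. f x = g x" by (simp add: ae_class_def)
qed (rule ae_class_cong)

lemma ae_class_rep: "f \<in> borel_measurable M \<Longrightarrow> ae_class M (rep (ae_class M f)) = ae_class M f"
  by (intro ae_class_cong AE_rep)

lemma class_space_add:
  fixes f g :: "'s \<Rightarrow> 'k::real_normed_field"
  assumes "f \<in> borel_measurable M" "g \<in> borel_measurable M"
  shows "vadd (class_space M F N) (ae_class M f) (ae_class M g) = ae_class M (\<lambda>x. f x + g x)"
proof -
  have "AE x in M. rep (ae_class M f) x + rep (ae_class M g) x = f x + g x"
    using AE_rep [OF assms(1)] AE_rep [OF assms(2)] by eventually_elim simp
  then show ?thesis unfolding class_space_def by (simp add: ae_class_cong flip: rep_def)
qed

lemma class_space_scale:
  fixes f :: "'s \<Rightarrow> 'k::real_normed_field"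
  assumes "f \<in> borel_measurable M"
  shows "vscale (class_space M F N) c (ae_class M f) = ae_class M (\<lambda>x. c * f x)"
proof -
  have "AE x in M. c * rep (ae_class M f) x = c * f x"
    using AE_rep [OF assms(1)] by eventually_elim simp
  then show ?thesis unfolding class_space_def by (simp add: ae_class_cong flip: rep_def)
qed

lemmas Lp_add = class_space_add [where F = "{f \<in> borel_measurable M. integrable M (\<lambda>x. norm (f x) powr p)}"
    and N = "\<lambda>f. (LINT x|M. norm (f x) powr p) powr (1 / p)", folded Lp_def] for p
lemmas Lp_scale = class_space_scale [where F = "{f \<in> borel_measurable M. integrable M (\<lambda>x. norm (f x) powr p)}"
    and N = "\<lambda>f. (LINT x|M. norm (f x) powr p) powr (1 / p)", folded Lp_def] for p
lemmas Linf_add = class_space_add [where F = "{f \<in> borel_measurable M. esssup M (\<lambda>x. ennreal (norm (f x))) < \<infinity>}"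
    and N = "\<lambda>f. enn2real (esssup M (\<lambda>x. ennreal (norm (f x))))", folded Linf_def]
lemmas Linf_scale = class_space_scale [where F = "{f \<in> borel_measurable M. esssup M (\<lambda>x. ennreal (norm (f x))) < \<infinity>}"
    and N = "\<lambda>f. enn2real (esssup M (\<lambda>x. ennreal (norm (f x))))", folded Linf_def]

lemma Lp_norm_cong:
  fixes f g :: "'s \<Rightarrow> 'k::real_normed_field"
  assumes [measurable]: "f \<in> borel_measurable M" "g \<in> borel_measurable M" and "AE x in M. f x = g x"
  shows "Lp_norm p M f = Lp_norm p M g"
proof -
  have "(LINT x|M. norm (f x) powr p) = (LINT x|M. norm (g x) powr p)"
    using assms(3) by (intro integral_cong_AE) (measurable, auto elim: eventually_mono)
  then show ?thesis by (simp add: Lp_norm_def)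
qed

lemma vnorm_Lp:
  fixes f :: "'s \<Rightarrow> 'k::real_normed_field"
  assumes "f \<in> borel_measurable M"
  shows "vnorm (Lp p M) (ae_class M f) = Lp_norm p M f"
  using Lp_norm_cong [OF rep_measurable [OF assms] assms AE_rep [OF assms], of p]
  by (simp add: Lp_def class_space_def Lp_norm_def flip: rep_def)

lemma vzero_Lp: "vzero (Lp p M) = ae_class M (\<lambda>_. 0)"
  by (simp add: Lp_def class_space_def)

lemma vcarrier_Lp: "vcarrier (Lp p M) = ae_class M ` {f \<in> borel_measurable M. integrable M (\<lambda>x. norm (f x) powr p)}"
  by (simp add: Lp_def class_space_def)

lemma vcarrier_Linf:
  "vcarrier (Linf M) = ae_class M ` {f \<in> borel_measurable M. esssup M (\<lambda>x. ennreal (norm (f x))) < \<infinity>}"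
  by (simp add: Linf_def class_space_def)

lemma vnorm_Linf:
  fixes f :: "'s \<Rightarrow> 'k::real_normed_field"
  assumes [measurable]: "f \<in> borel_measurable M"
  shows "vnorm (Linf M) (ae_class M f) = enn2real (esssup M (\<lambda>x. ennreal (norm (f x))))"
proof -
  have [measurable]: "rep (ae_class M f) \<in> borel_measurable M" by (rule rep_measurable) fact
  have "esssup M (\<lambda>x. ennreal (norm (rep (ae_class M f) x))) = esssup M (\<lambda>x. ennreal (norm (f x)))"
    using AE_rep [OF assms] by (intro esssup_AE_cong) (measurable, auto elim: eventually_mono)
  then show ?thesis by (simp add: Linf_def class_space_def flip: rep_def)
qed

lemma Lp_cases:
  assumes "A \<in> vcarrier (Lp p M)"
  obtains f where "f \<in> borel_measurable M" "integrable M (\<lambda>x. norm (f x) powr p)" "A = ae_class M f"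
  using assms by (auto simp: vcarrier_Lp)

lemma Lp_norm_scale:
  fixes f :: "'s \<Rightarrow> 'k::real_normed_field"
  assumes "0 < p"
  shows "Lp_norm p M (\<lambda>x. c * f x) = norm c * Lp_norm p M f"
  using assms by (simp add: Lp_norm_def norm_mult powr_mult powr_powr)

lemma normed_space_Lp:
  assumes p: "1 \<le> p"
  shows "normed_space (Lp p M :: ('k::{real_normed_field, euclidean_space}, ('s \<Rightarrow> 'k) set) nspace)"
proof
  let ?V = "Lp p M :: ('k, ('s \<Rightarrow> 'k) set) nspace"
  fix A B C :: "('s \<Rightarrow> 'k) set" and c d :: 'k
  have mem: "ae_class M f \<in> vcarrier ?V" if "f \<in> borel_measurable M" "integrable M (\<lambda>x. norm (f x) powr p)" for f
    using that by (auto simp: vcarrier_Lp)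
  have scale_int: "integrable M (\<lambda>x. norm (c * f x) powr p)" if "integrable M (\<lambda>x. norm (f x) powr p)" for c :: 'k and f
    using that by (simp add: norm_mult powr_mult)
  show "vzero ?V \<in> vcarrier ?V" unfolding vzero_Lp by (rule mem) auto
  assume "A \<in> vcarrier ?V"
  then obtain f where f [measurable]: "f \<in> borel_measurable M" and fi: "integrable M (\<lambda>x. norm (f x) powr p)"
    and A: "A = ae_class M f" by (rule Lp_cases)
  show "vscale ?V c A \<in> vcarrier ?V"
    unfolding A Lp_scale [OF f] by (intro mem scale_int fi) measurable
  show "vadd ?V (vzero ?V) A = A" unfolding A vzero_Lp by (simp add: Lp_add)
  show "vadd ?V A (vscale ?V (- 1) A) = vzero ?V"
    unfolding A vzero_Lp by (simp add: Lp_scale Lp_add)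
  show "vscale ?V (c + d) A = vadd ?V (vscale ?V c A) (vscale ?V d A)"
    unfolding A by (simp add: Lp_scale Lp_add distrib_right)
  show "vscale ?V c (vscale ?V d A) = vscale ?V (c * d) A"
    unfolding A by (simp add: Lp_scale mult.assoc)
  show "vscale ?V 1 A = A" unfolding A by (simp add: Lp_scale)
  show "0 \<le> vnorm ?V A" unfolding A by (simp add: vnorm_Lp Lp_norm_nonneg)
  show "vnorm ?V (vscale ?V c A) = norm c * vnorm ?V A"
    unfolding A using p by (simp add: Lp_scale vnorm_Lp Lp_norm_scale)
  have "vnorm ?V A = 0 \<longleftrightarrow> (LINT x|M. norm (f x) powr p) = 0"
    unfolding A using p by (simp add: vnorm_Lp Lp_norm_def)
  also have "\<dots> \<longleftrightarrow> (AE x in M. norm (f x) powr p = 0)"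
    using fi by (intro integral_nonneg_eq_0_iff_AE) auto
  also have "\<dots> \<longleftrightarrow> A = vzero ?V"
    unfolding A vzero_Lp ae_class_eq_iff [OF f] by simp
  finally show "vnorm ?V A = 0 \<longleftrightarrow> A = vzero ?V" .
  assume "B \<in> vcarrier ?V"
  then obtain g where g [measurable]: "g \<in> borel_measurable M" and gi: "integrable M (\<lambda>x. norm (g x) powr p)"
    and B: "B = ae_class M g" by (rule Lp_cases)
  show "vadd ?V A B \<in> vcarrier ?V"
    unfolding A B Lp_add [OF f g] by (intro mem Lp_integrable_add p fi gi) measurable
  show "vadd ?V A B = vadd ?V B A"
    unfolding A B by (simp add: Lp_add add.commute)
  show "vscale ?V c (vadd ?V A B) = vadd ?V (vscale ?V c A) (vscale ?V c B)"
    unfolding A B by (simp add: Lp_add Lp_scale distrib_left)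
  show "vnorm ?V (vadd ?V A B) \<le> vnorm ?V A + vnorm ?V B"
    unfolding A B using Minkowski [OF p f g fi gi] by (simp add: Lp_add vnorm_Lp)
  assume "C \<in> vcarrier ?V"
  then obtain h where h [measurable]: "h \<in> borel_measurable M" and C: "C = ae_class M h" by (rule Lp_cases)
  show "vadd ?V (vadd ?V A B) C = vadd ?V A (vadd ?V B C)"
    unfolding A B C by (simp add: Lp_add add.assoc)
qed

lemma vdist_Lp:
  fixes f g :: "'s \<Rightarrow> 'k::{real_normed_field, euclidean_space}"
  assumes "f \<in> borel_measurable M" "g \<in> borel_measurable M"
  shows "vdist (Lp p M) (ae_class M f) (ae_class M g) = Lp_norm p M (\<lambda>x. f x - g x)"
  using assms by (simp add: vdist_def Lp_scale Lp_add vnorm_Lp)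

end

lemma normed_space_linf:
  assumes ne: "\<Gamma> \<noteq> {}"
  shows "normed_space (linf_space \<Gamma> :: ('k::real_normed_field, 'g \<Rightarrow> 'k) nspace)"
proof
  let ?V = "linf_space \<Gamma> :: ('k::real_normed_field, 'g \<Rightarrow> 'k) nspace"
  fix f g h :: "'g \<Rightarrow> 'k" and c d :: 'k
  have bdd: "bdd_above ((\<lambda>x. norm (k x)) ` \<Gamma>) \<longleftrightarrow> (\<exists>B. \<forall>x\<in>\<Gamma>. norm (k x) \<le> B)" for k :: "'g \<Rightarrow> 'k"
    by (auto simp: bdd_above_def)
  have up: "norm (k x) \<le> vnorm ?V k" if "k \<in> vcarrier ?V" "x \<in> \<Gamma>" for k x
    using that by (auto simp: linf_space_def intro!: cSUP_upper)
  have least: "vnorm ?V k \<le> B" if "\<And>x. x \<in> \<Gamma> \<Longrightarrow> norm (k x) \<le> B" for k B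
    using that ne by (auto simp: linf_space_def intro!: cSUP_least)
  show zero: "vzero ?V \<in> vcarrier ?V" by (auto simp: linf_space_def)
  assume f: "f \<in> vcarrier ?V"
  then have fe: "f \<in> extensional \<Gamma>" by (simp add: linf_space_def)
  show scf: "vscale ?V c f \<in> vcarrier ?V" for c
  proof -
    have "norm (c * f x) \<le> norm c * vnorm ?V f" if "x \<in> \<Gamma>" for x
      using up [OF f that] by (simp add: norm_mult mult_left_mono)
    then have "\<exists>B. \<forall>x\<in>\<Gamma>. norm (c * f x) \<le> B" by blast
    then show ?thesis by (simp add: linf_space_def bdd cong: image_cong)
  qed
  show "vadd ?V (vzero ?V) f = f" "vscale ?V 1 f = f"
    using fe by (auto simp: linf_space_def fun_eq_iff extensional_def)
  show "vadd ?V f (vscale ?V (- 1) f) = vzero ?V" "vscale ?V (c + d) f = vadd ?V (vscale ?V c f) (vscale ?V d f)"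
    "vscale ?V c (vscale ?V d f) = vscale ?V (c * d) f"
    by (simp_all add: linf_space_def fun_eq_iff distrib_right mult.assoc)
  obtain x0 where x0: "x0 \<in> \<Gamma>" using ne by blast
  show nn: "0 \<le> vnorm ?V f" using up [OF f x0] norm_ge_zero order_trans by blast
  show "vnorm ?V f = 0 \<longleftrightarrow> f = vzero ?V"
  proof
    assume "vnorm ?V f = 0"
    then have "f x = 0" if "x \<in> \<Gamma>" for x using up [OF f that] by simp
    then show "f = vzero ?V" using fe by (auto simp: linf_space_def fun_eq_iff extensional_def)
  next
    assume "f = vzero ?V"
    then show "vnorm ?V f = 0" using ne by (simp add: linf_space_def cong: SUP_cong_simp)
  qed
  show "vnorm ?V (vscale ?V c f) = norm c * vnorm ?V f"
  proof (rule antisym)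
    show "vnorm ?V (vscale ?V c f) \<le> norm c * vnorm ?V f"
      using up [OF f] by (intro least) (auto simp: linf_space_def norm_mult intro!: mult_left_mono)
    show "norm c * vnorm ?V f \<le> vnorm ?V (vscale ?V c f)"
    proof (cases "c = 0")
      case True
      have "0 \<le> vnorm ?V (vscale ?V c f)"
        by (rule order_trans [OF norm_ge_zero up [OF scf x0]])
      with True show ?thesis by simp
    next
      case False
      have "norm (f x) \<le> vnorm ?V (vscale ?V c f) / norm c" if "x \<in> \<Gamma>" for x
        using up [OF scf that, of c] that False by (simp add: linf_space_def norm_mult field_simps)
      then have "vnorm ?V f \<le> vnorm ?V (vscale ?V c f) / norm c" by (rule least)
      then show ?thesis using False by (simp add: field_simps)
    qed
  qed
  assume g: "g \<in> vcarrier ?V"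
  have le: "norm (f x + g x) \<le> vnorm ?V f + vnorm ?V g" if "x \<in> \<Gamma>" for x
    using norm_triangle_ineq [of "f x" "g x"] up [OF f that] up [OF g that] by linarith
  then have "\<exists>B. \<forall>x\<in>\<Gamma>. norm (f x + g x) \<le> B" by blast
  then show "vadd ?V f g \<in> vcarrier ?V" by (simp add: linf_space_def bdd cong: image_cong)
  show "vnorm ?V (vadd ?V f g) \<le> vnorm ?V f + vnorm ?V g"
    using le by (intro least) (simp add: linf_space_def)
  show "vadd ?V f g = vadd ?V g f" "vscale ?V c (vadd ?V f g) = vadd ?V (vscale ?V c f) (vscale ?V c g)"
    by (simp_all add: linf_space_def fun_eq_iff add.commute distrib_left)
  show "vadd ?V (vadd ?V f g) h = vadd ?V f (vadd ?V g h)"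
    by (simp add: linf_space_def fun_eq_iff add.assoc)
qed

lemma vdist_linf_upper:
  assumes "f \<in> vcarrier (linf_space \<Gamma>)" "g \<in> vcarrier (linf_space \<Gamma>)" "x \<in> \<Gamma>"
  shows "norm (f x - g x) \<le> vdist (linf_space \<Gamma>) f g"
proof -
  interpret normed_space "linf_space \<Gamma> :: ('b::real_normed_field, 'a \<Rightarrow> 'b) nspace"
    using assms by (intro normed_space_linf) auto
  have "vadd (linf_space \<Gamma>) f (vscale (linf_space \<Gamma>) (- 1) g) \<in> vcarrier (linf_space \<Gamma>)"
    using assms by (intro add_closed scale_closed)
  then have "norm (vadd (linf_space \<Gamma>) f (vscale (linf_space \<Gamma>) (- 1) g) x) \<le> vdist (linf_space \<Gamma>) f g"
    unfolding vdist_def using assms(3) by (auto simp: linf_space_def intro!: cSUP_upper)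
  then show ?thesis using assms(3) by (simp add: linf_space_def)
qed

lemma vdist_linf_least:
  assumes "\<Gamma> \<noteq> {}" "\<And>x. x \<in> \<Gamma> \<Longrightarrow> norm (f x - g x) \<le> B"
  shows "vdist (linf_space \<Gamma>) f g \<le> B"
  unfolding vdist_def using assms by (auto simp: linf_space_def intro!: cSUP_least)

section \<open>Operators into bounded measurable functions\<close>

lemma (in prob_space) norm_average_le:
  fixes f :: "'a \<Rightarrow> 'k::{banach, second_countable_topology}"
  assumes f: "integrable M f" and A: "A \<in> events" "0 < prob A"
    and le: "AE x in M. x \<in> A \<longrightarrow> norm (f x) \<le> r"
  shows "norm ((1 / prob A) *\<^sub>R (LINT x|M. indicator A x *\<^sub>R f x)) \<le> r"
proof -
  have "norm (LINT x|M. indicator A x *\<^sub>R f x) \<le> (LINT x|M. norm (indicator A x *\<^sub>R f x))"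
    by (rule integral_norm_bound)
  also have "\<dots> \<le> (LINT x|M. indicator A x * r)"
  proof (rule integral_mono_AE)
    show "integrable M (\<lambda>x. norm (indicator A x *\<^sub>R f x))"
      using integrable_mult_indicator [OF A(1) f] by (rule integrable_norm)
    show "integrable M (\<lambda>x. indicator A x * r)"
      using A by (intro integrable_mult_left integrable_real_indicator) (auto simp flip: less_top)
    show "AE x in M. norm (indicator A x *\<^sub>R f x) \<le> indicator A x * r"
      using le by eventually_elim (auto simp: indicator_def)
  qed
  also have "\<dots> = prob A * r" using A by simp
  finally show ?thesis using A by (simp add: field_simps)
qed

text \<open>Where the sum exceeds \<open>S\<close>, continuity yields a small box around a tuple
  from the countable dense set \<open>D\<close> on which it still exceeds \<open>S\<close>. If the
  preimage of that box had positive probability, the averages over it would lie in the box, a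
  product of closed balls, against \<open>avg\<close>. There are countably many such boxes, so the
  exceptional set is null.\<close>

lemma (in prob_space) AE_sum_powr_le_of_averages:
  fixes F :: "nat \<Rightarrow> 'a \<Rightarrow> 'k::euclidean_space"
  assumes int: "\<And>i. i < k \<Longrightarrow> integrable M (F i)" and p: "0 < p"
    and avg: "\<And>A. A \<in> events \<Longrightarrow> 0 < prob A \<Longrightarrow>
      (\<Sum>i<k. norm ((1 / prob A) *\<^sub>R (LINT x|M. indicator A x *\<^sub>R F i x)) powr p) \<le> S"
  shows "AE x in M. (\<Sum>i<k. norm (F i x) powr p) \<le> S"
proof -
  obtain D :: "'k set" where D: "countable D" "\<And>U. open U \<Longrightarrow> U \<noteq> {} \<Longrightarrow> \<exists>d\<in>D. d \<in> U"
    using countable_dense_exists by blast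
  \<comment> \<open>The boxes with centre in \<open>D\<close> and radius \<open>1 / (m + 1)\<close>
    that lie entirely above \<open>S\<close>. Extensional centres keep \<open>J\<close>
    countable.\<close>
  define J where "J = {(q, m :: nat). q \<in> Pi\<^sub>E {..<k} (\<lambda>_. D) \<and>
      (\<forall>t. (\<forall>i<k. norm (t i - q i) \<le> 1 / real (Suc m)) \<longrightarrow> S < (\<Sum>i<k. norm (t i) powr p))}"
  define A where "A = (\<lambda>(q :: nat \<Rightarrow> 'k, m :: nat). {x \<in> space M. \<forall>i<k. norm (F i x - q i) \<le> 1 / real (Suc m)})"
  have "countable (Pi\<^sub>E {..<k} (\<lambda>_. D) \<times> (UNIV :: nat set))"
    using D(1) by (intro countable_SIGMA countable_PiE) auto
  then have J: "countable J" by (rule countable_subset [rotated]) (auto simp: J_def)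
  have Am: "A j \<in> events" for j
  proof -
    have *: "{x \<in> space M. \<forall>i\<in>{..<k}. norm (F i x - q i) \<le> r} \<in> events" for q r
    proof (rule sets.sets_Collect_finite_All)
      fix i assume "i \<in> {..<k}"
      then have [measurable]: "F i \<in> borel_measurable M" using int by auto
      show "{x \<in> space M. norm (F i x - q i) \<le> r} \<in> events" by measurable
    qed simp
    obtain q m where "j = (q, m)" by fastforce
    then show ?thesis using * [of q "1 / real (Suc m)"] by (simp only: A_def prod.case Ball_def lessThan_iff)
  qed
  have "AE x in M. x \<notin> A j" if j: "j \<in> J" for j
  proof -
    obtain q m where qm: "j = (q, m)" by fastforce
    have "prob (A j) = 0"
    proof (rule ccontr)
      assume "prob (A j) \<noteq> 0"
      then have pos: "0 < prob (A j)" by (simp add: zero_less_measure_iff)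
      define t where "t = (\<lambda>i. (1 / prob (A j)) *\<^sub>R (LINT x|M. indicator (A j) x *\<^sub>R F i x))"
      have "norm (t i - q i) \<le> 1 / real (Suc m)" if i: "i < k" for i
      proof -
        have "(LINT x|M. indicator (A j) x *\<^sub>R (F i x - q i)) =
            (LINT x|M. indicator (A j) x *\<^sub>R F i x) - prob (A j) *\<^sub>R q i"
        proof -
          have "(LINT x|M. indicator (A j) x *\<^sub>R (F i x - q i)) =
              (LINT x|M. indicator (A j) x *\<^sub>R F i x) - (LINT x|M. indicator (A j) x *\<^sub>R q i)"
            unfolding scaleR_diff_right
            by (intro Bochner_Integration.integral_diff integrable_mult_indicator Am int i integrable_const)
          also have "(LINT x|M. indicator (A j) x *\<^sub>R q i) = prob (A j) *\<^sub>R q i"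
          proof -
            have "integrable M (indicator (A j) :: 'a \<Rightarrow> real)"
              using Am by (intro integrable_real_indicator) (auto simp flip: less_top)
            then show ?thesis using Am by (subst integral_scaleR_left) auto
          qed
          finally show ?thesis .
        qed
        then have "t i - q i = (1 / prob (A j)) *\<^sub>R (LINT x|M. indicator (A j) x *\<^sub>R (F i x - q i))"
          using pos by (simp add: t_def scaleR_diff_right)
        also have "norm \<dots> \<le> 1 / real (Suc m)"
        proof (rule norm_average_le [OF _ Am pos])
          show "integrable M (\<lambda>x. F i x - q i)" using int [OF i] by simp
          show "AE x in M. x \<in> A j \<longrightarrow> norm (F i x - q i) \<le> 1 / real (Suc m)"
            using i by (intro AE_I2) (simp only: A_def qm prod.case mem_Collect_eq, blast)
        qed
        finally show ?thesis .
      qed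
      then have "S < (\<Sum>i<k. norm (t i) powr p)" using j by (auto simp: J_def qm)
      then show False using avg [OF Am pos] by (simp add: t_def)
    qed
    then show ?thesis using Am by (simp add: prob_eq_0)
  qed
  then have "AE x in M. \<forall>j\<in>J. x \<notin> A j" using J by (simp add: AE_ball_countable)
  then show ?thesis
  proof (rule AE_mp, intro AE_I2 impI)
    fix x assume x: "x \<in> space M" and notA: "\<forall>j\<in>J. x \<notin> A j"
    show "(\<Sum>i<k. norm (F i x) powr p) \<le> S"
    proof (rule ccontr)
      assume "\<not> ?thesis"
      then have gt: "S < (\<Sum>i<k. norm (F i x) powr p)" by simp
      \<comment> \<open>The excess divided by \<open>k + 1\<close>: a loss of \<open>e\<close> in
        each of the \<open>k\<close> terms still leaves \<open>S + e\<close>.\<close>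
      define e where "e = ((\<Sum>i<k. norm (F i x) powr p) - S) / real (Suc k)"
      have e: "0 < e" using gt by (simp add: e_def)
      have "continuous_on UNIV (\<lambda>z :: 'k. norm z powr p)"
        using p by (intro continuous_on_powr' continuous_intros) auto
      then have "\<exists>d>0. \<forall>z. dist z w < d \<longrightarrow> dist (norm z powr p) (norm w powr p) < e" for w :: 'k
        using e by (auto simp: continuous_on_iff)
      then have "\<exists>d. \<forall>w :: 'k. 0 < d w \<and> (\<forall>z. dist z w < d w \<longrightarrow> dist (norm z powr p) (norm w powr p) < e)"
        by (intro choice) auto
      then obtain d where d: "\<And>w :: 'k. 0 < d w"
        "\<And>w z. dist z w < d w \<Longrightarrow> dist (norm z powr p) (norm w powr p) < e"
        by blast
      \<comment> \<open>\<open>insert 1\<close> makes the minimum meaningful for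
        \<open>k = 0\<close>.\<close>
      define d0 where "d0 = Min (insert 1 ((\<lambda>i. d (F i x)) ` {..<k}))"
      have d0: "0 < d0" "\<And>i. i < k \<Longrightarrow> d0 \<le> d (F i x)" using d(1) by (auto simp: d0_def)
      obtain m :: nat where m: "1 / real (Suc m) < d0 / 2"
        using reals_Archimedean [of "d0 / 2"] d0 by (auto simp: inverse_eq_divide)
      have "\<exists>q\<in>D. q \<in> ball (F i x) (1 / real (Suc m))" for i
        by (intro D(2)) auto
      then obtain q where q: "\<And>i. q i \<in> D" "\<And>i. dist (F i x) (q i) < 1 / real (Suc m)"
        unfolding mem_ball by metis
      have "S < (\<Sum>i<k. norm (t i) powr p)" if t: "\<And>i. i < k \<Longrightarrow> norm (t i - q i) \<le> 1 / real (Suc m)" for t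
      proof -
        have "norm (F i x) powr p - e \<le> norm (t i) powr p" if i: "i < k" for i
        proof -
          have "dist (t i) (F i x) \<le> dist (t i) (q i) + dist (F i x) (q i)" by (rule dist_triangle2)
          also have "\<dots> < d (F i x)" using t [OF i] q(2) [of i] m d0(2) [OF i] unfolding dist_norm by linarith
          finally show ?thesis using d(2) by (force simp: dist_real_def)
        qed
        then have "(\<Sum>i<k. norm (F i x) powr p - e) \<le> (\<Sum>i<k. norm (t i) powr p)" by (intro sum_mono) auto
        moreover have "(\<Sum>i<k. norm (F i x) powr p - e) = S + e"
        proof -
          have "e * real (Suc k) = (\<Sum>i<k. norm (F i x) powr p) - S"
            unfolding e_def by (simp del: of_nat_Suc)
          then show ?thesis by (simp add: sum_subtractf algebra_simps)
        qed
        ultimately show ?thesis using e by simp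
      qed
      then have "(restrict q {..<k}, m) \<in> J" using q by (auto simp: J_def)
      moreover have "x \<in> A (restrict q {..<k}, m)"
        using x q(2) by (auto simp: A_def dist_norm less_imp_le)
      ultimately show False using notA by blast
    qed
  qed
qed

lemma Linf_rep:
  fixes A :: "('s \<Rightarrow> 'k::{real_normed_field, euclidean_space}) set"
  assumes "A \<in> vcarrier (Linf M)"
  shows Linf_rep_measurable: "rep A \<in> borel_measurable M"
    and ae_class_Linf_rep: "ae_class M (rep A) = A"
    and AE_Linf_rep: "AE x in M. norm (rep A x) \<le> vnorm (Linf M) A"
proof -
  obtain f where f [measurable]: "f \<in> borel_measurable M" and fin: "esssup M (\<lambda>x. ennreal (norm (f x))) < \<infinity>"
    and A: "A = ae_class M f"
    using assms by (auto simp: vcarrier_Linf)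
  show "rep A \<in> borel_measurable M" "ae_class M (rep A) = A"
    unfolding A using f by (rule rep_measurable, rule ae_class_rep)
  have "AE x in M. ennreal (norm (f x)) \<le> esssup M (\<lambda>x. ennreal (norm (f x)))" by (rule esssup_AE)
  then show "AE x in M. norm (rep A x) \<le> vnorm (Linf M) A"
    using AE_rep [OF f] unfolding A vnorm_Linf [OF f]
  proof eventually_elim
    case (elim x)
    then show ?case using fin by (metis enn2real_ennreal enn2real_mono norm_ge_zero infinity_ennreal_def)
  qed
qed

lemma vnorm_Linf_le:
  fixes f :: "'s \<Rightarrow> 'k::real_normed_field"
  assumes [measurable]: "f \<in> borel_measurable M" and le: "AE x in M. norm (f x) \<le> B" and B: "0 \<le> B"
  shows "ae_class M f \<in> vcarrier (Linf M)" "vnorm (Linf M) (ae_class M f) \<le> B"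
proof -
  have "AE x in M. ennreal (norm (f x)) \<le> ennreal B"
    using le by eventually_elim (simp add: ennreal_leI)
  then have *: "esssup M (\<lambda>x. ennreal (norm (f x))) \<le> ennreal B" by (intro esssup_I) measurable
  then show "ae_class M f \<in> vcarrier (Linf M)"
    by (auto simp: vcarrier_Linf intro!: le_less_trans [OF *])
  show "vnorm (Linf M) (ae_class M f) \<le> B"
    unfolding vnorm_Linf [OF assms(1)] using enn2real_mono [OF *] B by simp
qed

context normed_product
begin

lemma multilinearD_add:
  "multilinear n X W f \<Longrightarrow> i < n \<Longrightarrow> u \<in> TT \<Longrightarrow> x \<in> vcarrier (X i) \<Longrightarrow> y \<in> vcarrier (X i) \<Longrightarrow>
    f (u(i := vadd (X i) x y)) = vadd W (f (u(i := x))) (f (u(i := y)))"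
  by (simp add: multilinear_def)

lemma multilinearD_scale:
  "multilinear n X W f \<Longrightarrow> i < n \<Longrightarrow> u \<in> TT \<Longrightarrow> x \<in> vcarrier (X i) \<Longrightarrow>
    f (u(i := vscale (X i) c x)) = vscale W c (f (u(i := x)))"
  by (simp add: multilinear_def)

lemma multilinearD_closed: "multilinear n X W f \<Longrightarrow> u \<in> TT \<Longrightarrow> f u \<in> vcarrier W"
  by (auto simp: multilinear_def)

end

text \<open>The bound \<open>s\<close> is a parameter because values below 1 are used later to rule
  out an evaluation operator of small norm; positivity allows division by it.\<close>

locale Linf_operator = normed_product n X + prob_space M
  for n and X :: "nat \<Rightarrow> ('k::{real_normed_field, euclidean_space}, 'v) nspace" and M :: "'s measure" +
  fixes \<nu> :: "(nat \<Rightarrow> 'v) \<Rightarrow> ('s \<Rightarrow> 'k) set" and s :: real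
  assumes \<nu>: "multilinear n X (Linf M) \<nu>" and bounded: "bounded_op n X (Linf M) \<nu>"
    and opnorm_le: "opnorm n X (Linf M) \<nu> \<le> s" and s_pos: "0 < s"
begin

lemma measurable_rep [measurable]: "u \<in> TT \<Longrightarrow> rep (\<nu> u) \<in> borel_measurable M"
  using multilinearD_closed [OF \<nu>] by (rule Linf_rep_measurable)

lemma ae_class_rep_op: "u \<in> TT \<Longrightarrow> ae_class M (rep (\<nu> u)) = \<nu> u"
  using multilinearD_closed [OF \<nu>] by (rule ae_class_Linf_rep)

lemma AE_rep_op: "u \<in> TT \<Longrightarrow> AE x in M. norm (rep (\<nu> u) x) \<le> vnorm (Linf M) (\<nu> u)"
  using multilinearD_closed [OF \<nu>] by (rule AE_Linf_rep)

lemma integrable_rep: "u \<in> TT \<Longrightarrow> integrable M (rep (\<nu> u))"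
  using AE_rep_op by (intro integrable_const_bound) auto

lemma AE_rep_unit: "u \<in> unit_tuples n X \<Longrightarrow> AE x in M. norm (rep (\<nu> u) x) \<le> s"
proof -
  assume u: "u \<in> unit_tuples n X"
  have "vnorm (Linf M) (\<nu> u) \<le> opnorm n X (Linf M) \<nu>"
    unfolding opnorm_def using u bounded by (intro cSUP_upper) (auto simp: bounded_op_def)
  then have le: "vnorm (Linf M) (\<nu> u) \<le> s" using opnorm_le by simp
  have "AE x in M. norm (rep (\<nu> u) x) \<le> vnorm (Linf M) (\<nu> u)"
    using u unit_tuples_subset by (intro AE_rep_op) auto
  then show ?thesis by eventually_elim (use le in linarith)
qed

lemma AE_rep_add:
  assumes i: "i < n" and u: "u \<in> TT" and x: "x \<in> vcarrier (X i)" and y: "y \<in> vcarrier (X i)"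
  shows "AE \<omega> in M. rep (\<nu> (u(i := vadd (X i) x y))) \<omega> = rep (\<nu> (u(i := x))) \<omega> + rep (\<nu> (u(i := y))) \<omega>"
proof -
  have t: "u(i := x) \<in> TT" "u(i := y) \<in> TT" using assms by (auto intro: tuples_upd)
  have "\<nu> (u(i := vadd (X i) x y)) = vadd (Linf M) (ae_class M (rep (\<nu> (u(i := x))))) (ae_class M (rep (\<nu> (u(i := y)))))"
    using multilinearD_add [OF \<nu> assms] t by (simp add: ae_class_rep_op)
  also have "\<dots> = ae_class M (\<lambda>\<omega>. rep (\<nu> (u(i := x))) \<omega> + rep (\<nu> (u(i := y))) \<omega>)"
    using t by (intro Linf_add measurable_rep)
  finally show ?thesis
    using AE_rep [of "\<lambda>\<omega>. rep (\<nu> (u(i := x))) \<omega> + rep (\<nu> (u(i := y))) \<omega>" M] t by simp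
qed

lemma AE_rep_scale:
  assumes i: "i < n" and u: "u \<in> TT" and x: "x \<in> vcarrier (X i)"
  shows "AE \<omega> in M. rep (\<nu> (u(i := vscale (X i) c x))) \<omega> = c * rep (\<nu> (u(i := x))) \<omega>"
proof -
  have t: "u(i := x) \<in> TT" using assms by (auto intro: tuples_upd)
  have "\<nu> (u(i := vscale (X i) c x)) = vscale (Linf M) c (ae_class M (rep (\<nu> (u(i := x)))))"
    using multilinearD_scale [OF \<nu> assms] t by (simp add: ae_class_rep_op)
  also have "\<dots> = ae_class M (\<lambda>\<omega>. c * rep (\<nu> (u(i := x))) \<omega>)"
    using t by (intro Linf_scale measurable_rep)
  finally show ?thesis
    using AE_rep [of "\<lambda>\<omega>. c * rep (\<nu> (u(i := x))) \<omega>" M] t by simp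
qed

definition average :: "'s set \<Rightarrow> (nat \<Rightarrow> 'v) \<Rightarrow> 'k" where
  "average A = (\<lambda>u\<in>TT. (1 / s) *\<^sub>R ((1 / prob A) *\<^sub>R (LINT \<omega>|M. indicator A \<omega> *\<^sub>R rep (\<nu> u) \<omega>)))"

text \<open>The almost everywhere identities for \<open>rep (\<nu> u)\<close> become exact under the
  integral; the factor \<open>1 / s\<close> brings the norm down to at most 1.\<close>

lemma average_in_ball:
  assumes A [measurable]: "A \<in> events" and pos: "0 < prob A"
  shows "average A \<in> BB"
proof (rule mform_ballI)
  show "average A \<in> extensional TT" by (simp add: average_def)
  show "multilinear n X scalars (average A)"
    unfolding multilinear_scalars
  proof (intro conjI allI ballI impI)
    fix i u x y assume *: "i < n" "u \<in> TT" "x \<in> vcarrier (X i)" "y \<in> vcarrier (X i)"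
    have t: "u(i := x) \<in> TT" "u(i := y) \<in> TT" "u(i := vadd (X i) x y) \<in> TT"
      using * normed_space.add_closed [OF X] by (auto intro: tuples_upd)
    have "(LINT \<omega>|M. indicator A \<omega> *\<^sub>R rep (\<nu> (u(i := vadd (X i) x y))) \<omega>) =
        (LINT \<omega>|M. indicator A \<omega> *\<^sub>R rep (\<nu> (u(i := x))) \<omega> + indicator A \<omega> *\<^sub>R rep (\<nu> (u(i := y))) \<omega>)"
    proof (rule integral_cong_AE)
      show "AE \<omega> in M. indicator A \<omega> *\<^sub>R rep (\<nu> (u(i := vadd (X i) x y))) \<omega> =
          indicator A \<omega> *\<^sub>R rep (\<nu> (u(i := x))) \<omega> + indicator A \<omega> *\<^sub>R rep (\<nu> (u(i := y))) \<omega>"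
        using AE_rep_add [OF *] by eventually_elim (simp add: scaleR_add_right)
    qed (use t in measurable)
    also have "\<dots> = (LINT \<omega>|M. indicator A \<omega> *\<^sub>R rep (\<nu> (u(i := x))) \<omega>) + (LINT \<omega>|M. indicator A \<omega> *\<^sub>R rep (\<nu> (u(i := y))) \<omega>)"
      using t by (intro Bochner_Integration.integral_add integrable_mult_indicator integrable_rep A)
    finally show "average A (u(i := vadd (X i) x y)) = average A (u(i := x)) + average A (u(i := y))"
      using t by (simp add: average_def scaleR_add_right)
  next
    fix i u x c assume *: "i < n" "u \<in> TT" "x \<in> vcarrier (X i)"
    have t: "u(i := x) \<in> TT" "u(i := vscale (X i) c x) \<in> TT"
      using * vscale_closed by (auto intro: tuples_upd)
    have "(LINT \<omega>|M. indicator A \<omega> *\<^sub>R rep (\<nu> (u(i := vscale (X i) c x))) \<omega>) =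
        (LINT \<omega>|M. c * (indicator A \<omega> *\<^sub>R rep (\<nu> (u(i := x))) \<omega>))"
    proof (rule integral_cong_AE)
      show "AE \<omega> in M. indicator A \<omega> *\<^sub>R rep (\<nu> (u(i := vscale (X i) c x))) \<omega> =
          c * (indicator A \<omega> *\<^sub>R rep (\<nu> (u(i := x))) \<omega>)"
        using AE_rep_scale [OF *, of c] by eventually_elim simp
    qed (use t in measurable)
    also have "\<dots> = c * (LINT \<omega>|M. indicator A \<omega> *\<^sub>R rep (\<nu> (u(i := x))) \<omega>)"
      using t by (intro Bochner_Integration.integral_mult_right integrable_mult_indicator integrable_rep A)
    finally show "average A (u(i := vscale (X i) c x)) = c * average A (u(i := x))"
      using t by (simp add: average_def)
  qed
  fix u assume u: "u \<in> unit_tuples n X"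
  then have uT: "u \<in> TT" using unit_tuples_subset by blast
  have "norm ((1 / prob A) *\<^sub>R (LINT \<omega>|M. indicator A \<omega> *\<^sub>R rep (\<nu> u) \<omega>)) \<le> s"
    using AE_rep_unit [OF u] pos uT by (intro norm_average_le integrable_rep) (auto elim: eventually_mono)
  then show "norm (average A u) \<le> 1"
    using uT s_pos pos by (simp add: average_def divide_le_eq mult.commute)
qed

text \<open>The average of \<open>rep (\<nu> (u i)) - rep (\<nu> (v i))\<close> over
  \<open>A\<close> is \<open>s\<close> times the increment of the form \<open>average A\<close>, so
  the bound \<open>C\<close> over the ball is a bound for all averages.\<close>

lemma AE_sum_powr_le:
  fixes k :: nat
  assumes p: "0 < p" and uv: "\<And>i. i < k \<Longrightarrow> u i \<in> TT \<and> v i \<in> TT"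
    and C: "\<And>\<phi>. \<phi> \<in> BB \<Longrightarrow> (\<Sum>i<k. norm (\<phi> (u i) - \<phi> (v i)) powr p) \<le> C"
  shows "AE \<omega> in M. (\<Sum>i<k. norm (rep (\<nu> (u i)) \<omega> - rep (\<nu> (v i)) \<omega>) powr p) \<le> s powr p * C"
proof (rule AE_sum_powr_le_of_averages [where F = "\<lambda>i \<omega>. rep (\<nu> (u i)) \<omega> - rep (\<nu> (v i)) \<omega>", OF _ p])
  show "integrable M (\<lambda>\<omega>. rep (\<nu> (u i)) \<omega> - rep (\<nu> (v i)) \<omega>)" if "i < k" for i
    using uv [OF that] by (intro Bochner_Integration.integrable_diff integrable_rep) auto
  fix A assume A: "A \<in> events" and pos: "0 < prob A"
  have "(1 / prob A) *\<^sub>R (LINT \<omega>|M. indicator A \<omega> *\<^sub>R (rep (\<nu> (u i)) \<omega> - rep (\<nu> (v i)) \<omega>)) =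
      s *\<^sub>R (average A (u i) - average A (v i))" if "i < k" for i
  proof -
    have t: "u i \<in> TT" "v i \<in> TT" using uv [OF that] by auto
    have "(LINT \<omega>|M. indicator A \<omega> *\<^sub>R (rep (\<nu> (u i)) \<omega> - rep (\<nu> (v i)) \<omega>)) =
        (LINT \<omega>|M. indicator A \<omega> *\<^sub>R rep (\<nu> (u i)) \<omega>) - (LINT \<omega>|M. indicator A \<omega> *\<^sub>R rep (\<nu> (v i)) \<omega>)"
      unfolding scaleR_diff_right using t
      by (intro Bochner_Integration.integral_diff integrable_mult_indicator integrable_rep A)
    then show ?thesis using t s_pos by (simp add: average_def scaleR_diff_right)
  qed
  then have "(\<Sum>i<k. norm ((1 / prob A) *\<^sub>R (LINT \<omega>|M. indicator A \<omega> *\<^sub>R (rep (\<nu> (u i)) \<omega> - rep (\<nu> (v i)) \<omega>))) powr p)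
      = (\<Sum>i<k. norm (s *\<^sub>R (average A (u i) - average A (v i))) powr p)"
    by (intro sum.cong) auto
  also have "\<dots> = s powr p * (\<Sum>i<k. norm (average A (u i) - average A (v i)) powr p)"
    using s_pos by (simp add: powr_mult sum_distrib_left)
  also have "\<dots> \<le> s powr p * C"
    using C [OF average_in_ball [OF A pos]] by (intro mult_left_mono) auto
  finally show "(\<Sum>i<k. norm ((1 / prob A) *\<^sub>R (LINT \<omega>|M. indicator A \<omega> *\<^sub>R (rep (\<nu> (u i)) \<omega> - rep (\<nu> (v i)) \<omega>))) powr p)
      \<le> s powr p * C" .
qed

lemma integrable_rep_diff_powr:
  assumes p: "0 < p" and "u \<in> TT" "v \<in> TT"
  shows "integrable M (\<lambda>\<omega>. norm (rep (\<nu> u) \<omega> - rep (\<nu> v) \<omega>) powr p)"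
proof (rule integrable_const_bound)
  show "AE \<omega> in M. norm (norm (rep (\<nu> u) \<omega> - rep (\<nu> v) \<omega>) powr p) \<le>
      (vnorm (Linf M) (\<nu> u) + vnorm (Linf M) (\<nu> v)) powr p"
    using AE_rep_op [OF assms(2)] AE_rep_op [OF assms(3)]
  proof eventually_elim
    case (elim \<omega>)
    then have "norm (rep (\<nu> u) \<omega> - rep (\<nu> v) \<omega>) \<le> vnorm (Linf M) (\<nu> u) + vnorm (Linf M) (\<nu> v)"
      using norm_triangle_ineq4 [of "rep (\<nu> u) \<omega>" "rep (\<nu> v) \<omega>"] by linarith
    then show ?case using p by (simp add: powr_mono2)
  qed
qed (use assms in measurable)

lemma integral_sum_powr_le:
  fixes k :: nat
  assumes p: "0 < p" and uv: "\<And>i. i < k \<Longrightarrow> u i \<in> TT \<and> v i \<in> TT"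
    and C: "\<And>\<phi>. \<phi> \<in> BB \<Longrightarrow> (\<Sum>i<k. norm (\<phi> (u i) - \<phi> (v i)) powr p) \<le> C"
  shows "(\<Sum>i<k. LINT \<omega>|M. norm (rep (\<nu> (u i)) \<omega> - rep (\<nu> (v i)) \<omega>) powr p) \<le> s powr p * C"
proof -
  have "(\<Sum>i<k. LINT \<omega>|M. norm (rep (\<nu> (u i)) \<omega> - rep (\<nu> (v i)) \<omega>) powr p) =
      (LINT \<omega>|M. (\<Sum>i<k. norm (rep (\<nu> (u i)) \<omega> - rep (\<nu> (v i)) \<omega>) powr p))"
    using uv p by (intro Bochner_Integration.integral_sum [symmetric] integrable_rep_diff_powr) auto
  also have "\<dots> \<le> (LINT \<omega>|M. s powr p * C)"
    using AE_sum_powr_le [OF p uv C] uv p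
    by (intro integral_mono_AE Bochner_Integration.integrable_sum integrable_rep_diff_powr) auto
  finally show ?thesis by (simp add: prob_space)
qed

lemma in_Lp:
  assumes "1 \<le> p" "u \<in> TT"
  shows "\<nu> u \<in> vcarrier (Lp p M)"
proof -
  have "integrable M (\<lambda>\<omega>. norm (rep (\<nu> u) \<omega>) powr p)"
    using AE_rep_op [OF assms(2)] assms
    by (intro integrable_const_bound [where B = "vnorm (Linf M) (\<nu> u) powr p"])
      (auto elim!: eventually_mono intro!: powr_mono2)
  then have "ae_class M (rep (\<nu> u)) \<in> vcarrier (Lp p M)"
    using measurable_rep [OF assms(2)] by (auto simp: vcarrier_Lp)
  then show ?thesis using ae_class_rep_op [OF assms(2)] by simp
qed

lemma vdist_Lp_op:
  assumes "u \<in> TT" "v \<in> TT"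
  shows "vdist (Lp p M) (\<nu> u) (\<nu> v) = Lp_norm p M (\<lambda>\<omega>. rep (\<nu> u) \<omega> - rep (\<nu> v) \<omega>)"
  using vdist_Lp [OF measurable_rep [OF assms(1)] measurable_rep [OF assms(2)], of p] assms
  by (simp add: ae_class_rep_op)

end

section \<open>Equivalence of the conditions\<close>

context normed_space
begin

text \<open>Values are attached to indices, not to points, because distinct tuples may give the same
  class. If the increments of \<open>a\<close> are at most \<open>c\<close> times the distances,
  equal points carry equal values.\<close>

definition mcshane :: "'i set \<Rightarrow> ('i \<Rightarrow> 'v) \<Rightarrow> real \<Rightarrow> ('i \<Rightarrow> real) \<Rightarrow> 'v \<Rightarrow> real" where
  "mcshane I P c a x = (INF i\<in>I. a i + c * vdist V x (P i))"

context
  fixes I :: "'i set" and P :: "'i \<Rightarrow> 'v" and c :: real and a :: "'i \<Rightarrow> real"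
  assumes ne: "I \<noteq> {}" and P: "\<And>i. i \<in> I \<Longrightarrow> P i \<in> vcarrier V" and c: "0 \<le> c"
    and a: "\<And>i j. i \<in> I \<Longrightarrow> j \<in> I \<Longrightarrow> a i - a j \<le> c * vdist V (P i) (P j)"
begin

lemma mcshane_bdd: "x \<in> vcarrier V \<Longrightarrow> bdd_below ((\<lambda>i. a i + c * vdist V x (P i)) ` I)"
proof -
  assume x: "x \<in> vcarrier V"
  obtain j where j: "j \<in> I" using ne by blast
  show ?thesis
  proof (rule bdd_belowI2)
    fix i assume i: "i \<in> I"
    have "c * vdist V (P j) (P i) \<le> c * (vdist V x (P j) + vdist V x (P i))"
      using c vdist_triangle [of "P j" x "P i"] vdist_commute [of "P j" x] x P i j by (intro mult_left_mono) auto
    then show "a j - c * vdist V x (P j) \<le> a i + c * vdist V x (P i)"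
      using a [OF j i] by (simp add: distrib_left)
  qed
qed

lemma mcshane_le: "x \<in> vcarrier V \<Longrightarrow> i \<in> I \<Longrightarrow> mcshane I P c a x \<le> a i + c * vdist V x (P i)"
  unfolding mcshane_def by (intro cINF_lower mcshane_bdd)

lemma mcshane_extends: "j \<in> I \<Longrightarrow> mcshane I P c a (P j) = a j"
proof (rule antisym)
  assume j: "j \<in> I"
  have "vdist V (P j) (P j) = 0" using vdist_eq_zero [of "P j" "P j"] P j by simp
  then show "mcshane I P c a (P j) \<le> a j" using mcshane_le [OF P [OF j] j] by simp
  have "a j \<le> a i + c * vdist V (P j) (P i)" if "i \<in> I" for i
    using a [OF j that] by simp
  then show "a j \<le> mcshane I P c a (P j)"
    unfolding mcshane_def by (intro cINF_greatest ne)
qed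

lemma mcshane_Lipschitz:
  assumes xy: "x \<in> vcarrier V" "y \<in> vcarrier V"
  shows "\<bar>mcshane I P c a x - mcshane I P c a y\<bar> \<le> c * vdist V x y"
proof -
  have *: "mcshane I P c a x - c * vdist V x y \<le> mcshane I P c a y"
    if xy: "x \<in> vcarrier V" "y \<in> vcarrier V" for x y
    unfolding mcshane_def [of _ _ _ _ y]
  proof (intro cINF_greatest ne)
    fix i assume i: "i \<in> I"
    have "c * vdist V x (P i) \<le> c * (vdist V x y + vdist V y (P i))"
      using c P [OF i] xy by (intro mult_left_mono vdist_triangle)
    then show "mcshane I P c a x - c * vdist V x y \<le> a i + c * vdist V y (P i)"
      using mcshane_le [OF xy(1) i] by (simp add: distrib_left)
  qed
  from * [OF xy] * [OF xy(2,1)] show ?thesis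
    using xy by (simp add: vdist_commute abs_le_iff)
qed

end

lemma dual_ball_diff_le:
  assumes g: "g \<in> dual_ball V" and xy: "x \<in> vcarrier V" "y \<in> vcarrier V"
  shows "norm (g x - g y) \<le> vdist V x y"
proof -
  have "g (vadd V x (vscale V (- 1) y)) = g x - g y"
    using g xy by (simp add: dual_ball_def scale_closed)
  then show ?thesis
    using dual_ball_le [OF g, of "vadd V x (vscale V (- 1) y)"] xy
    by (simp add: vdist_def add_closed scale_closed)
qed

lemma dual_ball_ne: "dual_ball V \<noteq> {}"
proof -
  have "(\<lambda>x\<in>vcarrier V. 0) \<in> dual_ball V"
    by (intro dual_ballI) (auto simp: add_closed scale_closed norm_nonneg)
  then show ?thesis by blast
qed

lemma i_Y_carrier: "y \<in> vcarrier V \<Longrightarrow> i_Y V y \<in> vcarrier (linf_space (dual_ball V))"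
  using dual_ball_le by (auto simp: i_Y_def linf_space_def intro!: bdd_aboveI2 [where M = "vnorm V y"])

text \<open>A functional norming \<open>x - y\<close> is a coordinate in which the images already
  show the whole distance.\<close>

lemma vdist_i_Y:
  assumes norming: "has_norming V" and xy: "x \<in> vcarrier V" "y \<in> vcarrier V"
  shows "vdist V x y \<le> vdist (linf_space (dual_ball V)) (i_Y V x) (i_Y V y)"
proof -
  let ?z = "vadd V x (vscale V (- 1) y)"
  have "?z \<in> vcarrier V" using xy by (simp add: add_closed scale_closed)
  then obtain g where g: "g \<in> dual_ball V" "norm (g ?z) = vnorm V ?z"
    using norming unfolding has_norming_def by blast
  have "g ?z = g x - g y" using g xy by (simp add: dual_ball_def scale_closed)
  then have "vdist V x y = norm (i_Y V x g - i_Y V y g)"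
    using g by (simp add: vdist_def i_Y_def)
  also have "\<dots> \<le> vdist (linf_space (dual_ball V)) (i_Y V x) (i_Y V y)"
    using xy g by (intro vdist_linf_upper i_Y_carrier)
  finally show ?thesis .
qed

end

lemma norm_le_sqrt_DIM:
  fixes x :: "'k::euclidean_space"
  assumes "\<And>b. b \<in> Basis \<Longrightarrow> \<bar>x \<bullet> b\<bar> \<le> r" "0 \<le> r"
  shows "norm x \<le> sqrt (DIM('k)) * r"
proof -
  have "(x \<bullet> b)\<^sup>2 \<le> r\<^sup>2" if "b \<in> Basis" for b
    using assms(1) [OF that] assms(2) by (metis abs_of_nonneg abs_le_square_iff)
  then have "(\<Sum>b\<in>Basis. (x \<bullet> b)\<^sup>2) \<le> (\<Sum>b\<in>(Basis :: 'k set). r\<^sup>2)" by (intro sum_mono)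
  then have "sqrt (\<Sum>b\<in>Basis. (x \<bullet> b)\<^sup>2) \<le> sqrt (DIM('k) * r\<^sup>2)"
    by (intro real_sqrt_le_mono) simp
  then show ?thesis
    using assms(2) by (simp add: norm_eq_sqrt_inner euclidean_inner [of x x] power2_eq_square real_sqrt_mult)
qed

lemma powr_root_le_iff:
  fixes a b p :: real
  assumes "0 < p" "0 \<le> a" "0 \<le> b"
  shows "a powr (1 / p) \<le> b \<longleftrightarrow> a \<le> b powr p"
proof
  assume "a powr (1 / p) \<le> b"
  then have "(a powr (1 / p)) powr p \<le> b powr p" using assms by (intro powr_mono2) auto
  then show "a \<le> b powr p" using assms by (simp add: powr_powr)
next
  assume "a \<le> b powr p"
  then have "a powr (1 / p) \<le> (b powr p) powr (1 / p)" using assms by (intro powr_mono2) auto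
  then show "a powr (1 / p) \<le> b" using assms by (simp add: powr_powr)
qed

locale summing_setting = normed_product n X + Y: normed_space Y
  for n and X :: "nat \<Rightarrow> ('k::{real_normed_field, euclidean_space}, 'v) nspace" and Y :: "('k, 'y) nspace" +
  fixes p :: real and T :: "(nat \<Rightarrow> 'v) \<Rightarrow> 'y"
  assumes p: "1 \<le> p" and T: "multilinear n X Y T"
begin

section \<open>The supremum over the ball and the optimal constant\<close>

lemma p_pos: "0 < p" using p by simp

lemma T_closed: "u \<in> TT \<Longrightarrow> T u \<in> vcarrier Y"
  by (rule multilinearD_closed [OF T])

definition sup_form :: "nat \<Rightarrow> (nat \<Rightarrow> nat \<Rightarrow> 'v) \<Rightarrow> (nat \<Rightarrow> nat \<Rightarrow> 'v) \<Rightarrow> real" where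
  "sup_form k u v = (SUP \<phi>\<in>BB. (\<Sum>i<k. norm (\<phi> (u i) - \<phi> (v i)) powr p) powr (1 / p))"

text \<open>The bound by \<open>prodnorm\<close> makes the set under the supremum bounded; only then
  does \<open>SUP\<close> dominate its members.\<close>

lemma sup_form_upper:
  assumes uv: "\<And>i. i < k \<Longrightarrow> u i \<in> TT \<and> v i \<in> TT" and \<phi>: "\<phi> \<in> BB"
  shows "(\<Sum>i<k. norm (\<phi> (u i) - \<phi> (v i)) powr p) powr (1 / p) \<le> sup_form k u v"
  unfolding sup_form_def
proof (rule cSUP_upper [OF \<phi>], rule bdd_aboveI2)
  fix \<psi> assume "\<psi> \<in> BB"
  then show "(\<Sum>i<k. norm (\<psi> (u i) - \<psi> (v i)) powr p) powr (1 / p) \<le>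
      (\<Sum>i<k. (prodnorm (u i) + prodnorm (v i)) powr p) powr (1 / p)"
    using uv p by (intro powr_mono2 sum_mono ball_diff_le) (auto intro: sum_nonneg)
qed

lemma sup_form_nonneg:
  assumes "\<And>i. i < k \<Longrightarrow> u i \<in> TT \<and> v i \<in> TT"
  shows "0 \<le> sup_form k u v"
  by (rule order_trans [OF powr_ge_zero sup_form_upper [OF assms zero_in_ball]])

lemma sum_le_sup_form:
  assumes "\<And>i. i < k \<Longrightarrow> u i \<in> TT \<and> v i \<in> TT" "\<phi> \<in> BB"
  shows "(\<Sum>i<k. norm (\<phi> (u i) - \<phi> (v i)) powr p) \<le> sup_form k u v powr p"
  using sup_form_upper [of k u v, OF assms] sup_form_nonneg [of k u v, OF assms(1)] p_pos
  by (subst powr_root_le_iff [symmetric]) (auto intro: sum_nonneg)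

lemma sup_form_le:
  assumes "\<And>\<phi>. \<phi> \<in> BB \<Longrightarrow> (\<Sum>i<k. norm (\<phi> (u i) - \<phi> (v i)) powr p) \<le> C powr p" "0 \<le> C"
  shows "sup_form k u v \<le> C"
  unfolding sup_form_def using assms p_pos ball_ne
  by (intro cSUP_least) (auto simp: powr_root_le_iff sum_nonneg)

lemma summing_const_iff:
  "summing_const p n X Y T c \<longleftrightarrow> 0 < c \<and>
    (\<forall>k u v. (\<forall>i<k. u i \<in> TT \<and> v i \<in> TT) \<longrightarrow>
      (\<Sum>i<k. vdist Y (T (u i)) (T (v i)) powr p) \<le> (c * sup_form k u v) powr p)"
proof -
  have "(\<Sum>i<k. vdist Y (T (u i)) (T (v i)) powr p) powr (1 / p) \<le> c * sup_form k u v \<longleftrightarrow>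
      (\<Sum>i<k. vdist Y (T (u i)) (T (v i)) powr p) \<le> (c * sup_form k u v) powr p"
    if "0 < c" "\<forall>i<k. u i \<in> TT \<and> v i \<in> TT" for k :: nat and u v
    using that sup_form_nonneg [of k u v] p_pos by (intro powr_root_le_iff) (auto intro: sum_nonneg)
  then show ?thesis unfolding summing_const_def sup_form_def [symmetric] by blast
qed

text \<open>The almost everywhere bound for sums of increments of \<open>\<nu>\<close>, integrated.
  It serves three times: for the evaluation operator of a measure it leads from (ii) to (i), for a
  given \<open>\<nu>\<close> from (iv) to (i), and with \<open>s < 1\<close> it excludes an
  evaluation operator of norm below 1 at the optimal constant.\<close>

lemma summing_of_Lipschitz_factor:
  assumes op: "Linf_operator n X M \<nu> s" and L: "0 \<le> L"
    and lip: "\<And>u v. u \<in> TT \<Longrightarrow> v \<in> TT \<Longrightarrow> vdist Y (T u) (T v) \<le> L * vdist (Lp p M) (\<nu> u) (\<nu> v)"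
    and c: "0 < c" "L * s \<le> c"
  shows "summing_const p n X Y T c"
  unfolding summing_const_iff
proof (intro conjI allI impI c(1))
  interpret Linf_operator n X M \<nu> s by (rule op)
  fix k :: nat and u v assume uv: "\<forall>i<k. u i \<in> TT \<and> v i \<in> TT"
  then have uv': "\<And>i. i < k \<Longrightarrow> u i \<in> TT \<and> v i \<in> TT" by blast
  have "(\<Sum>i<k. vdist Y (T (u i)) (T (v i)) powr p) \<le>
      (\<Sum>i<k. L powr p * (LINT \<omega>|M. norm (rep (\<nu> (u i)) \<omega> - rep (\<nu> (v i)) \<omega>) powr p))"
  proof (rule sum_mono)
    fix i assume "i \<in> {..<k}"
    then have t: "u i \<in> TT" "v i \<in> TT" using uv by auto
    have "vdist Y (T (u i)) (T (v i)) powr p \<le>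
        (L * Lp_norm p M (\<lambda>\<omega>. rep (\<nu> (u i)) \<omega> - rep (\<nu> (v i)) \<omega>)) powr p"
      using lip [OF t] t p by (intro powr_mono2) (auto simp: vdist_Lp_op Y.vdist_nonneg T_closed)
    then show "vdist Y (T (u i)) (T (v i)) powr p \<le>
        L powr p * (LINT \<omega>|M. norm (rep (\<nu> (u i)) \<omega> - rep (\<nu> (v i)) \<omega>) powr p)"
      using L Lp_norm_nonneg p_pos by (simp add: powr_mult Lp_norm_powr)
  qed
  also have "\<dots> \<le> L powr p * (s powr p * sup_form k u v powr p)"
    unfolding sum_distrib_left [symmetric]
    by (intro mult_left_mono integral_sum_powr_le p_pos uv' sum_le_sup_form) auto
  also have "\<dots> = ((L * s) * sup_form k u v) powr p"
    using L s_pos sup_form_nonneg [of k u v, OF uv'] by (simp add: powr_mult)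
  also have "\<dots> \<le> (c * sup_form k u v) powr p"
    using c L s_pos sup_form_nonneg [of k u v, OF uv'] p
    by (intro powr_mono2 mult_right_mono) auto
  finally show "(\<Sum>i<k. vdist Y (T (u i)) (T (v i)) powr p) \<le> (c * sup_form k u v) powr p" .
qed

lemma summing_const_mono:
  assumes "summing_const p n X Y T c" "c \<le> c'"
  shows "summing_const p n X Y T c'"
  unfolding summing_const_iff
proof (intro conjI allI impI)
  show "0 < c'" using assms by (simp add: summing_const_iff)
  fix k :: nat and u v assume uv: "\<forall>i<k. u i \<in> TT \<and> v i \<in> TT"
  then have nn: "0 \<le> sup_form k u v" by (intro sup_form_nonneg) auto
  have "(\<Sum>i<k. vdist Y (T (u i)) (T (v i)) powr p) \<le> (c * sup_form k u v) powr p"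
    using assms(1) uv by (simp add: summing_const_iff)
  also have "\<dots> \<le> (c' * sup_form k u v) powr p"
    using assms nn p by (intro powr_mono2 mult_right_mono) (auto simp: summing_const_iff)
  finally show "(\<Sum>i<k. vdist Y (T (u i)) (T (v i)) powr p) \<le> (c' * sup_form k u v) powr p" .
qed

abbreviation "\<pi>T \<equiv> pi_Lip p n X Y T"

lemma pi_Lip_le: "summing_const p n X Y T c \<Longrightarrow> \<pi>T \<le> c"
  unfolding pi_Lip_def
  by (rule cInf_lower) (auto simp: summing_const_def intro!: bdd_belowI [where m = 0])

lemma pi_Lip_nonneg: "summing_const p n X Y T c \<Longrightarrow> 0 \<le> \<pi>T"
  unfolding pi_Lip_def by (rule cInf_greatest) (blast, simp add: summing_const_def)

lemma summing_above_pi_Lip: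
  assumes "summing_const p n X Y T c0" "\<pi>T < c"
  shows "summing_const p n X Y T c"
proof -
  have "\<exists>c'\<in>{c. summing_const p n X Y T c}. c' < c"
    using assms unfolding pi_Lip_def by (intro cInf_lessD) auto
  then show ?thesis using summing_const_mono less_imp_le by blast
qed

text \<open>For fixed tuples the inequality is closed in the constant, so it passes to the infimum.
  It is kept apart from \<open>summing_const\<close> because the infimum may be 0, which
  \<open>summing_const\<close> excludes.\<close>

lemma summing_pi_Lip_le:
  assumes ex: "summing_const p n X Y T c0" and uv: "\<And>i. i < k \<Longrightarrow> u i \<in> TT \<and> v i \<in> TT"
  shows "(\<Sum>i<k. vdist Y (T (u i)) (T (v i)) powr p) powr (1 / p) \<le> \<pi>T * sup_form k u v"
proof (rule LIMSEQ_le_const)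
  show "(\<lambda>m. (\<pi>T + inverse (real (Suc m))) * sup_form k u v) \<longlonglongrightarrow> \<pi>T * sup_form k u v"
    using tendsto_mult [OF tendsto_add [OF tendsto_const LIMSEQ_inverse_real_of_nat] tendsto_const, of \<pi>T "sup_form k u v"]
    by simp
  have "summing_const p n X Y T (\<pi>T + inverse (real (Suc m)))" for m
    by (rule summing_above_pi_Lip [OF ex]) simp
  then show "\<exists>N. \<forall>m\<ge>N. (\<Sum>i<k. vdist Y (T (u i)) (T (v i)) powr p) powr (1 / p) \<le>
      (\<pi>T + inverse (real (Suc m))) * sup_form k u v"
    using uv unfolding summing_const_def sup_form_def [symmetric] by blast
qed

lemma summing_pi_Lip:
  assumes "summing_const p n X Y T c0" "0 < \<pi>T"
  shows "summing_const p n X Y T \<pi>T"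
  using summing_pi_Lip_le [OF assms(1)] assms(2)
  unfolding summing_const_def sup_form_def [symmetric] by blast

lemma T_const_if_pi_Lip_zero:
  assumes "summing_const p n X Y T c0" "\<pi>T = 0" "u \<in> TT" "v \<in> TT"
  shows "T u = T v"
proof -
  have "(\<Sum>i<1::nat. vdist Y (T u) (T v) powr p) powr (1 / p) \<le> \<pi>T * sup_form 1 (\<lambda>_. u) (\<lambda>_. v)"
    using assms by (intro summing_pi_Lip_le [where u = "\<lambda>_. u" and v = "\<lambda>_. v"]) auto
  then have "vdist Y (T u) (T v) \<le> 0"
    using assms p_pos Y.vdist_nonneg [of "T u" "T v"] by (simp add: powr_powr T_closed)
  then show ?thesis
    using Y.vdist_nonneg [of "T u" "T v"] Y.vdist_eq_zero [of "T u" "T v"] assms by (simp add: T_closed)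
qed

text \<open>This is \<open>j_p M \<circ> tensor_map n X\<close>. In \<open>Linf M\<close> it serves
  as the operator \<open>\<nu>\<close> of (iv), in \<open>Lp p M\<close> its values are the points
  of the set in (iii); the classes are literally the same.\<close>

definition eval_class :: "((nat \<Rightarrow> 'v) \<Rightarrow> 'k) measure \<Rightarrow> (nat \<Rightarrow> 'v) \<Rightarrow> (((nat \<Rightarrow> 'v) \<Rightarrow> 'k) \<Rightarrow> 'k) set" where
  "eval_class M u = ae_class M (tensor_map n X u)"

section \<open>Evaluation as a multilinear operator into bounded functions\<close>

context
  fixes M assumes M: "regular_prob (ball_top n X) M"
begin

lemma space_regular: "space M = BB"
  using M by (simp add: regular_prob_def topspace_ball_top)

lemma measurable_tensor_map: "u \<in> TT \<Longrightarrow> tensor_map n X u \<in> borel_measurable M"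
proof -
  assume "u \<in> TT"
  then have "(\<lambda>\<phi>. \<phi> u) \<in> borel_measurable M"
    by (intro regular_prob_measurable [OF M] continuous_map_eval)
  then show ?thesis
    by (rule measurable_cong [THEN iffD1, rotated]) (simp add: space_regular tensor_map_def)
qed

lemma vdist_eval_class:
  assumes "u \<in> TT" "v \<in> TT"
  shows "vdist (Lp p M) (eval_class M u) (eval_class M v) = (LINT \<phi>|M. norm (\<phi> u - \<phi> v) powr p) powr (1 / p)"
proof -
  have "(LINT \<phi>|M. norm (tensor_map n X u \<phi> - tensor_map n X v \<phi>) powr p) = (LINT \<phi>|M. norm (\<phi> u - \<phi> v) powr p)"
    by (intro Bochner_Integration.integral_cong) (auto simp: space_regular tensor_map_def)
  then show ?thesis
    unfolding eval_class_def vdist_Lp [OF measurable_tensor_map [OF assms(1)] measurable_tensor_map [OF assms(2)]]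
    by (simp add: Lp_norm_def)
qed

lemma Linf_eval_class:
  assumes u: "u \<in> TT"
  shows "eval_class M u \<in> vcarrier (Linf M)"
proof -
  have "AE \<phi> in M. norm (tensor_map n X u \<phi>) \<le> prodnorm u"
    using mform_ball_le [OF _ u] by (intro AE_I2) (simp add: space_regular tensor_map_def)
  then show ?thesis
    unfolding eval_class_def by (rule vnorm_Linf_le(1) [OF measurable_tensor_map [OF u] _ prodnorm_nonneg [OF u]])
qed

lemma multilinear_eval_class: "multilinear n X (Linf M) (eval_class M)"
  unfolding multilinear_def
proof (intro conjI allI ballI impI)
  show "eval_class M \<in> TT \<rightarrow> vcarrier (Linf M)" using Linf_eval_class by blast
  fix i u x assume *: "i < n" "u \<in> TT" "x \<in> vcarrier (X i)"
  have t: "u(i := x) \<in> TT" using * by (auto intro: tuples_upd)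
  show "eval_class M (u(i := vscale (X i) c x)) = vscale (Linf M) c (eval_class M (u(i := x)))" for c
    unfolding eval_class_def Linf_scale [OF measurable_tensor_map [OF t]]
    using * by (intro ae_class_cong AE_I2)
      (simp add: space_regular tensor_map_def multilinear_scale1 mform_ball_multilinear)
  fix y assume y: "y \<in> vcarrier (X i)"
  have t': "u(i := y) \<in> TT" using * y by (auto intro: tuples_upd)
  show "eval_class M (u(i := vadd (X i) x y)) = vadd (Linf M) (eval_class M (u(i := x))) (eval_class M (u(i := y)))"
    unfolding eval_class_def Linf_add [OF measurable_tensor_map [OF t] measurable_tensor_map [OF t']]
    using * y by (intro ae_class_cong AE_I2)
      (use mform_ball_multilinear in \<open>simp add: space_regular tensor_map_def multilinear_scalars\<close>)
qed

lemma eval_class_unit: "u \<in> unit_tuples n X \<Longrightarrow> vnorm (Linf M) (eval_class M u) \<le> 1"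
proof -
  assume u: "u \<in> unit_tuples n X"
  then have uT: "u \<in> TT" using unit_tuples_subset by blast
  have "AE \<phi> in M. norm (tensor_map n X u \<phi>) \<le> 1"
    using mform_ball_unit [OF _ u] by (intro AE_I2) (simp add: space_regular tensor_map_def)
  then show ?thesis
    unfolding eval_class_def by (rule vnorm_Linf_le(2) [OF measurable_tensor_map [OF uT]]) simp
qed

lemma bounded_eval_class: "bounded_op n X (Linf M) (eval_class M)"
  unfolding bounded_op_def using eval_class_unit by (intro bdd_aboveI2)

lemma opnorm_eval_class: "opnorm n X (Linf M) (eval_class M) \<le> 1"
  unfolding opnorm_def using eval_class_unit by (intro cSUP_least unit_tuples_ne)

lemma Linf_operator_eval_class:
  assumes "opnorm n X (Linf M) (eval_class M) \<le> s" "0 < s"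
  shows "Linf_operator n X M (eval_class M) s"
proof -
  interpret prob_space M using M by (simp add: regular_prob_def)
  show ?thesis
    by unfold_locales (use assms multilinear_eval_class bounded_eval_class in auto)
qed

lemma Lp_eval_class: "u \<in> TT \<Longrightarrow> eval_class M u \<in> vcarrier (Lp p M)"
  using Linf_operator.in_Lp [OF Linf_operator_eval_class [OF opnorm_eval_class] p] by simp

end

text \<open>Turns (ii) into a Lipschitz estimate for evaluation classes, the form in which it meets
  (iii) and (iv).\<close>

lemma domination_const_iff:
  "domination_const p n X Y T c \<longleftrightarrow> 0 < c \<and> (\<exists>M. regular_prob (ball_top n X) M \<and>
     (\<forall>u\<in>TT. \<forall>v\<in>TT. vdist Y (T u) (T v) \<le> c * vdist (Lp p M) (eval_class M u) (eval_class M v)))"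
  unfolding domination_const_def by (simp add: vdist_eval_class cong: conj_cong ball_cong)

lemma domination_imp_summing:
  assumes "domination_const p n X Y T c"
  shows "summing_const p n X Y T c"
proof -
  obtain M where c: "0 < c" and M: "regular_prob (ball_top n X) M"
    and le: "\<And>u v. u \<in> TT \<Longrightarrow> v \<in> TT \<Longrightarrow> vdist Y (T u) (T v) \<le> c * vdist (Lp p M) (eval_class M u) (eval_class M v)"
    using assms by (auto simp: domination_const_iff)
  show ?thesis
    by (rule summing_of_Lipschitz_factor [OF Linf_operator_eval_class [OF M opnorm_eval_class [OF M]] _ le])
      (use c in auto)
qed

text \<open>The measure construction is applied to functions indexed by pairs of tuples, and (i) for
  a finite list of pairs is its \<open>choice\<close> condition. The constant is the same on both
  sides, hence the infima over (i) and (ii) agree.\<close>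

lemma summing_imp_domination:
  assumes "summing_const p n X Y T c"
  shows "domination_const p n X Y T c"
proof -
  have c: "0 < c" using assms by (simp add: summing_const_def)
  define f :: "(nat \<Rightarrow> 'v) \<times> (nat \<Rightarrow> 'v) \<Rightarrow> ((nat \<Rightarrow> 'v) \<Rightarrow> 'k) \<Rightarrow> real"
    where "f = (\<lambda>(u, v) \<phi>. c powr p * norm (\<phi> u - \<phi> v) powr p)"
  define b where "b = (\<lambda>(u, v). vdist Y (T u) (T v) powr p)"
  define B where "B = (\<lambda>(u, v). c powr p * (prodnorm u + prodnorm v) powr p)"
  \<comment> \<open>The slack \<open>1\<close> survives the passage to the supremum without asking
    whether it is attained: failure at every form would turn (i) into
    \<open>A \<le> A - 1\<close>.\<close>
  have "\<exists>\<phi>\<in>topspace (ball_top n X). - 1 \<le> (\<Sum>j\<leftarrow>js. f j \<phi> - b j)" if js: "set js \<subseteq> TT \<times> TT" for js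
  proof (rule ccontr)
    assume "\<not> ?thesis"
    then have lt: "(\<Sum>j\<leftarrow>js. f j \<phi> - b j) < - 1" if "\<phi> \<in> BB" for \<phi>
      using that by (auto simp: topspace_ball_top not_le)
    define k where "k = length js"
    define u where "u = (\<lambda>i. fst (js ! i))"
    define v where "v = (\<lambda>i. snd (js ! i))"
    have uv: "u i \<in> TT \<and> v i \<in> TT" if "i < k" for i
      using js nth_mem [of i js] that by (auto simp: u_def v_def k_def mem_Times_iff dest!: subsetD)
    define A where "A = (\<Sum>i<k. vdist Y (T (u i)) (T (v i)) powr p)"
    have sums: "(\<Sum>j\<leftarrow>js. f j \<phi> - b j) = c powr p * (\<Sum>i<k. norm (\<phi> (u i) - \<phi> (v i)) powr p) - A" for \<phi>
      unfolding A_def sum_list_sum_nth k_def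
      by (simp add: lessThan_atLeast0 u_def v_def f_def b_def split_beta sum_subtractf sum_distrib_left)
    have *: "c powr p * (\<Sum>i<k. norm (\<phi> (u i) - \<phi> (v i)) powr p) < A - 1" if "\<phi> \<in> BB" for \<phi>
      using lt [OF that] sums [of \<phi>] by simp
    \<comment> \<open>Testing with the zero form shows \<open>1 \<le> A\<close>, so that the root in
      \<open>R\<close> is taken of a nonnegative number.\<close>
    have "0 \<le> c powr p * (\<Sum>i<k. norm ((\<lambda>u\<in>TT. 0 :: 'k) (u i) - (\<lambda>u\<in>TT. 0) (v i)) powr p)"
      by (intro mult_nonneg_nonneg sum_nonneg) auto
    then have A1: "0 \<le> A - 1" using * [OF zero_in_ball] by linarith
    define R where "R = (A - 1) powr (1 / p) / c"
    have Rp: "R powr p = (A - 1) / c powr p"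
      using A1 c p_pos by (simp add: R_def powr_divide powr_powr)
    have "sup_form k u v \<le> R"
    proof (rule sup_form_le)
      fix \<phi> assume "\<phi> \<in> BB"
      then show "(\<Sum>i<k. norm (\<phi> (u i) - \<phi> (v i)) powr p) \<le> R powr p"
        using * [of \<phi>] c unfolding Rp by (simp add: pos_le_divide_eq mult.commute)
    qed (use c in \<open>simp add: R_def\<close>)
    then have "(c * sup_form k u v) powr p \<le> (c * R) powr p"
      using c p sup_form_nonneg [of k u v, OF uv] by (intro powr_mono2 mult_left_mono) auto
    also have "\<dots> = A - 1" using c A1 p_pos by (simp add: R_def powr_powr)
    finally have "A \<le> A - 1"
      using assms uv unfolding summing_const_iff A_def by (meson order_trans)
    then show False by simp
  qed
  moreover have "continuous_map (ball_top n X) euclidean (f j)" if j: "j \<in> TT \<times> TT" for j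
  proof -
    obtain u v where uv: "j = (u, v)" "u \<in> TT" "v \<in> TT" using j by blast
    have "continuous_map (ball_top n X) euclidean (\<lambda>\<phi>. \<phi> u - \<phi> v)"
      using uv by (intro continuous_map_diff continuous_map_eval)
    moreover have "continuous_on UNIV (\<lambda>z :: 'k. c powr p * norm z powr p)"
      using p by (intro continuous_intros continuous_on_powr') auto
    ultimately have "continuous_map (ball_top n X) euclidean ((\<lambda>z :: 'k. c powr p * norm z powr p) \<circ> (\<lambda>\<phi>. \<phi> u - \<phi> v))"
      by (intro continuous_map_compose) auto
    then show ?thesis by (simp add: f_def uv o_def)
  qed
  moreover have "0 \<le> f j \<phi> \<and> f j \<phi> \<le> B j" if "j \<in> TT \<times> TT" "\<phi> \<in> topspace (ball_top n X)" for j \<phi>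
    using that ball_diff_le [of \<phi>] p
    by (auto simp: f_def B_def topspace_ball_top intro!: mult_left_mono powr_mono2)
  ultimately obtain M where M: "regular_prob (ball_top n X) M" "\<And>j. j \<in> TT \<times> TT \<Longrightarrow> b j \<le> (LINT \<phi>|M. f j \<phi>)"
    using exists_dominating_measure [OF compact_space_ball_top Hausdorff_ball_top, of "TT \<times> TT" f B b] by blast
  have "vdist Y (T u) (T v) \<le> c * (LINT \<phi>|M. norm (\<phi> u - \<phi> v) powr p) powr (1 / p)" if "u \<in> TT" "v \<in> TT" for u v
  proof -
    have "vdist Y (T u) (T v) powr p \<le> c powr p * (LINT \<phi>|M. norm (\<phi> u - \<phi> v) powr p)"
      using M(2) [of "(u, v)"] that by (simp add: f_def b_def)
    then have "(vdist Y (T u) (T v) powr p) powr (1 / p) \<le> (c powr p * (LINT \<phi>|M. norm (\<phi> u - \<phi> v) powr p)) powr (1 / p)"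
      using p by (intro powr_mono2) auto
    then show ?thesis
      using c p_pos Y.vdist_nonneg [of "T u" "T v"] that by (simp add: powr_mult powr_powr T_closed)
  qed
  then show ?thesis using c M(1) unfolding domination_const_def by blast
qed

lemma summing_iff_domination: "summing_const p n X Y T c \<longleftrightarrow> domination_const p n X Y T c"
  using summing_imp_domination domination_imp_summing by blast

lemma domination_iff_factors_Sigma_p:
  "(\<exists>c. domination_const p n X Y T c) \<longleftrightarrow> factors_Sigma_p p n X Y T"
proof
  assume "\<exists>c. domination_const p n X Y T c"
  then obtain c M where c: "0 < c" and M: "regular_prob (ball_top n X) M"
    and le: "\<And>u v. u \<in> TT \<Longrightarrow> v \<in> TT \<Longrightarrow> vdist Y (T u) (T v) \<le> c * vdist (Lp p M) (eval_class M u) (eval_class M v)"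
    by (auto simp: domination_const_iff)
  interpret L: normed_space "Lp p M :: ('k, (((nat \<Rightarrow> 'v) \<Rightarrow> 'k) \<Rightarrow> 'k) set) nspace" by (rule normed_space_Lp [OF p])
  \<comment> \<open>Picks a tuple for each evaluation class. By (ii), tuples with the same class
    have images at distance 0 under \<open>T\<close>, so the choice does not matter.\<close>
  define sel where "sel = (\<lambda>A. SOME u. u \<in> TT \<and> eval_class M u = A)"
  have sel: "sel (eval_class M u) \<in> TT" "eval_class M (sel (eval_class M u)) = eval_class M u" if "u \<in> TT" for u
    unfolding sel_def using someI [of "\<lambda>w. w \<in> TT \<and> eval_class M w = eval_class M u" u] that by auto
  have Tsel: "T (sel (eval_class M u)) = T u" if u: "u \<in> TT" for u
  proof -
    have "vdist (Lp p M) (eval_class M u) (eval_class M u) = 0"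
      using L.vdist_eq_zero Lp_eval_class [OF M u] by simp
    then have "vdist Y (T (sel (eval_class M u))) (T u) \<le> 0"
      using le [OF sel(1) [OF u] u] sel(2) [OF u] by simp
    then show ?thesis
      using Y.vdist_nonneg Y.vdist_eq_zero T_closed [OF sel(1) [OF u]] T_closed [OF u] by (metis order_antisym)
  qed
  let ?\<Sigma> = "eval_class M ` TT"
  have jt: "j_p M \<circ> tensor_map n X = eval_class M" by (auto simp: j_p_def eval_class_def)
  have "Lipschitz_continuous_map (submetric (nmetric (Lp p M)) ?\<Sigma>) (nmetric Y) (T \<circ> sel)"
    unfolding Lipschitz_continuous_map_def
  proof (intro conjI exI [of _ c] ballI)
    show "T \<circ> sel \<in> mspace (submetric (nmetric (Lp p M)) ?\<Sigma>) \<rightarrow> mspace (nmetric Y)"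
      by (auto simp: L.mspace_nmetric Y.mspace_nmetric Tsel T_closed)
    fix A B assume "A \<in> mspace (submetric (nmetric (Lp p M)) ?\<Sigma>)" "B \<in> mspace (submetric (nmetric (Lp p M)) ?\<Sigma>)"
    then obtain u v where "u \<in> TT" "A = eval_class M u" "v \<in> TT" "B = eval_class M v" by auto
    then show "mdist (nmetric Y) ((T \<circ> sel) A) ((T \<circ> sel) B) \<le> c * mdist (submetric (nmetric (Lp p M)) ?\<Sigma>) A B"
      using le by (simp add: Tsel Y.mdist_nmetric L.mdist_nmetric T_closed Lp_eval_class [OF M])
  qed
  moreover have "\<forall>u\<in>TT. T u = (T \<circ> sel \<circ> j_p M \<circ> tensor_map n X) u"
    using Tsel jt by (metis comp_assoc comp_apply)
  ultimately show "factors_Sigma_p p n X Y T"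
    unfolding factors_Sigma_p_def using M jt by metis
next
  assume "factors_Sigma_p p n X Y T"
  then obtain M h where M: "regular_prob (ball_top n X) M"
    and lip: "Lipschitz_continuous_map (submetric (nmetric (Lp p M)) ((j_p M \<circ> tensor_map n X) ` TT)) (nmetric Y) h"
    and h: "\<And>u. u \<in> TT \<Longrightarrow> T u = (h \<circ> j_p M \<circ> tensor_map n X) u"
    unfolding factors_Sigma_p_def by blast
  interpret L: normed_space "Lp p M :: ('k, (((nat \<Rightarrow> 'v) \<Rightarrow> 'k) \<Rightarrow> 'k) set) nspace" by (rule normed_space_Lp [OF p])
  have jt: "j_p M \<circ> tensor_map n X = eval_class M" by (auto simp: j_p_def eval_class_def)
  obtain c where c: "0 < c" "\<And>A B. A \<in> eval_class M ` TT \<Longrightarrow> A \<in> vcarrier (Lp p M) \<Longrightarrow> B \<in> eval_class M ` TT \<Longrightarrow> B \<in> vcarrier (Lp p M)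
      \<Longrightarrow> mdist (nmetric Y) (h A) (h B) \<le> c * mdist (nmetric (Lp p M)) A B"
    using lip unfolding Lipschitz_continuous_map_pos jt by (auto simp: L.mspace_nmetric)
  have "vdist Y (T u) (T v) \<le> c * vdist (Lp p M) (eval_class M u) (eval_class M v)" if "u \<in> TT" "v \<in> TT" for u v
  proof -
    have "h (eval_class M w) = T w" if "w \<in> TT" for w using h [OF that] jt by (metis comp_assoc comp_apply)
    then show ?thesis
      using c(2) [of "eval_class M u" "eval_class M v"] that Lp_eval_class [OF M]
      by (simp add: Y.mdist_nmetric L.mdist_nmetric T_closed)
  qed
  then show "\<exists>c. domination_const p n X Y T c" using c(1) M by (auto simp: domination_const_iff)
qed

end

lemma lip_norm_le:
  assumes "0 \<le> L" "\<And>x y. x \<in> mspace m1 \<Longrightarrow> y \<in> mspace m1 \<Longrightarrow> mdist m2 (h x) (h y) \<le> L * mdist m1 x y"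
  shows "lip_norm m1 m2 h \<le> L"
  unfolding lip_norm_def using assms by (intro cInf_lower) (auto intro!: bdd_belowI [where m = 0])

section \<open>Factorization through bounded functions and the norm of \<open>h\<close>\<close>

context summing_setting
begin

lemma normed_space_linf_Y: "normed_space (linf_space (dual_ball Y) :: ('k, ('y \<Rightarrow> 'k) \<Rightarrow> 'k) nspace)"
  by (rule normed_space_linf [OF Y.dual_ball_ne])

lemma factors_Linf_LpI:
  fixes M :: "'s measure" and \<nu> :: "(nat \<Rightarrow> 'v) \<Rightarrow> ('s \<Rightarrow> 'k) set"
  assumes M: "prob_space M" and \<nu>: "multilinear n X (Linf M) \<nu>" "bounded_op n X (Linf M) \<nu>" "opnorm n X (Linf M) \<nu> = 1"
    and h: "\<And>A. A \<in> vcarrier (Lp p M) \<Longrightarrow> h A \<in> vcarrier (linf_space (dual_ball Y))"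
    and lip: "\<And>A B. A \<in> vcarrier (Lp p M) \<Longrightarrow> B \<in> vcarrier (Lp p M) \<Longrightarrow>
        vdist (linf_space (dual_ball Y)) (h A) (h B) \<le> L * vdist (Lp p M) A B"
    and L: "0 \<le> L" and hT: "\<And>u. u \<in> TT \<Longrightarrow> h (\<nu> u) = i_Y Y (T u)"
  shows "factors_Linf_Lp p n X Y T M \<nu> h" and "norm_h p Y M h \<le> L"
proof -
  interpret P: normed_space "Lp p M :: ('k, ('s \<Rightarrow> 'k) set) nspace" by (rule normed_space_Lp [OF p])
  interpret Q: normed_space "linf_space (dual_ball Y) :: ('k, ('y \<Rightarrow> 'k) \<Rightarrow> 'k) nspace" by (rule normed_space_linf_Y)
  have le: "mdist (nmetric (linf_space (dual_ball Y))) (h A) (h B) \<le> L * mdist (nmetric (Lp p M)) A B"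
    if "A \<in> mspace (nmetric (Lp p M))" "B \<in> mspace (nmetric (Lp p M))" for A B
    using that lip h by (simp add: P.mspace_nmetric P.mdist_nmetric Q.mdist_nmetric)
  show "norm_h p Y M h \<le> L" using le by (intro lip_norm_le L)
  have "Lipschitz_continuous_map (nmetric (Lp p M)) (nmetric (linf_space (dual_ball Y))) h"
    unfolding Lipschitz_continuous_map_def using le h by (auto simp: P.mspace_nmetric Q.mspace_nmetric)
  then show "factors_Linf_Lp p n X Y T M \<nu> h"
    using M \<nu> hT by (simp add: factors_Linf_Lp_def i_p_def)
qed

text \<open>\<open>i_Y\<close> does not shrink distances, so every Lipschitz constant of
  \<open>h\<close> controls the increments of \<open>T\<close> by those of \<open>\<nu>\<close> in
  \<open>Lp p M\<close>. The measure may live on any type.\<close>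

lemma factors_imp_summing:
  fixes M :: "'s measure"
  assumes norming: "has_norming Y" and F: "factors_Linf_Lp p n X Y T M \<nu> h"
  shows "\<exists>c. summing_const p n X Y T c" and "\<pi>T \<le> norm_h p Y M h"
proof -
  interpret P: normed_space "Lp p M :: ('k, ('s \<Rightarrow> 'k) set) nspace" by (rule normed_space_Lp [OF p])
  interpret Q: normed_space "linf_space (dual_ball Y) :: ('k, ('y \<Rightarrow> 'k) \<Rightarrow> 'k) nspace" by (rule normed_space_linf_Y)
  let ?m1 = "nmetric (Lp p M) :: ('s \<Rightarrow> 'k) set metric"
  let ?m2 = "nmetric (linf_space (dual_ball Y)) :: (('y \<Rightarrow> 'k) \<Rightarrow> 'k) metric"
  have lipm: "Lipschitz_continuous_map ?m1 ?m2 h" and hT: "\<And>u. u \<in> TT \<Longrightarrow> i_Y Y (T u) = h (\<nu> u)"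
    using F by (auto simp: factors_Linf_Lp_def i_p_def)
  have op: "Linf_operator n X M \<nu> 1"
  proof -
    interpret prob_space M using F by (simp add: factors_Linf_Lp_def)
    show ?thesis by unfold_locales (use F in \<open>auto simp: factors_Linf_Lp_def\<close>)
  qed
  have h: "h A \<in> vcarrier (linf_space (dual_ball Y))" if "A \<in> vcarrier (Lp p M)" for A
    using Lipschitz_continuous_map_image [OF lipm] that by (auto simp: P.mspace_nmetric Q.mspace_nmetric)
  have summing: "summing_const p n X Y T c"
    if L: "0 \<le> L" "\<forall>x\<in>mspace ?m1. \<forall>y\<in>mspace ?m1. mdist ?m2 (h x) (h y) \<le> L * mdist ?m1 x y"
      and c: "0 < c" "L \<le> c" for L c
  proof (rule summing_of_Lipschitz_factor [OF op L(1) _ c(1)])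
    show "L * 1 \<le> c" using c by simp
    fix u v assume uv: "u \<in> TT" "v \<in> TT"
    have \<nu>: "\<nu> u \<in> vcarrier (Lp p M)" "\<nu> v \<in> vcarrier (Lp p M)"
      using Linf_operator.in_Lp [OF op p] uv by auto
    have "vdist Y (T u) (T v) \<le> vdist (linf_space (dual_ball Y)) (h (\<nu> u)) (h (\<nu> v))"
      using Y.vdist_i_Y [OF norming T_closed [OF uv(1)] T_closed [OF uv(2)]] uv by (simp add: hT)
    also have "\<dots> \<le> L * vdist (Lp p M) (\<nu> u) (\<nu> v)"
      using L(2) \<nu> h by (simp add: P.mspace_nmetric P.mdist_nmetric Q.mdist_nmetric)
    finally show "vdist Y (T u) (T v) \<le> L * vdist (Lp p M) (\<nu> u) (\<nu> v)" .
  qed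
  obtain B where B: "0 < B" "\<forall>x\<in>mspace ?m1. \<forall>y\<in>mspace ?m1. mdist ?m2 (h x) (h y) \<le> B * mdist ?m1 x y"
    using lipm unfolding Lipschitz_continuous_map_pos by blast
  then show ex: "\<exists>c. summing_const p n X Y T c" using summing [of B B] by auto
  show "\<pi>T \<le> norm_h p Y M h"
    unfolding lip_norm_def
  proof (rule cInf_greatest)
    show "{L. 0 \<le> L \<and> (\<forall>x\<in>mspace ?m1. \<forall>y\<in>mspace ?m1. mdist ?m2 (h x) (h y) \<le> L * mdist ?m1 x y)} \<noteq> {}"
      using B less_imp_le by blast
    fix L assume L: "L \<in> {L. 0 \<le> L \<and> (\<forall>x\<in>mspace ?m1. \<forall>y\<in>mspace ?m1. mdist ?m2 (h x) (h y) \<le> L * mdist ?m1 x y)}"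
    show "\<pi>T \<le> L"
    \<comment> \<open>\<open>L\<close> may be 0, whereas constants in \<open>summing_const\<close>
      are positive.\<close>
    proof (rule field_le_epsilon)
      fix e :: real assume "0 < e"
      then show "\<pi>T \<le> L + e" using L by (intro pi_Lip_le summing [of L]) auto
    qed
  qed
qed

text \<open>For each \<open>g\<close> in the dual ball and each basis vector \<open>b\<close>,
  \<open>g (T u) \<bullet> b\<close> is a real function of the class of \<open>u\<close> with
  Lipschitz constant \<open>c\<close>, which McShane extends without loss. Recombining the
  coordinates of a scalar costs \<open>sqrt (DIM('k))\<close>, uniformly in
  \<open>g\<close>.\<close>

lemma exists_Lipschitz_extension:
  assumes M: "regular_prob (ball_top n X) M" and c: "0 \<le> c"
    and le: "\<And>u v. u \<in> TT \<Longrightarrow> v \<in> TT \<Longrightarrow> vdist Y (T u) (T v) \<le> c * vdist (Lp p M) (eval_class M u) (eval_class M v)"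
  obtains h where
    "\<And>A. A \<in> vcarrier (Lp p M) \<Longrightarrow> h A \<in> vcarrier (linf_space (dual_ball Y))"
    "\<And>A B. A \<in> vcarrier (Lp p M) \<Longrightarrow> B \<in> vcarrier (Lp p M) \<Longrightarrow>
        vdist (linf_space (dual_ball Y)) (h A) (h B) \<le> sqrt (DIM('k)) * c * vdist (Lp p M) A B"
    "\<And>u. u \<in> TT \<Longrightarrow> h (eval_class M u) = i_Y Y (T u)"
proof -
  interpret P: normed_space "Lp p M :: ('k, (((nat \<Rightarrow> 'v) \<Rightarrow> 'k) \<Rightarrow> 'k) set) nspace" by (rule normed_space_Lp [OF p])
  let ?e = "\<lambda>g b. P.mcshane TT (eval_class M) c (\<lambda>u. g (T u) \<bullet> b)"
  define h where "h = (\<lambda>A. \<lambda>g\<in>dual_ball Y. \<Sum>b\<in>Basis. ?e g b A *\<^sub>R (b :: 'k))"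
  have ne: "TT \<noteq> {}" using unit_tuples_ne unit_tuples_subset by blast
  have a: "g (T u) \<bullet> b - g (T v) \<bullet> b \<le> c * vdist (Lp p M) (eval_class M u) (eval_class M v)"
    if "g \<in> dual_ball Y" "b \<in> Basis" "u \<in> TT" "v \<in> TT" for g u v and b :: 'k
  proof -
    have "g (T u) \<bullet> b - g (T v) \<bullet> b \<le> norm (g (T u) - g (T v))"
      using Basis_le_norm [OF that(2), of "g (T u) - g (T v)"] by (simp add: inner_diff_left)
    also have "\<dots> \<le> vdist Y (T u) (T v)" using that by (intro Y.dual_ball_diff_le T_closed)
    also have "\<dots> \<le> c * vdist (Lp p M) (eval_class M u) (eval_class M v)" using that by (intro le)
    finally show ?thesis .
  qed
  have comp: "h A g \<bullet> b = ?e g b A" if "g \<in> dual_ball Y" "b \<in> Basis" for A g b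
    using that by (simp add: h_def inner_sum_left_Basis)
  have hT: "h (eval_class M u) = i_Y Y (T u)" if u: "u \<in> TT" for u
  proof (rule ext)
    fix g
    show "h (eval_class M u) g = i_Y Y (T u) g"
    proof (cases "g \<in> dual_ball Y")
      case True
      have "?e g b (eval_class M u) = g (T u) \<bullet> b" if "b \<in> Basis" for b
        using True that u by (intro P.mcshane_extends ne c a Lp_eval_class [OF M])
      then have "h (eval_class M u) g = (\<Sum>b\<in>Basis. (g (T u) \<bullet> b) *\<^sub>R b)" using True by (simp add: h_def)
      then show ?thesis using True by (simp add: euclidean_representation i_Y_def)
    qed (simp add: h_def i_Y_def)
  qed
  have hlip: "norm (h A g - h B g) \<le> sqrt (DIM('k)) * c * vdist (Lp p M) A B"
    if AB: "A \<in> vcarrier (Lp p M)" "B \<in> vcarrier (Lp p M)" and g: "g \<in> dual_ball Y"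
    for A B :: "(((nat \<Rightarrow> 'v) \<Rightarrow> 'k) \<Rightarrow> 'k) set" and g
  proof -
    have "\<bar>(h A g - h B g) \<bullet> b\<bar> \<le> c * vdist (Lp p M) A B" if b: "b \<in> Basis" for b
      unfolding inner_diff_left comp [OF g b]
      using AB g b by (intro P.mcshane_Lipschitz ne c a Lp_eval_class [OF M])
    then have "norm (h A g - h B g) \<le> sqrt (DIM('k)) * (c * vdist (Lp p M) A B)"
      using c AB by (intro norm_le_sqrt_DIM) (auto intro!: mult_nonneg_nonneg P.vdist_nonneg)
    then show ?thesis by (simp add: mult.assoc)
  qed
  show ?thesis
  proof
    fix A :: "(((nat \<Rightarrow> 'v) \<Rightarrow> 'k) \<Rightarrow> 'k) set" assume A: "A \<in> vcarrier (Lp p M)"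
    \<comment> \<open>Any tuple serves as base point: boundedness over \<open>g\<close> follows from
      the uniform Lipschitz estimate and the known value at \<open>eval_class M u\<close>.\<close>
    obtain u where u: "u \<in> TT" using ne by blast
    have "norm (h A g) \<le> sqrt (DIM('k)) * c * vdist (Lp p M) A (eval_class M u) + vnorm Y (T u)"
      if g: "g \<in> dual_ball Y" for g
    proof -
      have "norm (h A g) \<le> norm (h A g - h (eval_class M u) g) + norm (h (eval_class M u) g)"
        by (metis diff_add_cancel norm_triangle_ineq)
      moreover have "norm (h (eval_class M u) g) \<le> vnorm Y (T u)"
        using Y.dual_ball_le [OF g T_closed [OF u]] g by (simp add: hT u i_Y_def)
      ultimately show ?thesis using hlip [OF A Lp_eval_class [OF M u] g] by linarith
    qed
    then show "h A \<in> vcarrier (linf_space (dual_ball Y))"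
      by (auto simp: linf_space_def h_def cong: image_cong intro!: bdd_aboveI2)
  next
    fix A B :: "(((nat \<Rightarrow> 'v) \<Rightarrow> 'k) \<Rightarrow> 'k) set" assume "A \<in> vcarrier (Lp p M)" "B \<in> vcarrier (Lp p M)"
    then show "vdist (linf_space (dual_ball Y)) (h A) (h B) \<le> sqrt (DIM('k)) * c * vdist (Lp p M) A B"
      using hlip by (intro vdist_linf_least Y.dual_ball_ne)
  qed (rule hT)
qed

text \<open>The product of functionals \<open>g i\<close> of absolute value 1 at unit vectors
  \<open>x i\<close>. It stands in for the evaluation operator when \<open>\<pi>T = 0\<close>, where
  optimality of the constant says nothing about the norm of that operator.\<close>

lemma exists_norm_one_form:
  assumes norming: "\<And>i. i < n \<Longrightarrow> has_norming (X i)" and nz: "\<And>i. i < n \<Longrightarrow> vcarrier (X i) \<noteq> {vzero (X i)}"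
  obtains \<phi> u where "multilinear n X scalars \<phi>" "\<And>u. u \<in> unit_tuples n X \<Longrightarrow> norm (\<phi> u) \<le> 1"
    "u \<in> unit_tuples n X" "norm (\<phi> u) = 1"
proof -
  have "\<exists>x g. x \<in> vcarrier (X i) \<and> vnorm (X i) x = 1 \<and> g \<in> dual_ball (X i) \<and> norm (g x) = 1" if i: "i < n" for i
  proof -
    interpret Xi: normed_space "X i" by (rule X [OF i])
    obtain y where y: "y \<in> vcarrier (X i)" "y \<noteq> vzero (X i)" using nz [OF i] Xi.zero_closed by blast
    then have pos: "0 < vnorm (X i) y" using Xi.norm_nonneg Xi.norm_eq_zero by (metis order_le_less)
    define x where "x = vscale (X i) (of_real (inverse (vnorm (X i) y))) y"
    have x: "x \<in> vcarrier (X i)" "vnorm (X i) x = 1"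
      using y pos by (auto simp: x_def Xi.scale_closed Xi.norm_scale norm_inverse)
    then show ?thesis using norming [OF i] unfolding has_norming_def by metis
  qed
  then obtain x g where xg: "\<And>i. i < n \<Longrightarrow> x i \<in> vcarrier (X i) \<and> vnorm (X i) (x i) = 1 \<and> g i \<in> dual_ball (X i) \<and> norm (g i (x i)) = 1"
    by metis
  define \<phi> where "\<phi> = (\<lambda>u. \<Prod>i<n. g i (u i))"
  have split: "\<phi> (u(i := y)) = g i y * (\<Prod>j\<in>{..<n} - {i}. g j (u j))" if "i < n" for u i y
  proof -
    have "\<phi> (u(i := y)) = g i ((u(i := y)) i) * (\<Prod>j\<in>{..<n} - {i}. g j ((u(i := y)) j))"
      unfolding \<phi>_def using that by (intro prod.remove) auto
    also have "(\<Prod>j\<in>{..<n} - {i}. g j ((u(i := y)) j)) = (\<Prod>j\<in>{..<n} - {i}. g j (u j))"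
      by (intro prod.cong) auto
    finally show ?thesis by (simp only: fun_upd_same)
  qed
  show ?thesis
  proof
    show "multilinear n X scalars \<phi>"
      unfolding multilinear_scalars using xg by (auto simp: split dual_ball_def distrib_right mult.assoc)
    show "norm (\<phi> u) \<le> 1" if u: "u \<in> unit_tuples n X" for u
    proof -
      have "norm (g i (u i)) \<le> 1" if i: "i < n" for i
        using normed_space.dual_ball_le [OF X [OF i], of "g i" "u i"] xg [OF i] u i unit_tuples_subset
        by (force simp: unit_tuples_def tuples_nth)
      then show ?thesis unfolding \<phi>_def prod_norm [symmetric] by (intro prod_le_1) auto
    qed
    show "(\<lambda>i\<in>{..<n}. x i) \<in> unit_tuples n X"
      using xg by (auto simp: unit_tuples_def intro!: tuplesI)
    show "norm (\<phi> (\<lambda>i\<in>{..<n}. x i)) = 1"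
      unfolding \<phi>_def prod_norm [symmetric] using xg by (auto intro!: prod.neutral)
  qed
qed

text \<open>A domination measure for the optimal constant lives on forms of norm essentially \<open>1\<close>:
  otherwise rescaling would improve the constant.\<close>

lemma exists_factors_pos:
  assumes ex: "summing_const p n X Y T c0" and pos: "0 < \<pi>T"
  shows "\<exists>(M :: ((nat \<Rightarrow> 'v) \<Rightarrow> 'k) measure) \<nu> h. factors_Linf_Lp p n X Y T M \<nu> h \<and>
    norm_h p Y M h \<le> sqrt (DIM('k)) * \<pi>T"
proof -
  have "domination_const p n X Y T \<pi>T"
    using summing_pi_Lip [OF ex pos] by (rule summing_imp_domination)
  then obtain M where M: "regular_prob (ball_top n X) M"
    and le: "\<And>u v. u \<in> TT \<Longrightarrow> v \<in> TT \<Longrightarrow> vdist Y (T u) (T v) \<le> \<pi>T * vdist (Lp p M) (eval_class M u) (eval_class M v)"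
    by (auto simp: domination_const_iff)
  let ?o = "opnorm n X (Linf M) (eval_class M)"
  have "?o = 1"
  proof (rule ccontr)
    assume "?o \<noteq> 1"
    then have lt: "?o < 1" using opnorm_eval_class [OF M] by simp
    \<comment> \<open>The norm \<open>?o\<close> might be 0, whereas \<open>Linf_operator\<close>
      asks for a positive bound; any number strictly between 0 and 1 could replace
      \<open>1/2\<close>.\<close>
    define s where "s = max (1/2) ?o"
    have s: "0 < s" "s < 1" "?o \<le> s" using lt by (auto simp: s_def)
    have "summing_const p n X Y T (\<pi>T * s)"
      using s pos by (intro summing_of_Lipschitz_factor [OF Linf_operator_eval_class [OF M s(3,1)] _ le]) auto
    then have "\<pi>T \<le> \<pi>T * s" by (rule pi_Lip_le)
    then show False using s pos by simp
  qed
  moreover obtain h where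
    "\<And>A. A \<in> vcarrier (Lp p M) \<Longrightarrow> h A \<in> vcarrier (linf_space (dual_ball Y))"
    "\<And>A B. A \<in> vcarrier (Lp p M) \<Longrightarrow> B \<in> vcarrier (Lp p M) \<Longrightarrow>
        vdist (linf_space (dual_ball Y)) (h A) (h B) \<le> sqrt (DIM('k)) * \<pi>T * vdist (Lp p M) A B"
    "\<And>u. u \<in> TT \<Longrightarrow> h (eval_class M u) = i_Y Y (T u)"
    using exists_Lipschitz_extension [OF M less_imp_le [OF pos] le] by blast
  moreover have "prob_space M" using M by (simp add: regular_prob_def)
  ultimately show ?thesis
    using factors_Linf_LpI [of M "eval_class M" h "sqrt (DIM('k)) * \<pi>T"]
      multilinear_eval_class [OF M] bounded_eval_class [OF M] pos by auto
qed

text \<open>\<open>T\<close> is constant, so a constant \<open>h\<close> factors it through any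
  \<open>\<nu>\<close>. Over a Dirac measure, letting \<open>\<nu> u\<close> be the class of the
  constant function \<open>\<phi> u\<close> gives norm 1 because \<open>\<phi>\<close> has norm
  1.\<close>

lemma exists_factors_zero:
  assumes ex: "summing_const p n X Y T c0" and zero: "\<pi>T = 0"
    and norming: "\<And>i. i < n \<Longrightarrow> has_norming (X i)" and nz: "\<And>i. i < n \<Longrightarrow> vcarrier (X i) \<noteq> {vzero (X i)}"
  shows "\<exists>(M :: ((nat \<Rightarrow> 'v) \<Rightarrow> 'k) measure) \<nu> h. factors_Linf_Lp p n X Y T M \<nu> h \<and> norm_h p Y M h \<le> 0"
proof -
  obtain \<phi> w where \<phi>: "multilinear n X scalars \<phi>" "\<And>u. u \<in> unit_tuples n X \<Longrightarrow> norm (\<phi> u) \<le> 1"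
    and w: "w \<in> unit_tuples n X" "norm (\<phi> w) = 1"
    using exists_norm_one_form [OF norming nz] by blast
  define M :: "((nat \<Rightarrow> 'v) \<Rightarrow> 'k) measure" where "M = return (count_space UNIV) undefined"
  interpret prob_space M unfolding M_def by (rule prob_space_return) simp
  define \<nu> where "\<nu> = (\<lambda>u. ae_class M (\<lambda>_. \<phi> u))"
  have norm\<nu>: "vnorm (Linf M) (\<nu> u) = norm (\<phi> u)" for u
    unfolding \<nu>_def by (simp add: vnorm_Linf esssup_const emeasure_space_1)
  have mult: "multilinear n X (Linf M) \<nu>"
    unfolding multilinear_def
  proof (intro conjI allI ballI impI)
    show "\<nu> \<in> TT \<rightarrow> vcarrier (Linf M)"
      by (auto simp: \<nu>_def intro!: vnorm_Linf_le(1) [where B = "norm (\<phi> u)" for u])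
  qed (use \<phi>(1) in \<open>simp_all add: \<nu>_def multilinear_scalars Linf_add Linf_scale\<close>)
  have bdd: "bounded_op n X (Linf M) \<nu>"
    unfolding bounded_op_def norm\<nu> using \<phi>(2) by (intro bdd_aboveI2)
  have op: "opnorm n X (Linf M) \<nu> = 1"
  proof (rule antisym)
    show "opnorm n X (Linf M) \<nu> \<le> 1"
      unfolding opnorm_def norm\<nu> using \<phi>(2) by (intro cSUP_least unit_tuples_ne)
    have "norm (\<phi> w) \<le> opnorm n X (Linf M) \<nu>"
      unfolding opnorm_def norm\<nu> [symmetric] using bdd w by (intro cSUP_upper) (auto simp: bounded_op_def)
    then show "1 \<le> opnorm n X (Linf M) \<nu>" using w by simp
  qed
  have wT: "w \<in> TT" using w unit_tuples_subset by blast
  interpret Q: normed_space "linf_space (dual_ball Y) :: ('k, ('y \<Rightarrow> 'k) \<Rightarrow> 'k) nspace" by (rule normed_space_linf_Y)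
  have iw: "i_Y Y (T w) \<in> vcarrier (linf_space (dual_ball Y))" by (intro Y.i_Y_carrier T_closed wT)
  have "vdist (linf_space (dual_ball Y)) (i_Y Y (T w)) (i_Y Y (T w)) = 0"
    using Q.vdist_eq_zero iw by simp
  then show ?thesis
    using factors_Linf_LpI [OF prob_space_axioms mult bdd op, of "\<lambda>_. i_Y Y (T w)" 0] iw
      T_const_if_pi_Lip_zero [OF ex zero _ wT] by fastforce
qed

text \<open>\<open>DIM('k)\<close> carries the dependence on the field: it is 1 for real and 2 for
  complex scalars, which yields equality of the norms and the factor \<open>sqrt 2\<close>,
  respectively.\<close>

theorem summing_equivalences:
  assumes normingY: "has_norming Y"
    and norming: "\<forall>i<n. has_norming (X i) \<and> vcarrier (X i) \<noteq> {vzero (X i)}"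
  shows "(\<exists>c. summing_const p n X Y T c) \<longleftrightarrow> (\<exists>c. domination_const p n X Y T c)"
    and "(\<exists>c. summing_const p n X Y T c) \<longleftrightarrow> factors_Sigma_p p n X Y T"
    and "(\<exists>c. summing_const p n X Y T c) \<longleftrightarrow>
      (\<exists>(M :: ((nat \<Rightarrow> 'v) \<Rightarrow> 'k) measure) \<nu> h. factors_Linf_Lp p n X Y T M \<nu> h)"
    and "\<pi>T = Inf {c. domination_const p n X Y T c}"
    and "(\<exists>c. summing_const p n X Y T c) \<Longrightarrow>
      \<exists>(M :: ((nat \<Rightarrow> 'v) \<Rightarrow> 'k) measure) \<nu> h. factors_Linf_Lp p n X Y T M \<nu> h \<and>
        \<pi>T \<le> norm_h p Y M h \<and> norm_h p Y M h \<le> sqrt (DIM('k)) * \<pi>T"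
proof -
  show "(\<exists>c. summing_const p n X Y T c) \<longleftrightarrow> (\<exists>c. domination_const p n X Y T c)"
    by (simp add: summing_iff_domination)
  then show "(\<exists>c. summing_const p n X Y T c) \<longleftrightarrow> factors_Sigma_p p n X Y T"
    by (simp add: domination_iff_factors_Sigma_p)
  show "\<pi>T = Inf {c. domination_const p n X Y T c}"
    by (simp add: pi_Lip_def summing_iff_domination)
  show *: "\<exists>(M :: ((nat \<Rightarrow> 'v) \<Rightarrow> 'k) measure) \<nu> h. factors_Linf_Lp p n X Y T M \<nu> h \<and>
      \<pi>T \<le> norm_h p Y M h \<and> norm_h p Y M h \<le> sqrt (DIM('k)) * \<pi>T"
    if ex: "\<exists>c. summing_const p n X Y T c"
  proof -
    obtain c where c: "summing_const p n X Y T c" using ex by blast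
    have "\<exists>(M :: ((nat \<Rightarrow> 'v) \<Rightarrow> 'k) measure) \<nu> h. factors_Linf_Lp p n X Y T M \<nu> h \<and>
        norm_h p Y M h \<le> sqrt (DIM('k)) * \<pi>T"
    proof (cases "\<pi>T = 0")
      case True
      then show ?thesis using exists_factors_zero [OF c True] norming by simp
    next
      case False
      then show ?thesis using exists_factors_pos [OF c] pi_Lip_nonneg [OF c] by simp
    qed
    then show ?thesis using factors_imp_summing(2) [OF normingY] by blast
  qed
  then show "(\<exists>c. summing_const p n X Y T c) \<longleftrightarrow>
      (\<exists>(M :: ((nat \<Rightarrow> 'v) \<Rightarrow> 'k) measure) \<nu> h. factors_Linf_Lp p n X Y T M \<nu> h)"
    using factors_imp_summing(1) [OF normingY] by blast
qed

end

lemma setting_summing_setting: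
  fixes X :: "nat \<Rightarrow> ('k::{real_normed_field, euclidean_space}, 'v) nspace"
  assumes "setting n X Y T" "1 \<le> p"
  shows "summing_setting n X Y p T"
  using assms unfolding setting_def summing_setting_def summing_setting_axioms_def normed_product_def
  by (auto simp: banach_space_def)

text \<open>Existence is claimed on the type of forms, while the converse and the lower bound
  concern measures on an arbitrary type \<open>'s\<close>. Together they express (iv) for
  probability spaces over any set.\<close>

theorem theorem3p1:
  fixes p :: real and n :: nat
    and XR :: "nat \<Rightarrow> (real, 'a) nspace" and YR :: "(real, 'b) nspace"
    and TR :: "(nat \<Rightarrow> 'a) \<Rightarrow> 'b"
    and XC :: "nat \<Rightarrow> (complex, 'c) nspace" and YC :: "(complex, 'd) nspace"
    and TC :: "(nat \<Rightarrow> 'c) \<Rightarrow> 'd"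
  assumes p: "1 \<le> p"
  shows
    "(setting n XR YR TR \<longrightarrow>
       ((\<exists>c. summing_const p n XR YR TR c) \<longleftrightarrow> (\<exists>c. domination_const p n XR YR TR c)) \<and>
       ((\<exists>c. summing_const p n XR YR TR c) \<longleftrightarrow> factors_Sigma_p p n XR YR TR) \<and>
       ((\<exists>c. summing_const p n XR YR TR c) \<longleftrightarrow>
          (\<exists>(M :: ((nat \<Rightarrow> 'a) \<Rightarrow> real) measure) \<nu> h. factors_Linf_Lp p n XR YR TR M \<nu> h)) \<and>
       ((\<exists>(M :: 's measure) \<nu> h. factors_Linf_Lp p n XR YR TR M \<nu> h) \<longrightarrow>
          (\<exists>c. summing_const p n XR YR TR c)) \<and>
       ((\<exists>c. summing_const p n XR YR TR c) \<longrightarrow>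
          pi_Lip p n XR YR TR = Inf {c. domination_const p n XR YR TR c} \<and>
          (\<exists>(M :: ((nat \<Rightarrow> 'a) \<Rightarrow> real) measure) \<nu> h.
             factors_Linf_Lp p n XR YR TR M \<nu> h \<and> norm_h p YR M h = pi_Lip p n XR YR TR) \<and>
          (\<forall>(M :: 's measure) \<nu> h. factors_Linf_Lp p n XR YR TR M \<nu> h \<longrightarrow>
             pi_Lip p n XR YR TR \<le> norm_h p YR M h)))
     \<and>
     (setting n XC YC TC \<longrightarrow>
       ((\<exists>c. summing_const p n XC YC TC c) \<longleftrightarrow> (\<exists>c. domination_const p n XC YC TC c)) \<and>
       ((\<exists>c. summing_const p n XC YC TC c) \<longleftrightarrow> factors_Sigma_p p n XC YC TC) \<and>
       ((\<exists>c. summing_const p n XC YC TC c) \<longleftrightarrow>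
          (\<exists>(M :: ((nat \<Rightarrow> 'c) \<Rightarrow> complex) measure) \<nu> h. factors_Linf_Lp p n XC YC TC M \<nu> h)) \<and>
       ((\<exists>(M :: 's measure) \<nu> h. factors_Linf_Lp p n XC YC TC M \<nu> h) \<longrightarrow>
          (\<exists>c. summing_const p n XC YC TC c)) \<and>
       ((\<exists>c. summing_const p n XC YC TC c) \<longrightarrow>
          pi_Lip p n XC YC TC = Inf {c. domination_const p n XC YC TC c} \<and>
          (\<exists>(M :: ((nat \<Rightarrow> 'c) \<Rightarrow> complex) measure) \<nu> h.
             factors_Linf_Lp p n XC YC TC M \<nu> h \<and>
             pi_Lip p n XC YC TC \<le> norm_h p YC M h \<and>
             norm_h p YC M h \<le> sqrt 2 * pi_Lip p n XC YC TC) \<and>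
          (\<forall>(M :: 's measure) \<nu> h. factors_Linf_Lp p n XC YC TC M \<nu> h \<longrightarrow>
             pi_Lip p n XC YC TC \<le> norm_h p YC M h)))"
proof (intro conjI impI allI)
  assume S: "setting n XR YR TR"
  interpret summing_setting n XR YR p TR by (rule setting_summing_setting [OF S p])
  have normingY: "has_norming YR"
    using Y.normed_space_axioms by (rule has_norming_real)
  have norming: "\<forall>i<n. has_norming (XR i) \<and> vcarrier (XR i) \<noteq> {vzero (XR i)}"
    using S by (auto simp: setting_def intro!: has_norming_real X)
  note eq = summing_equivalences [OF normingY norming]
  show "(\<exists>c. summing_const p n XR YR TR c) \<longleftrightarrow> (\<exists>c. domination_const p n XR YR TR c)"
    by (rule eq(1))
  show "(\<exists>c. summing_const p n XR YR TR c) \<longleftrightarrow> factors_Sigma_p p n XR YR TR"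
    by (rule eq(2))
  show "(\<exists>c. summing_const p n XR YR TR c) \<longleftrightarrow>
       (\<exists>(M :: ((nat \<Rightarrow> 'a) \<Rightarrow> real) measure) \<nu> h. factors_Linf_Lp p n XR YR TR M \<nu> h)"
    by (rule eq(3))
  show "pi_Lip p n XR YR TR = Inf {c. domination_const p n XR YR TR c}"
    by (rule eq(4))
  show "\<exists>c. summing_const p n XR YR TR c"
    if "\<exists>(M :: 's measure) \<nu> h. factors_Linf_Lp p n XR YR TR M \<nu> h"
    using that factors_imp_summing(1) [OF normingY] by blast
  show "pi_Lip p n XR YR TR \<le> norm_h p YR M h"
    if "factors_Linf_Lp p n XR YR TR M \<nu> h" for M :: "'s measure" and \<nu> h
    using that by (rule factors_imp_summing(2) [OF normingY])
  show "\<exists>(M :: ((nat \<Rightarrow> 'a) \<Rightarrow> real) measure) \<nu> h.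
      factors_Linf_Lp p n XR YR TR M \<nu> h \<and> norm_h p YR M h = pi_Lip p n XR YR TR"
    if "\<exists>c. summing_const p n XR YR TR c"
    using eq(5) [OF that] by (auto intro: order_antisym)
next
  assume S: "setting n XC YC TC"
  interpret summing_setting n XC YC p TC by (rule setting_summing_setting [OF S p])
  have normingY: "has_norming YC"
    using Y.normed_space_axioms by (rule has_norming_complex)
  have norming: "\<forall>i<n. has_norming (XC i) \<and> vcarrier (XC i) \<noteq> {vzero (XC i)}"
    using S by (auto simp: setting_def intro!: has_norming_complex X)
  note eq = summing_equivalences [OF normingY norming]
  show "(\<exists>c. summing_const p n XC YC TC c) \<longleftrightarrow> (\<exists>c. domination_const p n XC YC TC c)"
    by (rule eq(1))
  show "(\<exists>c. summing_const p n XC YC TC c) \<longleftrightarrow> factors_Sigma_p p n XC YC TC"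
    by (rule eq(2))
  show "(\<exists>c. summing_const p n XC YC TC c) \<longleftrightarrow>
       (\<exists>(M :: ((nat \<Rightarrow> 'c) \<Rightarrow> complex) measure) \<nu> h. factors_Linf_Lp p n XC YC TC M \<nu> h)"
    by (rule eq(3))
  show "pi_Lip p n XC YC TC = Inf {c. domination_const p n XC YC TC c}"
    by (rule eq(4))
  show "\<exists>c. summing_const p n XC YC TC c"
    if "\<exists>(M :: 's measure) \<nu> h. factors_Linf_Lp p n XC YC TC M \<nu> h"
    using that factors_imp_summing(1) [OF normingY] by blast
  show "pi_Lip p n XC YC TC \<le> norm_h p YC M h"
    if "factors_Linf_Lp p n XC YC TC M \<nu> h" for M :: "'s measure" and \<nu> h
    using that by (rule factors_imp_summing(2) [OF normingY])
  show "\<exists>(M :: ((nat \<Rightarrow> 'c) \<Rightarrow> complex) measure) \<nu> h.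
      factors_Linf_Lp p n XC YC TC M \<nu> h \<and> pi_Lip p n XC YC TC \<le> norm_h p YC M h \<and>
      norm_h p YC M h \<le> sqrt 2 * pi_Lip p n XC YC TC"
    if "\<exists>c. summing_const p n XC YC TC c"
    using eq(5) [OF that] by (auto intro: order_antisym)
qed

end
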